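(* Let $m,n\ge1$. The superalgebra $k_q[GL(m|n)]$ is a coalgebra, with comultiplication $\Delta$ and counit $\epsilon$ the superalgebra homomorphisms given on generators by $$\Delta(a_{ij})=\sum_{k=1}^{m+n}a_{ik}\otimes a_{kj},$$ $$\Delta(D_1^{-1})=\sum_{i=1}^{2mn+2}(-1)^{i-1}R_0^{-1}\bigl[R_0^{-1}(q^{-2}R_1+q^{-4}R_2+\dots+q^{-2m}R_m)\bigr]^{i-1},$$ $$\Delta(D_2^{-1})=\sum_{i=1}^{2mn+2}(-1)^{i-1}S_0^{-1}\bigl[S_0^{-1}(q^{-2}S_1+q^{-4}S_2+\dots+q^{-2n}S_n)\bigr]^{i-1},$$ $$\epsilon(a_{ij})=\delta_{ij},\qquad \epsilon(D_1^{-1})=1,\qquad \epsilon(D_2^{-1})=1 .$$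
   Context: $k$ is an algebraically closed field and $k_q=k[q,q^{-1}]$ with $q$ an even indeterminate. Let $p(i)=0$ for $1\le i\le m$ and $p(i)=1$ for $m+1\le i\le m+n$. $k_q[M(m|n)]$ is the superalgebra over $k_q$ generated by $a_{ij}$, $1\le i,j\le m+n$, of parity $\pi(a_{ij})=p(i)+p(j) \bmod 2$ (even ones written $x_{ij}$, odd ones $\xi_{ij}$), with relations $\xi_{ij}^2=0$ and - $a_{ij}a_{il}=(-1)^{\pi(a_{ij})\pi(a_{il})}q^{(-1)^{p(i)+1}}a_{il}a_{ij}$ for $j<l$; - $a_{ij}a_{kj}=(-1)^{\pi(a_{ij})\pi(a_{kj})}q^{(-1)^{p(j)+1}}a_{kj}a_{ij}$ for $i<k$; - $a_{ij}a_{kl}=(-1)^{\pi(a_{ij})\pi(a_{kl})}a_{kl}a_{ij}$ for $i<k,\ j>l$ or $i>k,\ j<l$; - $a_{ij}a_{kl}-(-1)^{\pi(a_{ij})\pi(a_{kl})}a_{kl}a_{ij}=(-1)^{p(j)p(k)+p(j)p(l)+p(k)p(l)}(q^{-1}-q)\,a_{il}a_{kj}$ for $i<k,\ j<l$. Quantum determinants ($l(\sigma)$ is the length of the permutation $\sigma$): $D_1=\sum_{\sigma\in S_m}(-q)^{-l(\sigma)}x_{1,\sigma(1)}\cdots x_{m,\sigma(m)}$ and $D_2=\sum_{\sigma\in S_n}(-q)^{l(\sigma)}x_{m+1,m+\sigma(1)}\cdots x_{m+n,m+\sigma(n)}$. $k_q[GL(m|n)]$ is obtained from $k_q[M(m|n)]$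 by adjoining even generators $D_1^{-1},D_2^{-1}$ which are two-sided inverses of $D_1,D_2$. Tensor products of superalgebras (over $k_q$) carry the product $(a\otimes b)(c\otimes d)=(-1)^{\pi(b)\pi(c)}ac\otimes bd$. In $k_q[GL(m|n)]\otimes k_q[GL(m|n)]$ define, for $0\le i\le m$, $$R_i=\sum_{\sigma\in S_m}\ \sum_{(k_1,\dots,k_m)}(-q)^{-l(\sigma)}\,(a_{1,k_1}\otimes a_{k_1,\sigma(1)})\cdots(a_{m,k_m}\otimes a_{k_m,\sigma(m)}),$$ summing over $(k_1,\dots,k_m)\in\{1,\dots,m+n\}^m$ with exactly $i$ of the $k_j$ greater than $m$; and for $0\le i\le n$, $$S_i=\sum_{\theta\in S_n}\ \sum_{(l_1,\dots,l_n)}(-q)^{l(\theta)}\,(a_{m+1,l_1}\otimes a_{l_1,m+\theta(1)})\cdots(a_{m+n,l_n}\otimes a_{l_n,m+\theta(n)}),$$ summing over $(l_1,\dots,l_n)\in\{1,\dots,m+n\}^n$ with exactly $i$ of the $l_j$ at most $m$. One has $R_0=D_1\otimes D_1$ and $S_0=D_2\otimes D_2$ (hence invertible), and $\Delta(D_1)=\sum_{i=0}^mR_i$, $\Delta(D_2)=\sum_{i=0}^nS_i$. *)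

theory Defs
  imports
    "HOL-Library.Poly_Mapping"
    "HOL-Library.Cardinality"
    "HOL-Library.FuncSet"
    "HOL-Computational_Algebra.Polynomial"
    "HOL-Combinatorics.Permutations"
begin

section \<open>Free modules and Laurent polynomials\<close>

definition fscale :: "'r::comm_ring_1 \<Rightarrow> ('a \<Rightarrow>\<^sub>0 'r) \<Rightarrow> ('a \<Rightarrow>\<^sub>0 'r)"
  where "fscale c x = Poly_Mapping.map ((*) c) x"

lemma lookup_fscale [simp]: "Poly_Mapping.lookup (fscale c x) a = c * Poly_Mapping.lookup x a"
  unfolding fscale_def by transfer (simp add: when_def)

interpretation free: module "fscale :: 'r::comm_ring_1 \<Rightarrow> ('a \<Rightarrow>\<^sub>0 'r) \<Rightarrow> _"
  by standard (auto intro!: poly_mapping_eqI simp: lookup_add algebra_simps)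

lemma fscale_single [simp]: "fscale c (Poly_Mapping.single a d) = Poly_Mapping.single a (c * d)"
  by (rule poly_mapping_eqI) (simp add: lookup_single when_def)

lemma fscale_single_1: "Poly_Mapping.single a d = fscale d (Poly_Mapping.single a 1)"
  by simp

lemma fscale_mult_left: "fscale c x * y = fscale c (x * y :: 'a::monoid_add \<Rightarrow>\<^sub>0 'r::comm_ring_1)"
  by (simp add: fscale_def mult_map_scale_conv_mult mult.assoc)

lemma poly_mapping_single_induct [case_names zero single add]:
  assumes "P 0" "\<And>a c. P (Poly_Mapping.single a c)" "\<And>x y. P x \<Longrightarrow> P y \<Longrightarrow> P (x + y)"
  shows "P (x :: 'a \<Rightarrow>\<^sub>0 'b::comm_monoid_add)"
proof (induction x rule: update_induct)
  case const
  show ?case by (simp add: assms(1))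
next
  case (update p a b)
  have "Poly_Mapping.update a b p = p + Poly_Mapping.single a b"
    using update(1) by (intro poly_mapping_eqI)
      (auto simp: lookup_update lookup_add lookup_single when_def in_keys_iff)
  with update assms show ?case by simp
qed

lemma fscale_mult_right: "x * fscale c y = fscale c (x * y :: 'a::monoid_add \<Rightarrow>\<^sub>0 'r::comm_ring_1)"
proof -
  have *: "x * Poly_Mapping.single 0 c = Poly_Mapping.single 0 c * x"
    by (induction x rule: poly_mapping_single_induct)
      (simp_all add: mult_single algebra_simps mult.commute)
  show ?thesis
    unfolding fscale_def mult_map_scale_conv_mult by (metis * mult.assoc)
qed

definition lin_ext :: "('r::comm_ring_1 \<Rightarrow> 'c::ab_group_add \<Rightarrow> 'c) \<Rightarrow> ('a \<Rightarrow> 'c) \<Rightarrow> ('a \<Rightarrow>\<^sub>0 'r) \<Rightarrow> 'c"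
  where "lin_ext s f x = (\<Sum>a\<in>Poly_Mapping.keys x. s (Poly_Mapping.lookup x a) (f a))"

lemma lin_ext_superset:
  assumes "module s" "finite A" "Poly_Mapping.keys x \<subseteq> A"
  shows "lin_ext s f x = (\<Sum>a\<in>A. s (Poly_Mapping.lookup x a) (f a))"
proof -
  interpret module s by fact
  show ?thesis unfolding lin_ext_def
    by (rule sum.mono_neutral_left) (use assms in \<open>auto simp: in_keys_iff\<close>)
qed

lemma lin_ext_hom:
  fixes f :: "'a \<Rightarrow> 'c::ab_group_add" and s :: "'r::comm_ring_1 \<Rightarrow> 'c \<Rightarrow> 'c"
  assumes "module s"
  shows "module_hom fscale s (lin_ext s f)"
proof -
  interpret module s by fact
  show ?thesis
  proof
    fix x y :: "'a \<Rightarrow>\<^sub>0 'r" and r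
    let ?A = "Poly_Mapping.keys x \<union> Poly_Mapping.keys y"
    have "Poly_Mapping.keys (x + y) \<subseteq> ?A" by (rule keys_add)
    then show "lin_ext s f (x + y) = lin_ext s f x + lin_ext s f y"
      by (simp add: lin_ext_superset[OF assms, of ?A] lookup_add scale_left_distrib sum.distrib)
    have "Poly_Mapping.keys (fscale r x) \<subseteq> Poly_Mapping.keys x"
      by (auto simp: in_keys_iff)
    then show "lin_ext s f (fscale r x) = s r (lin_ext s f x)"
      by (simp add: lin_ext_superset[OF assms, of "Poly_Mapping.keys x"] scale_sum_right)
  qed
qed

lemma lin_ext_single:
  assumes "module s"
  shows "lin_ext s f (Poly_Mapping.single a c) = s c (f a)"
proof -
  interpret module s by fact
  show ?thesis by (simp add: lin_ext_superset[OF assms, of "{a}"])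
qed

text \<open>The group algebra of \<open>\<int>\<close> is the Laurent polynomial ring \<open>k[q, 1/q]\<close>.\<close>

type_synonym 'k laurent = "int \<Rightarrow>\<^sub>0 'k"

definition qpow :: "int \<Rightarrow> 'k::field laurent"
  where "qpow z = Poly_Mapping.single z 1"

abbreviation qv :: "'k::field laurent" where "qv \<equiv> qpow 1"
abbreviation qinv :: "'k::field laurent" where "qinv \<equiv> qpow (- 1)"


section \<open>The superalgebra of the quantum general linear supergroup\<close>

text \<open>The dimensions are \<open>m = CARD('m)\<close> and \<open>n = CARD('n)\<close>; matrix indices are
  literally the numbers \<open>1, \<dots>, m + n\<close>.\<close>

typedef ('m::finite, 'n::finite) idx = "{1..CARD('m) + CARD('n)}"
  morphisms num ix
  by (rule exI[of _ 1]) (simp add: Suc_le_eq)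

lemma bij_betw_ix:
  "bij_betw (ix :: nat \<Rightarrow> ('m::finite, 'n::finite) idx) {1..CARD('m) + CARD('n)} UNIV"
  by (rule bij_betw_byWitness[where f' = num])
    (use num[where ?'m = 'm and ?'n = 'n] in \<open>auto simp: ix_inverse num_inverse\<close>)

instance idx :: (finite, finite) finite
  by standard (metis bij_betw_finite bij_betw_ix finite_atLeastAtMost)

definition ipar :: "('m::finite, 'n::finite) idx \<Rightarrow> nat"
  where "ipar i = (if num i \<le> CARD('m) then 0 else 1)"

datatype ('m, 'n) gen = Mat "('m::finite, 'n::finite) idx" "('m, 'n) idx" | D1_inv | D2_inv

definition apar :: "('m::finite, 'n::finite) idx \<Rightarrow> ('m, 'n) idx \<Rightarrow> nat"
  where "apar i j = (ipar i + ipar j) mod 2"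

fun gpar :: "('m::finite, 'n::finite) gen \<Rightarrow> nat" where
  "gpar (Mat i j) = apar i j"
| "gpar D1_inv = 0"
| "gpar D2_inv = 0"

text \<open>The free monoid, written additively so that \<open>'g word \<Rightarrow>\<^sub>0 'r\<close> is the free associative
  \<open>'r\<close>-algebra on \<open>'g\<close>.\<close>

datatype 'g word = Word (letters: "'g list")

instantiation word :: (type) monoid_add
begin
definition zero_word :: "'a word" where "zero_word = Word []"
definition plus_word :: "'a word \<Rightarrow> 'a word \<Rightarrow> 'a word"
  where "plus_word u v = Word (letters u @ letters v)"
instance by standard (simp_all add: zero_word_def plus_word_def)
end

definition wpar :: "('m::finite, 'n::finite) gen word \<Rightarrow> nat"
  where "wpar w = (\<Sum>g\<leftarrow>letters w. gpar g) mod 2"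

type_synonym ('k, 'm, 'n) falg = "('m, 'n) gen word \<Rightarrow>\<^sub>0 'k laurent"

definition fgen :: "('m::finite, 'n::finite) gen \<Rightarrow> ('k::field, 'm, 'n) falg"
  where "fgen g = Poly_Mapping.single (Word [g]) 1"

abbreviation fmat :: "('m::finite, 'n::finite) idx \<Rightarrow> ('m, 'n) idx \<Rightarrow> ('k::field, 'm, 'n) falg"
  where "fmat i j \<equiv> fgen (Mat i j)"

text \<open>The length of a permutation of \<open>{1..n}\<close> is its number of inversions.\<close>

definition perm_length :: "nat \<Rightarrow> (nat \<Rightarrow> nat) \<Rightarrow> nat"
  where "perm_length n \<sigma> = card {(i, j). 1 \<le> i \<and> i < j \<and> j \<le> n \<and> \<sigma> i > \<sigma> j}"

definition fD1 :: "('k::field, 'm::finite, 'n::finite) falg" where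
  "fD1 = (\<Sum>\<sigma> | \<sigma> permutes {1..CARD('m)}. fscale ((- qinv) ^ perm_length CARD('m) \<sigma>)
     (\<Prod>j\<leftarrow>[1..<CARD('m) + 1]. fmat (ix j) (ix (\<sigma> j))))"

definition fD2 :: "('k::field, 'm::finite, 'n::finite) falg" where
  "fD2 = (\<Sum>\<sigma> | \<sigma> permutes {1..CARD('n)}. fscale ((- qv) ^ perm_length CARD('n) \<sigma>)
     (\<Prod>j\<leftarrow>[1..<CARD('n) + 1]. fmat (ix (CARD('m) + j)) (ix (CARD('m) + \<sigma> j))))"

text \<open>A relation \<open>u = v\<close> is encoded by the element \<open>u - v\<close>.\<close>

inductive_set gl_rel :: "('k::field, 'm::finite, 'n::finite) falg set" where
  odd_sq: "apar i j = 1 \<Longrightarrow> fmat i j * fmat i j \<in> gl_rel"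
| row: "num j < num l \<Longrightarrow>
    fmat i j * fmat i l
      - fscale ((- 1) ^ (apar i j * apar i l) * qpow ((- 1) ^ (ipar i + 1)))
          (fmat i l * fmat i j) \<in> gl_rel"
| col: "num i < num k \<Longrightarrow>
    fmat i j * fmat k j
      - fscale ((- 1) ^ (apar i j * apar k j) * qpow ((- 1) ^ (ipar j + 1)))
          (fmat k j * fmat i j) \<in> gl_rel"
| anti: "(num i < num k \<and> num j > num l) \<or> (num i > num k \<and> num j < num l) \<Longrightarrow>
    fmat i j * fmat k l
      - fscale ((- 1) ^ (apar i j * apar k l)) (fmat k l * fmat i j) \<in> gl_rel"
| diag: "num i < num k \<Longrightarrow> num j < num l \<Longrightarrow>
    fmat i j * fmat k l
      - fscale ((- 1) ^ (apar i j * apar k l)) (fmat k l * fmat i j)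
      - fscale ((- 1) ^ (ipar j * ipar k + ipar j * ipar l + ipar k * ipar l) * (qinv - qv))
          (fmat i l * fmat k j) \<in> gl_rel"
| D1_right: "fD1 * fgen D1_inv - 1 \<in> gl_rel"
| D1_left: "fgen D1_inv * fD1 - 1 \<in> gl_rel"
| D2_right: "fD2 * fgen D2_inv - 1 \<in> gl_rel"
| D2_left: "fgen D2_inv * fD2 - 1 \<in> gl_rel"

inductive_set two_sided_ideal :: "'a::ring_1 set \<Rightarrow> 'a set" for S where
  zero: "0 \<in> two_sided_ideal S"
| gen: "s \<in> S \<Longrightarrow> x * s * y \<in> two_sided_ideal S"
| add: "x \<in> two_sided_ideal S \<Longrightarrow> y \<in> two_sided_ideal S \<Longrightarrow> x + y \<in> two_sided_ideal S"

lemma ideal_mult_left: "x \<in> two_sided_ideal S \<Longrightarrow> z * x \<in> two_sided_ideal S"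
  by (induction rule: two_sided_ideal.induct)
    (auto simp: distrib_left mult.assoc[symmetric] intro: two_sided_ideal.intros)

lemma ideal_mult_right: "x \<in> two_sided_ideal S \<Longrightarrow> x * z \<in> two_sided_ideal S"
proof (induction rule: two_sided_ideal.induct)
  case (gen s x y)
  then show ?case using two_sided_ideal.gen[of s S x "y * z"] by (simp add: mult.assoc)
qed (auto simp: distrib_right intro: two_sided_ideal.intros)

lemma ideal_uminus: "x \<in> two_sided_ideal S \<Longrightarrow> - x \<in> two_sided_ideal S"
  using ideal_mult_left[of x S "- 1"] by simp

lemma ideal_diff:
  "x \<in> two_sided_ideal S \<Longrightarrow> y \<in> two_sided_ideal S \<Longrightarrow> x - y \<in> two_sided_ideal S"
  by (metis ideal_uminus two_sided_ideal.add uminus_add_conv_diff add.commute)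

quotient_type (overloaded) ('k, 'm, 'n) kGL = "('k::field, 'm::finite, 'n::finite) falg" /
  "\<lambda>x y. x - y \<in> two_sided_ideal gl_rel"
proof (rule equivpI)
  let ?I = "two_sided_ideal (gl_rel :: ('k, 'm, 'n) falg set)"
  show "reflp (\<lambda>x y. x - y \<in> ?I)"
    by (rule reflpI) (simp add: two_sided_ideal.zero)
  show "symp (\<lambda>x y. x - y \<in> ?I)"
    by (rule sympI) (metis ideal_uminus minus_diff_eq)
  show "transp (\<lambda>x y. x - y \<in> ?I)"
  proof (rule transpI)
    fix x y z assume "x - y \<in> ?I" "y - z \<in> ?I"
    then have "(x - y) + (y - z) \<in> ?I" by (rule two_sided_ideal.add)
    then show "x - z \<in> ?I" by simp
  qed
qed

instantiation kGL :: (field, finite, finite) "{ring, monoid_mult}"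
begin

lift_definition zero_kGL :: "('a, 'b, 'c) kGL" is 0 .
lift_definition one_kGL :: "('a, 'b, 'c) kGL" is 1 .
lift_definition plus_kGL :: "('a, 'b, 'c) kGL \<Rightarrow> ('a, 'b, 'c) kGL \<Rightarrow> ('a, 'b, 'c) kGL" is "(+)"
  by (metis add_diff_add two_sided_ideal.add)
lift_definition minus_kGL :: "('a, 'b, 'c) kGL \<Rightarrow> ('a, 'b, 'c) kGL \<Rightarrow> ('a, 'b, 'c) kGL" is "(-)"
proof -
  fix x x' y y' :: "('a, 'b, 'c) falg"
  assume "x - x' \<in> two_sided_ideal gl_rel" "y - y' \<in> two_sided_ideal gl_rel"
  then have "(x - x') - (y - y') \<in> two_sided_ideal gl_rel" by (rule ideal_diff)
  then show "x - y - (x' - y') \<in> two_sided_ideal gl_rel" by (simp add: algebra_simps)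
qed
lift_definition uminus_kGL :: "('a, 'b, 'c) kGL \<Rightarrow> ('a, 'b, 'c) kGL" is uminus
  by (metis ideal_uminus minus_diff_minus)
lift_definition times_kGL :: "('a, 'b, 'c) kGL \<Rightarrow> ('a, 'b, 'c) kGL \<Rightarrow> ('a, 'b, 'c) kGL" is "(*)"
proof -
  fix x x' y y' :: "('a, 'b, 'c) falg"
  assume "x - x' \<in> two_sided_ideal gl_rel" "y - y' \<in> two_sided_ideal gl_rel"
  then have "(x - x') * y + x' * (y - y') \<in> two_sided_ideal gl_rel"
    by (intro two_sided_ideal.add ideal_mult_left ideal_mult_right)
  then show "x * y - x' * y' \<in> two_sided_ideal gl_rel" by (simp add: algebra_simps)
qed

instance
  by standard (transfer; simp add: algebra_simps two_sided_ideal.zero)+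

end

lemma abs_rep_kGL [simp]: "abs_kGL (rep_kGL x) = x"
  by (rule Quotient3_abs_rep[OF Quotient3_kGL])

lemma kGL_cases: obtains x' where "x = abs_kGL x'"
  by (rule that) (rule abs_rep_kGL[symmetric])

lemma abs_kGL_eq: "abs_kGL x = abs_kGL y \<longleftrightarrow> x - y \<in> two_sided_ideal gl_rel"
  using Quotient3_rel[OF Quotient3_kGL] by (fastforce simp: two_sided_ideal.zero)

lemma rep_abs_kGL: "rep_kGL (abs_kGL x) - x \<in> two_sided_ideal gl_rel"
  by (simp flip: abs_kGL_eq)

definition qscale :: "'k::field laurent \<Rightarrow> ('k, 'm::finite, 'n::finite) kGL \<Rightarrow> ('k, 'm, 'n) kGL"
  where "qscale c x = abs_kGL (fscale c (rep_kGL x))"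

lemma ideal_fscale: "x \<in> two_sided_ideal S \<Longrightarrow> fscale c x \<in> two_sided_ideal S"
  using ideal_mult_left[of x S "fscale c 1"] unfolding fscale_mult_left mult_1_left .

lemma qscale_abs: "qscale c (abs_kGL x) = abs_kGL (fscale c x)"
  unfolding qscale_def abs_kGL_eq free.scale_right_diff_distrib[symmetric]
  by (rule ideal_fscale[OF rep_abs_kGL])

interpretation kGL: module "qscale :: 'k::field laurent \<Rightarrow> ('k, 'm::finite, 'n::finite) kGL \<Rightarrow> _"
proof
  fix c d :: "'k laurent" and x y :: "('k, 'm, 'n) kGL"
  obtain x' where x: "x = abs_kGL x'" by (rule kGL_cases)
  obtain y' where y: "y = abs_kGL y'" by (rule kGL_cases)
  note * = x y
  show "qscale c (x + y) = qscale c x + qscale c y" "qscale (c + d) x = qscale c x + qscale d x"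
    "qscale c (qscale d x) = qscale (c * d) x" "qscale 1 x = x"
    unfolding * by (simp_all only: qscale_abs plus_kGL.abs_eq free.scale_right_distrib
        free.scale_left_distrib free.scale_scale free.scale_one)
qed

lemma qscale_mult_left: "qscale c x * y = qscale c (x * y)"
  by (cases x rule: kGL_cases; cases y rule: kGL_cases)
    (simp only: qscale_abs times_kGL.abs_eq fscale_mult_left)

lemma qscale_mult_right: "x * qscale c y = qscale c (x * y)"
  by (cases x rule: kGL_cases; cases y rule: kGL_cases)
    (simp only: qscale_abs times_kGL.abs_eq fscale_mult_right)

definition gmat :: "('m::finite, 'n::finite) idx \<Rightarrow> ('m, 'n) idx \<Rightarrow> ('k::field, 'm, 'n) kGL"
  where "gmat i j = abs_kGL (fmat i j)"

definition gD1_inv :: "('k::field, 'm::finite, 'n::finite) kGL"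
  where "gD1_inv = abs_kGL (fgen D1_inv)"

definition gD2_inv :: "('k::field, 'm::finite, 'n::finite) kGL"
  where "gD2_inv = abs_kGL (fgen D2_inv)"


section \<open>The grading\<close>

text \<open>Homogeneous components; parities are the numbers 0 (even) and 1 (odd).\<close>

lift_definition restrict_keys :: "('a \<Rightarrow> bool) \<Rightarrow> ('a \<Rightarrow>\<^sub>0 'b::zero) \<Rightarrow> ('a \<Rightarrow>\<^sub>0 'b)"
  is "\<lambda>P f a. if P a then f a else 0"
  by (erule finite_subset[rotated]) auto

definition fpart :: "nat \<Rightarrow> ('k::field, 'm::finite, 'n::finite) falg \<Rightarrow> ('k, 'm, 'n) falg"
  where "fpart d = restrict_keys (\<lambda>w. wpar w = d)"

definition fhom :: "nat \<Rightarrow> ('k::field, 'm::finite, 'n::finite) falg \<Rightarrow> bool"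
  where "fhom d x \<longleftrightarrow> (\<forall>w. Poly_Mapping.lookup x w \<noteq> 0 \<longrightarrow> wpar w = d)"

lemma lookup_fpart: "Poly_Mapping.lookup (fpart d x) w = (if wpar w = d then Poly_Mapping.lookup x w else 0)"
  unfolding fpart_def by transfer simp

lemma fpart_add: "fpart d (x + y) = fpart d x + fpart d y"
  by (rule poly_mapping_eqI) (simp add: lookup_fpart lookup_add)

lemma fpart_diff: "fpart d (x - y) = fpart d x - fpart d y"
  by (rule poly_mapping_eqI) (simp add: lookup_fpart lookup_minus)

lemma fpart_scale: "fpart d (fscale c x) = fscale c (fpart d x)"
  by (rule poly_mapping_eqI) (simp add: lookup_fpart)

lemma fpart_zero [simp]: "fpart d 0 = 0"
  by (rule poly_mapping_eqI) (simp add: lookup_fpart)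

lemma fpart_fhom: "fhom h x \<Longrightarrow> fpart d x = (if d = h then x else 0)"
  by (rule poly_mapping_eqI) (auto simp: lookup_fpart fhom_def)

lemma fhom_fpart: "fhom d (fpart d x)"
  by (simp add: fhom_def lookup_fpart)

lemma wpar_less: "wpar w < 2"
  by (simp add: wpar_def)

lemma fpart_sum: "fpart 0 x + fpart 1 x = x"
proof (rule poly_mapping_eqI)
  fix w
  show "Poly_Mapping.lookup (fpart 0 x + fpart 1 x) w = Poly_Mapping.lookup x w"
    using wpar_less[of w] by (auto simp: lookup_add lookup_fpart)
qed

lemma wpar_plus: "wpar (u + v) = (wpar u + wpar v) mod 2"
  by (simp add: wpar_def plus_word_def mod_simps)

lemma fhom_mult:
  assumes "fhom a x" "fhom b y" "d = (a + b) mod 2"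
  shows "fhom d (x * y)"
proof -
  have "wpar w = d" if "w \<in> Poly_Mapping.keys (x * y)" for w
  proof -
    have "w \<in> {u + v | u v. u \<in> Poly_Mapping.keys x \<and> v \<in> Poly_Mapping.keys y}"
      using keys_mult that by (rule subsetD)
    then obtain u v where w: "w = u + v"
      and uv: "u \<in> Poly_Mapping.keys x" "v \<in> Poly_Mapping.keys y" by blast
    from uv assms(1,2) have "wpar u = a" "wpar v = b" by (simp_all add: fhom_def in_keys_iff)
    then show ?thesis by (simp only: w wpar_plus assms(3))
  qed
  then show ?thesis by (simp add: fhom_def in_keys_iff)
qed

lemma fhom_add: "fhom d x \<Longrightarrow> fhom d y \<Longrightarrow> fhom d (x + y)"
  unfolding fhom_def lookup_add
proof (intro allI impI)
  fix w
  assume *: "\<forall>w. Poly_Mapping.lookup x w \<noteq> 0 \<longrightarrow> wpar w = d" "\<forall>w. Poly_Mapping.lookup y w \<noteq> 0 \<longrightarrow> wpar w = d"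
    and "Poly_Mapping.lookup x w + Poly_Mapping.lookup y w \<noteq> 0"
  then have "Poly_Mapping.lookup x w \<noteq> 0 \<or> Poly_Mapping.lookup y w \<noteq> 0" by auto
  with * show "wpar w = d" by blast
qed

lemma fhom_diff: "fhom d x \<Longrightarrow> fhom d y \<Longrightarrow> fhom d (x - y)"
  using fhom_add[of d x "- y"] by (simp add: fhom_def lookup_minus)

lemma fhom_scale: "fhom d x \<Longrightarrow> fhom d (fscale c x)"
  by (auto simp: fhom_def)

lemma fhom_sum: "(\<And>a. a \<in> A \<Longrightarrow> fhom d (f a)) \<Longrightarrow> fhom d (sum f A)"
  by (induction A rule: infinite_finite_induct) (auto intro: fhom_add simp: fhom_def[of _ 0])

lemma gpar_less: "gpar g < 2"
  by (cases g) (auto simp: apar_def)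

lemma fhom_fgen: "fhom (gpar g) (fgen g)"
  using gpar_less[of g] by (simp add: fhom_def fgen_def lookup_single when_def wpar_def)

lemma fhom_one: "fhom 0 1"
  by (simp add: fhom_def lookup_one when_def wpar_def zero_word_def)

lemma fhom_prod_list: "(\<And>a. a \<in> set xs \<Longrightarrow> fhom 0 (f a)) \<Longrightarrow> fhom 0 (\<Prod>a\<leftarrow>xs. f a)"
proof (induction xs)
  case (Cons a xs)
  then have "fhom 0 (f a)" "fhom 0 (\<Prod>a\<leftarrow>xs. f a)" by auto
  from fhom_mult[OF this, of 0] show ?case by simp
qed (simp add: fhom_one)

lemma ipar_ix:
  assumes "i \<in> {1..CARD('m) + CARD('n)}"
  shows "ipar (ix i :: ('m::finite, 'n::finite) idx) = (if i \<le> CARD('m) then 0 else 1)"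
  using assms by (simp add: ipar_def ix_inverse)

lemma fhom_fmat: "d = (ipar i + ipar j) mod 2 \<Longrightarrow> fhom d (fmat i j)"
  using fhom_fgen[of "Mat i j"] by (simp add: apar_def)

lemma fhom_fD1: "fhom 0 (fD1 :: ('k::field, 'm::finite, 'n::finite) falg)"
  unfolding fD1_def
proof (intro fhom_sum fhom_scale fhom_prod_list fhom_fmat)
  fix \<sigma> j assume \<sigma>: "\<sigma> \<in> {\<sigma>. \<sigma> permutes {1..CARD('m)}}" and j: "j \<in> set [1..<CARD('m) + 1]"
  have j': "j \<in> {1..CARD('m)}" using j by auto
  with \<sigma> have "\<sigma> j \<in> {1..CARD('m)}" using permutes_in_image[of \<sigma> "{1..CARD('m)}" j] by simp
  with j' show "0 = (ipar (ix j :: ('m, 'n) idx) + ipar (ix (\<sigma> j) :: ('m, 'n) idx)) mod 2"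
    by (simp add: ipar_ix)
qed

lemma fhom_fD2: "fhom 0 (fD2 :: ('k::field, 'm::finite, 'n::finite) falg)"
  unfolding fD2_def
proof (intro fhom_sum fhom_scale fhom_prod_list fhom_fmat)
  fix \<sigma> j assume \<sigma>: "\<sigma> \<in> {\<sigma>. \<sigma> permutes {1..CARD('n)}}" and j: "j \<in> set [1..<CARD('n) + 1]"
  have j': "j \<in> {1..CARD('n)}" using j by auto
  with \<sigma> have "\<sigma> j \<in> {1..CARD('n)}" using permutes_in_image[of \<sigma> "{1..CARD('n)}" j] by simp
  with j' show "0 = (ipar (ix (CARD('m) + j) :: ('m, 'n) idx)
      + ipar (ix (CARD('m) + \<sigma> j) :: ('m, 'n) idx)) mod 2"
    by (simp add: ipar_ix)
qed

lemma fhom_fmat2: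
  "d = (ipar i + ipar j + ipar k + ipar l) mod 2 \<Longrightarrow> fhom d (fmat i j * fmat k l)"
  by (rule fhom_mult[OF fhom_fmat[OF refl] fhom_fmat[OF refl]]) (simp add: mod_simps add.assoc)

lemma gl_rel_homogeneous: "s \<in> gl_rel \<Longrightarrow> \<exists>d. fhom d s"
proof (induction rule: gl_rel.induct)
  case (odd_sq i j)
  show ?case by (rule exI, rule fhom_fmat2, rule refl)
next
  case (row j l i)
  show ?case
    by (rule exI, intro fhom_diff fhom_scale fhom_fmat2, rule refl) (simp add: add_ac)
next
  case (col i k j)
  show ?case
    by (rule exI, intro fhom_diff fhom_scale fhom_fmat2, rule refl) (simp add: add_ac)
next
  case (anti i k j l)
  show ?case
    by (rule exI, intro fhom_diff fhom_scale fhom_fmat2, rule refl) (simp add: add_ac)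
next
  case (diag i k j l)
  show ?case
    by (rule exI, intro fhom_diff fhom_scale fhom_fmat2, rule refl) (simp_all add: add_ac)
next
  case D1_right
  show ?case using fhom_fgen[of D1_inv]
    by (intro exI[of _ 0] fhom_diff fhom_one fhom_mult[OF fhom_fD1, of 0]) auto
next
  case D1_left
  show ?case using fhom_fgen[of D1_inv]
    by (intro exI[of _ 0] fhom_diff fhom_one fhom_mult[OF _ fhom_fD1, of 0]) auto
next
  case D2_right
  show ?case using fhom_fgen[of D2_inv]
    by (intro exI[of _ 0] fhom_diff fhom_one fhom_mult[OF fhom_fD2, of 0]) auto
next
  case D2_left
  show ?case using fhom_fgen[of D2_inv]
    by (intro exI[of _ 0] fhom_diff fhom_one fhom_mult[OF _ fhom_fD2, of 0]) auto
qed

lemma fpart_ideal: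
  "x \<in> two_sided_ideal gl_rel \<Longrightarrow> fpart d x \<in> two_sided_ideal gl_rel"
proof (induction rule: two_sided_ideal.induct)
  case zero
  show ?case by (simp add: two_sided_ideal.zero)
next
  case (gen s x y)
  obtain h where h: "fhom h s" using gl_rel_homogeneous[OF gen] by blast
  have *: "fpart d (fpart a x * s * fpart b y) \<in> two_sided_ideal gl_rel" for a b
  proof -
    have "fhom (((a + h) mod 2 + b) mod 2) (fpart a x * s * fpart b y)"
      by (intro fhom_mult[OF fhom_mult[OF fhom_fpart h refl] fhom_fpart refl])
    then show ?thesis
      using gen by (auto simp: fpart_fhom intro: two_sided_ideal.intros)
  qed
  have "x * s * y = (fpart 0 x + fpart 1 x) * s * (fpart 0 y + fpart 1 y)"
    by (simp only: fpart_sum)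
  then show ?case
    by (simp only: distrib_left distrib_right fpart_add) (intro two_sided_ideal.add *)
next
  case (add x y)
  then show ?case by (simp add: fpart_add two_sided_ideal.add)
qed

definition qpart :: "nat \<Rightarrow> ('k::field, 'm::finite, 'n::finite) kGL \<Rightarrow> ('k, 'm, 'n) kGL"
  where "qpart d x = abs_kGL (fpart d (rep_kGL x))"

lemma qpart_abs: "qpart d (abs_kGL x) = abs_kGL (fpart d x)"
  unfolding qpart_def abs_kGL_eq
  using fpart_ideal[OF rep_abs_kGL[of x]] by (simp add: fpart_diff)

lemma qpart_add: "qpart d (x + y) = qpart d x + qpart d y"
  by (cases x rule: kGL_cases; cases y rule: kGL_cases)
    (simp add: qpart_abs plus_kGL.abs_eq fpart_add)

lemma qpart_scale: "qpart d (qscale c x) = qscale c (qpart d x)"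
  by (cases x rule: kGL_cases) (simp add: qpart_abs qscale_abs fpart_scale)

lemma qpart_sum: "qpart 0 x + qpart 1 x = x"
  by (cases x rule: kGL_cases) (simp only: qpart_abs plus_kGL.abs_eq fpart_sum)

lemma qpart_qpart: "qpart d (qpart e x) = (if d = e then qpart d x else 0)"
  by (cases x rule: kGL_cases)
    (simp add: qpart_abs fpart_fhom[OF fhom_fpart] zero_kGL.abs_eq)

definition qgrade :: "nat \<Rightarrow> ('k::field, 'm::finite, 'n::finite) kGL set"
  where "qgrade d = {x. qpart d x = x}"

lemma qgrade_mult:
  assumes "x \<in> qgrade a" "y \<in> qgrade b" "d = (a + b) mod 2"
  shows "x * y \<in> qgrade d"
proof -
  obtain x' where x': "x = abs_kGL x'" by (rule kGL_cases)
  obtain y' where y': "y = abs_kGL y'" by (rule kGL_cases)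
  have "x = abs_kGL (fpart a x')" "y = abs_kGL (fpart b y')"
    using assms(1,2) by (simp_all add: qgrade_def x' y' qpart_abs)
  then have "x * y = abs_kGL (fpart a x' * fpart b y')"
    by (simp add: times_kGL.abs_eq)
  then show ?thesis
    by (simp add: qgrade_def qpart_abs fpart_fhom[OF fhom_mult[OF fhom_fpart fhom_fpart assms(3)]])
qed

lemma one_qgrade: "1 \<in> qgrade 0"
  unfolding qgrade_def one_kGL_def by (simp add: qpart_abs fpart_fhom[OF fhom_one])

lemma qpart_in_qgrade: "qpart d x \<in> qgrade d"
  by (simp add: qgrade_def qpart_qpart)

lemma qpart_qgrade: "x \<in> qgrade e \<Longrightarrow> qpart d x = (if d = e then x else 0)"
  using qpart_qpart[of d e x] by (auto simp: qgrade_def)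


section \<open>The tensor square\<close>

lemma equivp_span: "equivp (\<lambda>x y. x - y \<in> free.span S)"
proof (rule equivpI)
  show "reflp (\<lambda>x y. x - y \<in> free.span S)"
    by (rule reflpI) (simp add: free.span_zero)
  show "symp (\<lambda>x y. x - y \<in> free.span S)"
    by (rule sympI) (metis free.span_neg minus_diff_eq)
  show "transp (\<lambda>x y. x - y \<in> free.span S)"
  proof (rule transpI)
    fix x y z assume "x - y \<in> free.span S" "y - z \<in> free.span S"
    then have "(x - y) + (y - z) \<in> free.span S" by (rule free.span_add)
    then show "x - z \<in> free.span S" by simp
  qed
qed

inductive_set tens2_rel ::
  "(('k::field, 'm::finite, 'n::finite) kGL \<times> ('k, 'm, 'n) kGL \<Rightarrow>\<^sub>0 'k laurent) set" where
  add1: "Poly_Mapping.single (a + a', b) 1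
    - (Poly_Mapping.single (a, b) 1 + Poly_Mapping.single (a', b) 1) \<in> tens2_rel"
| add2: "Poly_Mapping.single (a, b + b') 1
    - (Poly_Mapping.single (a, b) 1 + Poly_Mapping.single (a, b') 1) \<in> tens2_rel"
| scale1: "Poly_Mapping.single (qscale c a, b) 1 - fscale c (Poly_Mapping.single (a, b) 1) \<in> tens2_rel"
| scale2: "Poly_Mapping.single (a, qscale c b) 1 - fscale c (Poly_Mapping.single (a, b) 1) \<in> tens2_rel"

quotient_type (overloaded) ('k, 'm, 'n) kGL2 =
  "('k::field, 'm::finite, 'n::finite) kGL \<times> ('k, 'm, 'n) kGL \<Rightarrow>\<^sub>0 'k laurent" /
  "\<lambda>x y. x - y \<in> free.span tens2_rel"
  by (rule equivp_span)

lemma abs_kGL2_eq: "abs_kGL2 x = abs_kGL2 y \<longleftrightarrow> x - y \<in> free.span tens2_rel"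
  using Quotient3_rel[OF Quotient3_kGL2] by (fastforce simp: free.span_zero)

lemma abs_rep_kGL2 [simp]: "abs_kGL2 (rep_kGL2 t) = t"
  by (rule Quotient3_abs_rep[OF Quotient3_kGL2])

lemma kGL2_cases: obtains x where "t = abs_kGL2 x"
  by (rule that) (rule abs_rep_kGL2[symmetric])

lemma rep_abs_kGL2: "rep_kGL2 (abs_kGL2 x) - x \<in> free.span tens2_rel"
  by (simp flip: abs_kGL2_eq)

instantiation kGL2 :: (field, finite, finite) ab_group_add
begin

definition zero_kGL2 :: "('a, 'b, 'c) kGL2" where "zero_kGL2 = abs_kGL2 0"
definition plus_kGL2 :: "('a, 'b, 'c) kGL2 \<Rightarrow> ('a, 'b, 'c) kGL2 \<Rightarrow> ('a, 'b, 'c) kGL2"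
  where "plus_kGL2 t u = abs_kGL2 (rep_kGL2 t + rep_kGL2 u)"
definition minus_kGL2 :: "('a, 'b, 'c) kGL2 \<Rightarrow> ('a, 'b, 'c) kGL2 \<Rightarrow> ('a, 'b, 'c) kGL2"
  where "minus_kGL2 t u = abs_kGL2 (rep_kGL2 t - rep_kGL2 u)"
definition uminus_kGL2 :: "('a, 'b, 'c) kGL2 \<Rightarrow> ('a, 'b, 'c) kGL2"
  where "uminus_kGL2 t = abs_kGL2 (- rep_kGL2 t)"

lemma abs_kGL2_add: "abs_kGL2 (x + y) = abs_kGL2 x + (abs_kGL2 y :: ('a, 'b, 'c) kGL2)"
  unfolding plus_kGL2_def abs_kGL2_eq
  using free.span_neg[OF free.span_add[OF rep_abs_kGL2[of x] rep_abs_kGL2[of y]]]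
  by (simp add: algebra_simps)

lemma abs_kGL2_uminus: "abs_kGL2 (- x) = - (abs_kGL2 x :: ('a, 'b, 'c) kGL2)"
  unfolding uminus_kGL2_def abs_kGL2_eq using rep_abs_kGL2[of x] by (simp add: algebra_simps)

instance
proof
  fix t u v :: "('a, 'b, 'c) kGL2"
  obtain x where x: "t = abs_kGL2 x" by (rule kGL2_cases)
  obtain y where y: "u = abs_kGL2 y" by (rule kGL2_cases)
  obtain z where z: "v = abs_kGL2 z" by (rule kGL2_cases)
  note * = x y z
  show "t + u + v = t + (u + v)" "t + u = u + t" "0 + t = t" "- t + t = 0"
    unfolding * zero_kGL2_def by (simp_all add: add_ac flip: abs_kGL2_add abs_kGL2_uminus)
  show "t - u = t + - u"
    unfolding minus_kGL2_def diff_conv_add_uminus abs_kGL2_add abs_kGL2_uminus abs_rep_kGL2 ..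
qed

end

definition t2scale :: "'k::field laurent \<Rightarrow> ('k, 'm::finite, 'n::finite) kGL2 \<Rightarrow> ('k, 'm, 'n) kGL2"
  where "t2scale c t = abs_kGL2 (fscale c (rep_kGL2 t))"

lemma abs_kGL2_scale: "abs_kGL2 (fscale c x) = t2scale c (abs_kGL2 x)"
  unfolding t2scale_def abs_kGL2_eq
  using free.span_neg[OF free.span_scale[OF rep_abs_kGL2[of x], of c]]
  by (simp add: free.scale_right_diff_distrib)

interpretation kGL2: module "t2scale :: 'k::field laurent \<Rightarrow> ('k, 'm::finite, 'n::finite) kGL2 \<Rightarrow> _"
proof
  fix c d :: "'k laurent" and t u :: "('k, 'm, 'n) kGL2"
  obtain x where x: "t = abs_kGL2 x" by (rule kGL2_cases)
  obtain y where y: "u = abs_kGL2 y" by (rule kGL2_cases)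
  note * = x y
  show "t2scale c (t + u) = t2scale c t + t2scale c u" "t2scale (c + d) t = t2scale c t + t2scale d t"
    "t2scale c (t2scale d t) = t2scale (c * d) t" "t2scale 1 t = t"
    unfolding * by (simp_all add: free.scale_right_distrib free.scale_left_distrib
        flip: abs_kGL2_add abs_kGL2_scale)
qed

definition tens2 :: "('k::field, 'm::finite, 'n::finite) kGL \<Rightarrow> ('k, 'm, 'n) kGL \<Rightarrow> ('k, 'm, 'n) kGL2"
  (infixl \<open>\<otimes>\<close> 75) where "a \<otimes> b = abs_kGL2 (Poly_Mapping.single (a, b) 1)"

lemma tens2_add_left: "(a + a') \<otimes> b = a \<otimes> b + a' \<otimes> b"
  unfolding tens2_def abs_kGL2_add[symmetric] abs_kGL2_eq
  by (intro free.span_base tens2_rel.intros)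

lemma tens2_add_right: "a \<otimes> (b + b') = a \<otimes> b + a \<otimes> b'"
  unfolding tens2_def abs_kGL2_add[symmetric] abs_kGL2_eq
  by (intro free.span_base tens2_rel.intros)

lemma tens2_scale_left: "qscale c a \<otimes> b = t2scale c (a \<otimes> b)"
  unfolding tens2_def abs_kGL2_scale[symmetric] abs_kGL2_eq
  by (intro free.span_base tens2_rel.intros)

lemma tens2_scale_right: "a \<otimes> qscale c b = t2scale c (a \<otimes> b)"
  unfolding tens2_def abs_kGL2_scale[symmetric] abs_kGL2_eq
  by (intro free.span_base tens2_rel.intros)

lemma tens2_zero [simp]: "0 \<otimes> b = 0" "a \<otimes> 0 = 0"
  using tens2_add_left[of 0 0 b] tens2_add_right[of a 0 0] by simp_all

lemma kGL2_induct [case_names tens add]: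
  assumes tens: "\<And>a b. P (a \<otimes> b)" and add: "\<And>t u. P t \<Longrightarrow> P u \<Longrightarrow> P (t + u)"
  shows "P t"
proof -
  have "P (abs_kGL2 x)" for x
  proof (induction x rule: poly_mapping_single_induct)
    case zero
    show ?case using tens[of 0 0] by (simp add: zero_kGL2_def)
  next
    case (single p c)
    have "abs_kGL2 (Poly_Mapping.single p c) = t2scale c (fst p \<otimes> snd p)"
      by (simp add: tens2_def flip: abs_kGL2_scale)
    also have "\<dots> = qscale c (fst p) \<otimes> snd p"
      by (rule tens2_scale_left[symmetric])
    finally show ?case by (simp only: tens)
  next
    case (add x y)
    then show ?case by (simp add: abs_kGL2_add assms)
  qed
  from this[of "rep_kGL2 t"] show ?thesis by simp
qed

lemma kGL2_hom_induct [case_names tens add]: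
  assumes "\<And>a b r s. r < 2 \<Longrightarrow> s < 2 \<Longrightarrow> a \<in> qgrade r \<Longrightarrow> b \<in> qgrade s \<Longrightarrow> P (a \<otimes> b)"
    and add: "\<And>t u. P t \<Longrightarrow> P u \<Longrightarrow> P (t + u)"
  shows "P t"
proof (induction t rule: kGL2_induct)
  case (tens a b)
  have "P (qpart r a \<otimes> qpart s b)" if "r < 2" "s < 2" for r s
    using assms(1)[OF that qpart_in_qgrade qpart_in_qgrade] .
  then have "P ((qpart 0 a + qpart 1 a) \<otimes> (qpart 0 b + qpart 1 b))"
    unfolding tens2_add_left tens2_add_right by (intro add) auto
  then show ?case by (simp only: qpart_sum)
qed (rule add)

text \<open>The linear map on the tensor square induced by a bilinear map \<open>f\<close> into a module
  with scalar multiplication \<open>s\<close> (meaningful only for bilinear \<open>f\<close>).\<close>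

definition ext2 :: "('k::field laurent \<Rightarrow> 'c::ab_group_add \<Rightarrow> 'c) \<Rightarrow>
    (('k, 'm::finite, 'n::finite) kGL \<Rightarrow> ('k, 'm, 'n) kGL \<Rightarrow> 'c) \<Rightarrow> ('k, 'm, 'n) kGL2 \<Rightarrow> 'c"
  where "ext2 s f t = lin_ext s (\<lambda>(a, b). f a b) (rep_kGL2 t)"

definition bilin2 :: "('k::field laurent \<Rightarrow> 'c::ab_group_add \<Rightarrow> 'c) \<Rightarrow>
    (('k, 'm::finite, 'n::finite) kGL \<Rightarrow> ('k, 'm, 'n) kGL \<Rightarrow> 'c) \<Rightarrow> bool"
  where "bilin2 s f \<longleftrightarrow> module s \<and>
    (\<forall>a a' b. f (a + a') b = f a b + f a' b) \<and> (\<forall>a b b'. f a (b + b') = f a b + f a b') \<and>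
    (\<forall>c a b. f (qscale c a) b = s c (f a b)) \<and> (\<forall>c a b. f a (qscale c b) = s c (f a b))"

lemma ext2_abs:
  fixes s :: "'k::field laurent \<Rightarrow> 'c::ab_group_add \<Rightarrow> 'c"
    and f :: "('k, 'm::finite, 'n::finite) kGL \<Rightarrow> ('k, 'm, 'n) kGL \<Rightarrow> 'c"
  assumes "bilin2 s f"
  shows "ext2 s f (abs_kGL2 x) = lin_ext s (\<lambda>(a, b). f a b) x"
proof -
  have m: "module s" using assms by (simp add: bilin2_def)
  interpret h: module_hom fscale s "lin_ext s (\<lambda>(a, b). f a b)" by (rule lin_ext_hom[OF m])
  have "lin_ext s (\<lambda>(a, b). f a b) y = 0" if "y \<in> free.span tens2_rel" for y
  proof (rule h.eq_0_on_span[OF _ that])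
    fix z :: "('k, 'm, 'n) kGL \<times> ('k, 'm, 'n) kGL \<Rightarrow>\<^sub>0 'k laurent"
    assume "z \<in> tens2_rel"
    then show "lin_ext s (\<lambda>(a, b). f a b) z = 0"
      by cases (use assms in \<open>simp_all only: h.diff h.add h.scale lin_ext_single[OF m] h.m2.scale_one
          prod.case bilin2_def diff_self\<close>)
  qed
  from this[OF rep_abs_kGL2[of x]] show ?thesis
    unfolding ext2_def by (simp add: h.diff)
qed

lemma ext2_tens: "bilin2 s f \<Longrightarrow> ext2 s f (a \<otimes> b) = f a b"
  unfolding tens2_def
  by (simp add: ext2_abs lin_ext_single module.scale_one bilin2_def)

lemma ext2_hom:
  fixes s :: "'k::field laurent \<Rightarrow> 'c::ab_group_add \<Rightarrow> 'c"
    and f :: "('k, 'm::finite, 'n::finite) kGL \<Rightarrow> ('k, 'm, 'n) kGL \<Rightarrow> 'c"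
  assumes "bilin2 s f"
  shows "module_hom t2scale s (ext2 s f)"
proof -
  have m: "module s" using assms by (simp add: bilin2_def)
  interpret h: module_hom fscale s "lin_ext s (\<lambda>(a, b). f a b)" by (rule lin_ext_hom[OF m])
  show ?thesis
  proof
    fix t u :: "('k, 'm, 'n) kGL2" and r
    obtain x where x: "t = abs_kGL2 x" by (rule kGL2_cases)
    obtain y where y: "u = abs_kGL2 y" by (rule kGL2_cases)
    note * = x y
    show "ext2 s f (t + u) = ext2 s f t + ext2 s f u" "ext2 s f (t2scale r t) = s r (ext2 s f t)"
      unfolding * by (simp_all add: ext2_abs[OF assms] h.add h.scale flip: abs_kGL2_add abs_kGL2_scale)
  qed
qed

lemmas ext2_add = module_hom.add[OF ext2_hom]
lemmas ext2_scale = module_hom.scale[OF ext2_hom]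

lemma ext2_fun_add:
  "module s \<Longrightarrow> ext2 s (\<lambda>a b. f a b + g a b) t = ext2 s f t + ext2 s g t"
  by (simp add: ext2_def lin_ext_def module.scale_right_distrib sum.distrib case_prod_beta)

lemma ext2_fun_scale:
  "module s \<Longrightarrow> ext2 s (\<lambda>a b. s c (f a b)) t = s c (ext2 s f t)"
  by (simp add: ext2_def lin_ext_def module.scale_sum_right module.scale_left_commute case_prod_beta)

text \<open>The product \<open>(a \<otimes> b) (c \<otimes> d) = (-1)\<^bsup>\<pi>(b) \<pi>(c)\<^esup> a c \<otimes> b d\<close>, extended bilinearly
  by splitting \<open>b\<close> and \<open>c\<close> into homogeneous components.\<close>

definition tens_prod :: "('k::field, 'm::finite, 'n::finite) kGL \<Rightarrow> ('k, 'm, 'n) kGL \<Rightarrow>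
    ('k, 'm, 'n) kGL \<Rightarrow> ('k, 'm, 'n) kGL \<Rightarrow> ('k, 'm, 'n) kGL2"
  where "tens_prod a b c d =
    (\<Sum>r\<in>{0, 1}. \<Sum>s\<in>{0, 1}. t2scale ((- 1) ^ (r * s)) ((a * qpart s c) \<otimes> (qpart r b * d)))"

instantiation kGL2 :: (field, finite, finite) "{one, times}"
begin
definition one_kGL2 :: "('a, 'b, 'c) kGL2" where "one_kGL2 = 1 \<otimes> 1"
definition times_kGL2 :: "('a, 'b, 'c) kGL2 \<Rightarrow> ('a, 'b, 'c) kGL2 \<Rightarrow> ('a, 'b, 'c) kGL2"
  where "times_kGL2 t u = ext2 t2scale (\<lambda>a b. ext2 t2scale (\<lambda>c d. tens_prod a b c d) u) t"
instance ..
end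

lemma tens_prod_bilin_right: "bilin2 t2scale (\<lambda>c d. tens_prod a b c d)"
  unfolding bilin2_def
  by (simp add: kGL2.module_axioms tens_prod_def qpart_add qpart_scale distrib_left distrib_right
      qscale_mult_left qscale_mult_right tens2_add_left tens2_add_right tens2_scale_left
      tens2_scale_right kGL2.scale_right_distrib kGL2.scale_right_diff_distrib
      kGL2.scale_left_commute add_ac)

lemma tens_prod_left:
  "tens_prod (a + a') b c d = tens_prod a b c d + tens_prod a' b c d"
  "tens_prod a (b + b') c d = tens_prod a b c d + tens_prod a b' c d"
  "tens_prod (qscale k a) b c d = t2scale k (tens_prod a b c d)"
  "tens_prod a (qscale k b) c d = t2scale k (tens_prod a b c d)"
  by (simp_all add: tens_prod_def qpart_add qpart_scale distrib_left distrib_right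
      qscale_mult_left qscale_mult_right tens2_add_left tens2_add_right tens2_scale_left
      tens2_scale_right kGL2.scale_right_distrib kGL2.scale_right_diff_distrib
      mult.commute add_ac)

lemma times_bilin: "bilin2 t2scale (\<lambda>a b. ext2 t2scale (\<lambda>c d. tens_prod a b c d) u)"
  unfolding bilin2_def tens_prod_left
  by (simp add: kGL2.module_axioms ext2_fun_add ext2_fun_scale)

lemma tens2_times: "(a \<otimes> b) * (c \<otimes> d) = tens_prod a b c d"
  unfolding times_kGL2_def
  by (rule trans[OF ext2_tens[OF times_bilin] ext2_tens[OF tens_prod_bilin_right]])

lemma tens2_times_homogeneous:
  assumes "r < 2" "s < 2" "b \<in> qgrade r" "c \<in> qgrade s"
  shows "(a \<otimes> b) * (c \<otimes> d) = t2scale ((- 1) ^ (r * s)) ((a * c) \<otimes> (b * d))"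
proof -
  have "r = 0 \<or> r = 1" "s = 0 \<or> s = 1" using assms by auto
  then show ?thesis
    by (auto simp: tens2_times tens_prod_def qpart_qgrade[OF assms(3)] qpart_qgrade[OF assms(4)])
qed

lemma kGL2_distrib:
  fixes t u v :: "('k::field, 'm::finite, 'n::finite) kGL2"
  shows "(t + u) * v = t * v + u * v" and "t * (u + v) = t * u + t * v"
    and "t2scale c t * v = t2scale c (t * v)" and "t * t2scale c v = t2scale c (t * v)"
proof -
  show "(t + u) * v = t * v + u * v"
    unfolding times_kGL2_def by (rule ext2_add[OF times_bilin])
  show "t2scale c t * v = t2scale c (t * v)"
    unfolding times_kGL2_def by (rule ext2_scale[OF times_bilin])
  show "t * (u + v) = t * u + t * v"
    unfolding times_kGL2_def ext2_add[OF tens_prod_bilin_right]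
    by (rule ext2_fun_add[OF kGL2.module_axioms])
  show "t * t2scale c v = t2scale c (t * v)"
    unfolding times_kGL2_def ext2_scale[OF tens_prod_bilin_right]
    by (rule ext2_fun_scale[OF kGL2.module_axioms])
qed

lemma kGL2_mult_1:
  fixes t :: "('k::field, 'm::finite, 'n::finite) kGL2"
  shows "1 * t = t" "t * 1 = t"
proof -
  show "1 * t = t"
  proof (induction t rule: kGL2_hom_induct)
    case (tens a b r s)
    then show ?case
      using tens2_times_homogeneous[of 0 r 1 a 1 b] by (simp add: one_kGL2_def one_qgrade)
  qed (simp add: kGL2_distrib)
  show "t * 1 = t"
  proof (induction t rule: kGL2_hom_induct)
    case (tens a b r s)
    then show ?case
      using tens2_times_homogeneous[of s 0 b 1 a 1] by (simp add: one_kGL2_def one_qgrade)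
  qed (simp add: kGL2_distrib)
qed

lemma kGL2_assoc:
  fixes t u v :: "('k::field, 'm::finite, 'n::finite) kGL2"
  shows "t * u * v = t * (u * v)"
proof (induction t rule: kGL2_hom_induct)
  case (tens a b p p')
  note ab = tens
  show ?case
  proof (induction u rule: kGL2_hom_induct)
    case (tens c d r r')
    note cd = tens
    show ?case
    proof (induction v rule: kGL2_hom_induct)
      case (tens e f s s')
      have bd: "b * d \<in> qgrade ((p' + r') mod 2)" and ce: "c * e \<in> qgrade ((r + s) mod 2)"
        using ab cd tens by (auto intro: qgrade_mult)
      have "p' = 0 \<or> p' = 1" "r = 0 \<or> r = 1" "r' = 0 \<or> r' = 1" "s = 0 \<or> s = 1"
        using ab cd tens by auto
      then have sgn: "(- 1 :: 'k laurent) ^ (p' * r) * (- 1) ^ ((p' + r') mod 2 * s)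
          = (- 1) ^ (r' * s) * (- 1) ^ (p' * ((r + s) mod 2))"
        by auto
      have "(a \<otimes> b) * (c \<otimes> d) * (e \<otimes> f)
          = t2scale ((- 1) ^ (p' * r) * (- 1) ^ ((p' + r') mod 2 * s)) ((a * c * e) \<otimes> (b * d * f))"
        using ab cd tens
        by (simp add: tens2_times_homogeneous[of p' r] tens2_times_homogeneous[OF _ _ bd] kGL2_distrib)
      also have "\<dots> = (a \<otimes> b) * ((c \<otimes> d) * (e \<otimes> f))"
        unfolding sgn using ab cd tens
        by (simp add: tens2_times_homogeneous[of r' s] tens2_times_homogeneous[OF _ _ _ ce]
            kGL2_distrib mult.assoc)
      finally show ?case .
    qed (simp add: kGL2_distrib)
  qed (simp add: kGL2_distrib)
qed (simp add: kGL2_distrib)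

instance kGL2 :: (field, finite, finite) "{ring, monoid_mult}"
  by standard (simp_all add: kGL2_distrib kGL2_mult_1 kGL2_assoc)

definition t2grade :: "nat \<Rightarrow> ('k::field, 'm::finite, 'n::finite) kGL2 set" where
  "t2grade d = kGL2.span {a \<otimes> b | a b r s. r < 2 \<and> s < 2 \<and> a \<in> qgrade r \<and> b \<in> qgrade s
     \<and> (r + s) mod 2 = d}"


section \<open>The tensor cube\<close>

inductive_set tens3_rel ::
  "(('k::field, 'm::finite, 'n::finite) kGL \<times> ('k, 'm, 'n) kGL \<times> ('k, 'm, 'n) kGL
     \<Rightarrow>\<^sub>0 'k laurent) set" where
  add1: "Poly_Mapping.single (a + a', b, c) 1
    - (Poly_Mapping.single (a, b, c) 1 + Poly_Mapping.single (a', b, c) 1) \<in> tens3_rel"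
| add2: "Poly_Mapping.single (a, b + b', c) 1
    - (Poly_Mapping.single (a, b, c) 1 + Poly_Mapping.single (a, b', c) 1) \<in> tens3_rel"
| add3: "Poly_Mapping.single (a, b, c + c') 1
    - (Poly_Mapping.single (a, b, c) 1 + Poly_Mapping.single (a, b, c') 1) \<in> tens3_rel"
| scale1: "Poly_Mapping.single (qscale r a, b, c) 1
    - fscale r (Poly_Mapping.single (a, b, c) 1) \<in> tens3_rel"
| scale2: "Poly_Mapping.single (a, qscale r b, c) 1
    - fscale r (Poly_Mapping.single (a, b, c) 1) \<in> tens3_rel"
| scale3: "Poly_Mapping.single (a, b, qscale r c) 1
    - fscale r (Poly_Mapping.single (a, b, c) 1) \<in> tens3_rel"

quotient_type (overloaded) ('k, 'm, 'n) kGL3 =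
  "('k::field, 'm::finite, 'n::finite) kGL \<times> ('k, 'm, 'n) kGL \<times> ('k, 'm, 'n) kGL \<Rightarrow>\<^sub>0 'k laurent" /
  "\<lambda>x y. x - y \<in> free.span tens3_rel"
  by (rule equivp_span)

lemma abs_kGL3_eq: "abs_kGL3 x = abs_kGL3 y \<longleftrightarrow> x - y \<in> free.span tens3_rel"
  using Quotient3_rel[OF Quotient3_kGL3] by (fastforce simp: free.span_zero)

lemma abs_rep_kGL3 [simp]: "abs_kGL3 (rep_kGL3 t) = t"
  by (rule Quotient3_abs_rep[OF Quotient3_kGL3])

lemma kGL3_cases: obtains x where "t = abs_kGL3 x"
  by (rule that) (rule abs_rep_kGL3[symmetric])

lemma rep_abs_kGL3: "rep_kGL3 (abs_kGL3 x) - x \<in> free.span tens3_rel"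
  by (simp flip: abs_kGL3_eq)

instantiation kGL3 :: (field, finite, finite) ab_group_add
begin

definition zero_kGL3 :: "('a, 'b, 'c) kGL3" where "zero_kGL3 = abs_kGL3 0"
definition plus_kGL3 :: "('a, 'b, 'c) kGL3 \<Rightarrow> ('a, 'b, 'c) kGL3 \<Rightarrow> ('a, 'b, 'c) kGL3"
  where "plus_kGL3 t u = abs_kGL3 (rep_kGL3 t + rep_kGL3 u)"
definition minus_kGL3 :: "('a, 'b, 'c) kGL3 \<Rightarrow> ('a, 'b, 'c) kGL3 \<Rightarrow> ('a, 'b, 'c) kGL3"
  where "minus_kGL3 t u = abs_kGL3 (rep_kGL3 t - rep_kGL3 u)"
definition uminus_kGL3 :: "('a, 'b, 'c) kGL3 \<Rightarrow> ('a, 'b, 'c) kGL3"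
  where "uminus_kGL3 t = abs_kGL3 (- rep_kGL3 t)"

lemma abs_kGL3_add: "abs_kGL3 (x + y) = abs_kGL3 x + (abs_kGL3 y :: ('a, 'b, 'c) kGL3)"
  unfolding plus_kGL3_def abs_kGL3_eq
  using free.span_neg[OF free.span_add[OF rep_abs_kGL3[of x] rep_abs_kGL3[of y]]]
  by (simp add: algebra_simps)

lemma abs_kGL3_uminus: "abs_kGL3 (- x) = - (abs_kGL3 x :: ('a, 'b, 'c) kGL3)"
  unfolding uminus_kGL3_def abs_kGL3_eq using rep_abs_kGL3[of x] by (simp add: algebra_simps)

instance
proof
  fix t u v :: "('a, 'b, 'c) kGL3"
  obtain x where x: "t = abs_kGL3 x" by (rule kGL3_cases)
  obtain y where y: "u = abs_kGL3 y" by (rule kGL3_cases)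
  obtain z where z: "v = abs_kGL3 z" by (rule kGL3_cases)
  note * = x y z
  show "t + u + v = t + (u + v)" "t + u = u + t" "0 + t = t" "- t + t = 0"
    unfolding * zero_kGL3_def by (simp_all add: add_ac flip: abs_kGL3_add abs_kGL3_uminus)
  show "t - u = t + - u"
    unfolding minus_kGL3_def diff_conv_add_uminus abs_kGL3_add abs_kGL3_uminus abs_rep_kGL3 ..
qed

end

definition t3scale :: "'k::field laurent \<Rightarrow> ('k, 'm::finite, 'n::finite) kGL3 \<Rightarrow> ('k, 'm, 'n) kGL3"
  where "t3scale c t = abs_kGL3 (fscale c (rep_kGL3 t))"

lemma abs_kGL3_scale: "abs_kGL3 (fscale c x) = t3scale c (abs_kGL3 x)"
  unfolding t3scale_def abs_kGL3_eq
  using free.span_neg[OF free.span_scale[OF rep_abs_kGL3[of x], of c]]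
  by (simp add: free.scale_right_diff_distrib)

interpretation kGL3: module "t3scale :: 'k::field laurent \<Rightarrow> ('k, 'm::finite, 'n::finite) kGL3 \<Rightarrow> _"
proof
  fix c d :: "'k laurent" and t u :: "('k, 'm, 'n) kGL3"
  obtain x where x: "t = abs_kGL3 x" by (rule kGL3_cases)
  obtain y where y: "u = abs_kGL3 y" by (rule kGL3_cases)
  note * = x y
  show "t3scale c (t + u) = t3scale c t + t3scale c u" "t3scale (c + d) t = t3scale c t + t3scale d t"
    "t3scale c (t3scale d t) = t3scale (c * d) t" "t3scale 1 t = t"
    unfolding * by (simp_all add: free.scale_right_distrib free.scale_left_distrib
        flip: abs_kGL3_add abs_kGL3_scale)
qed

definition tens3 :: "('k::field, 'm::finite, 'n::finite) kGL \<Rightarrow> ('k, 'm, 'n) kGL \<Rightarrow> ('k, 'm, 'n) kGL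
    \<Rightarrow> ('k, 'm, 'n) kGL3"
  where "tens3 a b c = abs_kGL3 (Poly_Mapping.single (a, b, c) 1)"

lemma tens3_linear:
  "tens3 (a + a') b c = tens3 a b c + tens3 a' b c"
  "tens3 a (b + b') c = tens3 a b c + tens3 a b' c"
  "tens3 a b (c + c') = tens3 a b c + tens3 a b c'"
  "tens3 (qscale r a) b c = t3scale r (tens3 a b c)"
  "tens3 a (qscale r b) c = t3scale r (tens3 a b c)"
  "tens3 a b (qscale r c) = t3scale r (tens3 a b c)"
  unfolding tens3_def abs_kGL3_add[symmetric] abs_kGL3_scale[symmetric] abs_kGL3_eq
  by (intro free.span_base tens3_rel.intros)+


section \<open>Coalgebras and superalgebra homomorphisms\<close>

text \<open>The maps \<open>f \<otimes> id\<close> and \<open>id \<otimes> f\<close> for a linear map \<open>f\<close> into the tensor square or into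
  the ground ring, with the canonical identifications of the targets.\<close>

definition comult_left :: "(('k::field, 'm::finite, 'n::finite) kGL \<Rightarrow> ('k, 'm, 'n) kGL2) \<Rightarrow>
    ('k, 'm, 'n) kGL2 \<Rightarrow> ('k, 'm, 'n) kGL3"
  where "comult_left f = ext2 t3scale (\<lambda>a b. ext2 t3scale (\<lambda>c d. tens3 c d b) (f a))"

definition comult_right :: "(('k::field, 'm::finite, 'n::finite) kGL \<Rightarrow> ('k, 'm, 'n) kGL2) \<Rightarrow>
    ('k, 'm, 'n) kGL2 \<Rightarrow> ('k, 'm, 'n) kGL3"
  where "comult_right f = ext2 t3scale (\<lambda>a b. ext2 t3scale (\<lambda>c d. tens3 a c d) (f b))"

definition counit_left :: "(('k::field, 'm::finite, 'n::finite) kGL \<Rightarrow> 'k laurent) \<Rightarrow>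
    ('k, 'm, 'n) kGL2 \<Rightarrow> ('k, 'm, 'n) kGL"
  where "counit_left f = ext2 qscale (\<lambda>a b. qscale (f a) b)"

definition counit_right :: "(('k::field, 'm::finite, 'n::finite) kGL \<Rightarrow> 'k laurent) \<Rightarrow>
    ('k, 'm, 'n) kGL2 \<Rightarrow> ('k, 'm, 'n) kGL"
  where "counit_right f = ext2 qscale (\<lambda>a b. qscale (f b) a)"

lemma comult_left_tens:
  assumes "module_hom qscale t2scale f"
  shows "comult_left f (a \<otimes> b) = ext2 t3scale (\<lambda>c d. tens3 c d b) (f a)"
proof -
  have *: "bilin2 t3scale (\<lambda>c d. tens3 c d b)" for b :: "('a, 'b, 'c) kGL"
    by (simp add: bilin2_def kGL3.module_axioms tens3_linear)
  show ?thesis unfolding comult_left_def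
    by (rule ext2_tens) (simp add: bilin2_def kGL3.module_axioms module_hom.add[OF assms]
      module_hom.scale[OF assms] ext2_add[OF *] ext2_scale[OF *] tens3_linear
      ext2_fun_add[OF kGL3.module_axioms] ext2_fun_scale[OF kGL3.module_axioms])
qed

lemma comult_right_tens:
  assumes "module_hom qscale t2scale f"
  shows "comult_right f (a \<otimes> b) = ext2 t3scale (\<lambda>c d. tens3 a c d) (f b)"
proof -
  have *: "bilin2 t3scale (\<lambda>c d. tens3 a c d)" for a :: "('a, 'b, 'c) kGL"
    by (simp add: bilin2_def kGL3.module_axioms tens3_linear)
  have "ext2 t3scale (tens3 (a + a')) t = ext2 t3scale (tens3 a) t + ext2 t3scale (tens3 a') t"
    for a a' :: "('a, 'b, 'c) kGL" and t
    using ext2_fun_add[OF kGL3.module_axioms, of "tens3 a" "tens3 a'" t]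
    by (simp only: tens3_linear(1)[symmetric])
  moreover have "ext2 t3scale (tens3 (qscale r a)) t = t3scale r (ext2 t3scale (tens3 a) t)"
    for a :: "('a, 'b, 'c) kGL" and r t
    using ext2_fun_scale[OF kGL3.module_axioms, of r "tens3 a" t]
    by (simp only: tens3_linear(4)[symmetric])
  ultimately show ?thesis unfolding comult_right_def
    by (intro ext2_tens) (simp add: bilin2_def kGL3.module_axioms module_hom.add[OF assms]
      module_hom.scale[OF assms] ext2_add[OF *] ext2_scale[OF *])
qed

lemma counit_left_tens:
  assumes "module_hom qscale (*) f"
  shows "counit_left f (a \<otimes> b) = qscale (f a) b"
  unfolding counit_left_def
  by (rule ext2_tens) (simp add: bilin2_def kGL.module_axioms module_hom.add[OF assms]
    module_hom.scale[OF assms] kGL.scale_left_distrib kGL.scale_right_distrib mult.commute)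

lemma counit_right_tens:
  assumes "module_hom qscale (*) f"
  shows "counit_right f (a \<otimes> b) = qscale (f b) a"
  unfolding counit_right_def
  by (rule ext2_tens) (simp add: bilin2_def kGL.module_axioms module_hom.add[OF assms]
    module_hom.scale[OF assms] kGL.scale_left_distrib kGL.scale_right_distrib mult.commute)

definition coalgebra :: "(('k::field, 'm::finite, 'n::finite) kGL \<Rightarrow> ('k, 'm, 'n) kGL2) \<Rightarrow>
    (('k, 'm, 'n) kGL \<Rightarrow> 'k laurent) \<Rightarrow> bool"
  where "coalgebra \<Delta> \<epsilon> \<longleftrightarrow>
    module_hom qscale t2scale \<Delta> \<and> module_hom qscale (*) \<epsilon> \<and>
    (\<forall>x. comult_left \<Delta> (\<Delta> x) = comult_right \<Delta> (\<Delta> x)) \<and>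
    (\<forall>x. counit_left \<epsilon> (\<Delta> x) = x) \<and>
    (\<forall>x. counit_right \<epsilon> (\<Delta> x) = x)"

definition laurent_grade :: "nat \<Rightarrow> 'k::field laurent set"
  where "laurent_grade d = (if d = 0 then UNIV else {0})"

definition superalg_hom :: "('r::comm_ring_1 \<Rightarrow> 'a::{ring, monoid_mult} \<Rightarrow> 'a) \<Rightarrow> (nat \<Rightarrow> 'a set) \<Rightarrow>
    ('r \<Rightarrow> 'b::{ring, monoid_mult} \<Rightarrow> 'b) \<Rightarrow> (nat \<Rightarrow> 'b set) \<Rightarrow> ('a \<Rightarrow> 'b) \<Rightarrow> bool"
  where "superalg_hom s gr s' gr' f \<longleftrightarrow> module_hom s s' f \<and> f 1 = 1 \<and>
    (\<forall>x y. f (x * y) = f x * f y) \<and> (\<forall>d\<in>{0, 1}. \<forall>x\<in>gr d. f x \<in> gr' d)"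

definition unit_inv :: "'a::monoid_mult \<Rightarrow> 'a"
  where "unit_inv x = (THE y. x * y = 1 \<and> y * x = 1)"


section \<open>The terms of the coproducts of the quantum determinants\<close>

definition gl_R :: "nat \<Rightarrow> ('k::field, 'm::finite, 'n::finite) kGL2" where
  "gl_R i = (\<Sum>\<sigma> | \<sigma> permutes {1..CARD('m)}.
     \<Sum>k | k \<in> {1..CARD('m)} \<rightarrow>\<^sub>E UNIV \<and> card {j \<in> {1..CARD('m)}. num (k j) > CARD('m)} = i.
       t2scale ((- qinv) ^ perm_length CARD('m) \<sigma>)
         (\<Prod>j\<leftarrow>[1..<CARD('m) + 1]. gmat (ix j) (k j) \<otimes> gmat (k j) (ix (\<sigma> j))))"

definition gl_S :: "nat \<Rightarrow> ('k::field, 'm::finite, 'n::finite) kGL2" where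
  "gl_S i = (\<Sum>\<theta> | \<theta> permutes {1..CARD('n)}.
     \<Sum>l | l \<in> {1..CARD('n)} \<rightarrow>\<^sub>E UNIV \<and> card {j \<in> {1..CARD('n)}. num (l j) \<le> CARD('m)} = i.
       t2scale ((- qv) ^ perm_length CARD('n) \<theta>)
         (\<Prod>j\<leftarrow>[1..<CARD('n) + 1].
            gmat (ix (CARD('m) + j)) (l j) \<otimes> gmat (l j) (ix (CARD('m) + \<theta> j))))"

end

theory Submission
  imports Defs "HOL-Combinatorics.Multiset_Permutations"
begin

text \<open>The defining relations of the matrix generators say that an R-matrix commutes with the (suitably signed) matrix of
  products \<open>a\<^sub>i\<^sub>j a\<^sub>k\<^sub>l\<close>. This matrix is multiplicative under \<open>a\<^sub>i\<^sub>j \<mapsto> \<Sum>\<^sub>k a\<^sub>i\<^sub>k \<otimes> a\<^sub>k\<^sub>j\<close>, so the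
  relations are preserved. Adjugate matrices show that the quantum determinant of a diagonal block is central in
  the block, and an expansion of minors shows that it commutes with the odd entries next to the block up to the factor
  \<open>1/q\<close>. Hence \<open>R\<^sub>0 R\<^sub>i = q\<^sup>-\<^sup>2\<^sup>i R\<^sub>i R\<^sub>0\<close>, which turns the formula for \<open>\<Delta>(D\<^sub>1\<^sup>-\<^sup>1)\<close> into the geometric series of
  \<open>\<Delta>(D\<^sub>1) R\<^sub>0\<^sup>-\<^sup>1 = 1 + W\<close>; \<open>W\<close> is nilpotent because a product of more than \<open>m n\<close> of the \<open>m n\<close> odd generators in the
  rows of the block vanishes. The coalgebra axioms compare algebra homomorphisms, which are determined by their values
  on the matrix generators since inverses are unique.\<close>


section \<open>Quantum minors\<close>

text \<open>The RTT form replaces a check of every relation, with its signs, on sums over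
  intermediate indices. It misses one relation: for an odd entry it only says that
  \<open>qinv + qv\<close> annihilates the square, and \<open>qinv + qv\<close> is no unit. The
  squares of the coproduct entries are therefore treated separately, by a cancellation in pairs that
  also works in characteristic 2. Both blocks are instances of one argument, with parameter 1/q for
  the even and q for the odd block. The outside indices come after the even block but before the odd
  one, and this exchanges the parameter with its inverse; hence the same factor 1/q for both. A
  factor with an outside intermediate index is odd in both tensor legs, which gives q^-2 per index.
  Nilpotency is read off from the first leg alone. The filtration used there has to survive right
  multiplication by entries of the block rows and by the inverse determinant, so left ideals
  suffice. Coassociativity is an equation between maps into the tensor cube; comparing them on
  generators requires an associative product with Koszul signs on the cube.\<close>

locale scalar_algebra = module scale
  for scale :: "'r::comm_ring_1 \<Rightarrow> 'a::{ring,monoid_mult} \<Rightarrow> 'a" +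
  assumes scale_mult_left [simp]: "scale c x * y = scale c (x * y)"
    and scale_mult_right [simp]: "x * scale c y = scale c (x * y)"

text \<open>Collects the terms at (j, l) and (l, j), so that a relation between two entries can be
  applied inside a double sum.\<close>

lemma sum_off_diagonal:
  fixes f :: "'i::linorder \<Rightarrow> 'i \<Rightarrow> 'b::comm_monoid_add"
  assumes "finite S"
  shows "(\<Sum>j\<in>S. \<Sum>l\<in>S - {j}. f j l) = (\<Sum>j\<in>S. \<Sum>l | l \<in> S \<and> j < l. f j l + f l j)"
proof -
  have "(\<Sum>l\<in>S - {j}. f j l) = (\<Sum>l | l \<in> S \<and> j < l. f j l) + (\<Sum>l | l \<in> S \<and> l < j. f j l)"
    if "j \<in> S" for j
    by (subst sum.union_disjoint[symmetric]) (use assms in \<open>auto intro!: sum.cong\<close>)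
  then have "(\<Sum>j\<in>S. \<Sum>l\<in>S - {j}. f j l)
      = (\<Sum>j\<in>S. \<Sum>l | l \<in> S \<and> j < l. f j l) + (\<Sum>j\<in>S. \<Sum>l | l \<in> S \<and> l < j. f j l)"
    by (simp add: sum.distrib)
  also have "(\<Sum>j\<in>S. \<Sum>l | l \<in> S \<and> l < j. f j l) = (\<Sum>j\<in>S. \<Sum>l | l \<in> S \<and> j < l. f l j)"
    by (rule sum.swap_restrict[OF assms assms])
  finally show ?thesis by (simp add: sum.distrib)
qed

abbreviation count_below :: "'i::linorder set \<Rightarrow> 'i \<Rightarrow> nat"
  where "count_below S j \<equiv> card {j' \<in> S. j' < j}"

abbreviation count_above :: "'i::linorder set \<Rightarrow> 'i \<Rightarrow> nat"
  where "count_above S j \<equiv> card {j' \<in> S. j < j'}"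

lemma count_below_remove:
  fixes S :: "'i::linorder set"
  assumes "finite S" "j \<in> S"
  shows "count_below (S - {j}) l = (if j < l then count_below S l - 1 else count_below S l)"
    and "j < l \<Longrightarrow> count_below S l \<ge> 1"
proof -
  have *: "{j' \<in> S - {j}. j' < l} = {j' \<in> S. j' < l} - {j}" by auto
  show "count_below (S - {j}) l = (if j < l then count_below S l - 1 else count_below S l)"
    using assms unfolding * by (auto simp: card_Diff_singleton_if)
  show "j < l \<Longrightarrow> count_below S l \<ge> 1"
    using assms card_0_eq[of "{j' \<in> S. j' < l}"] by (auto simp: Suc_le_eq card_gt_0_iff)
qed

lemma count_above_remove:
  fixes S :: "'i::linorder set"
  assumes "finite S" "j \<in> S"
  shows "count_above (S - {j}) l = (if l < j then count_above S l - 1 else count_above S l)"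
    and "l < j \<Longrightarrow> count_above S l \<ge> 1"
proof -
  have *: "{j' \<in> S - {j}. l < j'} = {j' \<in> S. l < j'} - {j}" by auto
  show "count_above (S - {j}) l = (if l < j then count_above S l - 1 else count_above S l)"
    using assms unfolding * by (auto simp: card_Diff_singleton_if)
  show "l < j \<Longrightarrow> count_above S l \<ge> 1"
    using assms card_0_eq[of "{j' \<in> S. l < j'}"] by (auto simp: Suc_le_eq card_gt_0_iff)
qed

text \<open>The list form of \<open>perm_length\<close>. Splitting off the head matches the
  expansion of a minor along its first row.\<close>

fun inversions :: "'i::linorder list \<Rightarrow> nat" where
  "inversions [] = 0"
| "inversions (j # js) = count_below (set js) j + inversions js"

lemma inversions_sorted: "sorted js \<Longrightarrow> inversions js = 0"
  by (induction js) (auto simp: not_less)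

lemma inversions_snoc: "distinct (js @ [j]) \<Longrightarrow> inversions (js @ [j]) = count_above (set js) j + inversions js"
proof (induction js)
  case (Cons a js)
  then have a: "a \<notin> set js" "a \<noteq> j" by auto
  have 1: "{j'. (j' = a \<or> j' \<in> set js) \<and> j < j'} = (if j < a then insert a {j' \<in> set js. j < j'} else {j' \<in> set js. j < j'})"
    by auto
  have 2: "{j'. (j' = j \<or> j' \<in> set js) \<and> j' < a} = (if j < a then insert j {j' \<in> set js. j' < a} else {j' \<in> set js. j' < a})"
    by auto
  from Cons a show ?case by (auto simp: 1 2)
qed simp

context scalar_algebra
begin

text \<open>Rows form a list because they may be out of order or repeated; columns form a set
  because each is weighted by its position in increasing order. With \<open>u = - t\<close> this is
  the quantum minor. If there are more or fewer columns than rows, the value is 0.\<close>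

fun qminor :: "'r \<Rightarrow> ('h \<Rightarrow> 'i::linorder \<Rightarrow> 'a) \<Rightarrow> 'h list \<Rightarrow> 'i set \<Rightarrow> 'a" where
  "qminor u x [] S = (if S = {} then 1 else 0)"
| "qminor u x (i # is) S = (\<Sum>j\<in>S. scale (u ^ count_below S j) (x i j * qminor u x is (S - {j})))"

declare qminor.simps [simp del]

text \<open>The leading rows are expanded first and only remove columns, so an identity between
  minors of the remaining rows, valid for all column sets inside S, survives any common leading
  rows.\<close>

lemma qminor_cong_prefix:
  assumes "\<And>S'. S' \<subseteq> S \<Longrightarrow> qminor u x v S' = scale c (qminor u x w S')"
  shows "qminor u x (p @ v) S = scale c (qminor u x (p @ w) S)"
  using assms
proof (induction p arbitrary: S)
  case (Cons i p)
  have "qminor u x (p @ v) (S - {j}) = scale c (qminor u x (p @ w) (S - {j}))" for j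
    using Cons.prems by (intro Cons.IH) blast
  then show ?case by (simp add: qminor.simps scale_sum_right mult.commute)
qed simp

lemma qminor_snoc:
  assumes "finite S"
  shows "qminor u x (is @ [i]) S
    = (\<Sum>j\<in>S. scale (u ^ count_above S j) (qminor u x is (S - {j}) * x i j))"
  using assms
proof (induction "is" arbitrary: S)
  case Nil
  have "j \<in> S \<Longrightarrow> S - {j} = {} \<Longrightarrow> count_above S j = 0 \<and> count_below S j = 0" for j
    by (cases "S = {j}") auto
  then show ?case by (auto simp: qminor.simps intro!: sum.cong)
next
  case (Cons h "is")
  \<comment> \<open>For l < j the pair is an inversion: the left side counts it when j is removed
    first, the right side when l is removed first. For j < l neither side counts it.\<close>
  have ex: "count_below S j + count_above (S - {j}) l = count_above S l + count_below (S - {l}) j"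
    if "j \<in> S" "l \<in> S" "j \<noteq> l" for j l
    using that Cons.prems count_above_remove[OF Cons.prems \<open>j \<in> S\<close>, of l]
      count_below_remove[OF Cons.prems \<open>l \<in> S\<close>, of j] by auto
  have "qminor u x ((h # is) @ [i]) S = (\<Sum>j\<in>S. \<Sum>l\<in>S - {j}. scale (u ^ (count_below S j + count_above (S - {j}) l))
      (x h j * qminor u x is (S - {j} - {l}) * x i l))"
    using Cons.prems by (simp add: qminor.simps Cons.IH sum_distrib_left scale_sum_right power_add mult.assoc)
  also have "\<dots> = (\<Sum>j\<in>S. \<Sum>l | l \<in> S \<and> l \<noteq> j. scale (u ^ (count_above S l + count_below (S - {l}) j))
      (x h j * qminor u x is (S - {l} - {j}) * x i l))"
  proof (intro sum.cong refl)
    fix j l assume "j \<in> S" "l \<in> {l \<in> S. l \<noteq> j}"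
    then show "scale (u ^ (count_below S j + count_above (S - {j}) l)) (x h j * qminor u x is (S - {j} - {l}) * x i l)
      = scale (u ^ (count_above S l + count_below (S - {l}) j)) (x h j * qminor u x is (S - {l} - {j}) * x i l)"
      by (subst ex) (auto simp only: Diff_insert[symmetric] insert_commute)
  qed auto
  also have "\<dots> = (\<Sum>l\<in>S. \<Sum>j | j \<in> S \<and> l \<noteq> j. scale (u ^ (count_above S l + count_below (S - {l}) j))
      (x h j * qminor u x is (S - {l} - {j}) * x i l))"
    by (rule sum.swap_restrict[OF Cons.prems Cons.prems])
  also have "\<dots> = (\<Sum>l\<in>S. \<Sum>j\<in>S - {l}. scale (u ^ (count_above S l + count_below (S - {l}) j))
      (x h j * qminor u x is (S - {l} - {j}) * x i l))"
    by (intro sum.cong) auto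
  also have "\<dots> = (\<Sum>j\<in>S. scale (u ^ count_above S j) (qminor u x (h # is) (S - {j}) * x i j))"
    by (simp add: qminor.simps sum_distrib_right scale_sum_right power_add)
  finally show ?case .
qed

text \<open>Unfolds the recursion into the Leibniz sum: the choice of the first column j contributes
  the inversions that start at j.\<close>

lemma qminor_permutations:
  assumes "finite S" "card S = length is"
  shows "qminor u x is S
    = (\<Sum>js\<in>permutations_of_set S. scale (u ^ inversions js) (\<Prod>(i, j)\<leftarrow>zip is js. x i j))"
  using assms
proof (induction "is" arbitrary: S)
  case Nil
  then show ?case by (simp add: qminor.simps)
next
  case (Cons i "is")
  then have "S \<noteq> {}" by auto
  note fin = \<open>finite S\<close>
  have count: "count_below S j = count_below (set js) j" if "js \<in> permutations_of_set (S - {j})" for j js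
    using permutations_of_setD(1)[OF that] by (intro arg_cong[where f = card]) auto
  have "(\<Sum>js\<in>permutations_of_set S. scale (u ^ inversions js) (\<Prod>(i, j)\<leftarrow>zip (i # is) js. x i j))
    = (\<Sum>j\<in>S. \<Sum>js\<in>(#) j ` permutations_of_set (S - {j}). scale (u ^ inversions js) (\<Prod>(i, j)\<leftarrow>zip (i # is) js. x i j))"
    unfolding permutations_of_set_nonempty[OF \<open>S \<noteq> {}\<close>]
    by (rule sum.UNION_disjoint) (use fin in auto)
  also have "\<dots> = (\<Sum>j\<in>S. \<Sum>js\<in>permutations_of_set (S - {j}).
      scale (u ^ count_below S j * u ^ inversions js) (x i j * (\<Prod>(i, j)\<leftarrow>zip is js. x i j)))"
    proof (rule sum.cong[OF refl])
    fix j assume "j \<in> S"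
    show "(\<Sum>js\<in>(#) j ` permutations_of_set (S - {j}). scale (u ^ inversions js) (\<Prod>(i, j)\<leftarrow>zip (i # is) js. x i j))
      = (\<Sum>js\<in>permutations_of_set (S - {j}).
        scale (u ^ count_below S j * u ^ inversions js) (x i j * (\<Prod>(i, j)\<leftarrow>zip is js. x i j)))"
      by (subst sum.reindex) (auto simp: inj_on_def count power_add)
  qed
  also have "\<dots> = qminor u x (i # is) S"
    using Cons.prems by (simp add: qminor.simps Cons.IH scale_sum_right sum_distrib_left)
  finally show ?case ..
qed

end

text \<open>The relations of an ungraded quantum matrix. The parameter is kept general because the
  even block has \<open>t\<close> equal to 1/q and the odd block has \<open>t\<close> equal to
  q.\<close>

locale quantum_matrix = scalar_algebra scale
  for scale :: "'r::comm_ring_1 \<Rightarrow> 'a::{ring,monoid_mult} \<Rightarrow> 'a" +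
  fixes t t' :: 'r and x :: "nat \<Rightarrow> nat \<Rightarrow> 'a" and B :: "nat set"
  assumes t_inverse: "t * t' = 1"
    and row: "i \<in> B \<Longrightarrow> j \<in> B \<Longrightarrow> l \<in> B \<Longrightarrow> j < l \<Longrightarrow> x i j * x i l = scale t (x i l * x i j)"
    and col: "i \<in> B \<Longrightarrow> k \<in> B \<Longrightarrow> j \<in> B \<Longrightarrow> i < k \<Longrightarrow> x i j * x k j = scale t (x k j * x i j)"
    and anti: "i \<in> B \<Longrightarrow> k \<in> B \<Longrightarrow> j \<in> B \<Longrightarrow> l \<in> B \<Longrightarrow> i < k \<Longrightarrow> j < l \<Longrightarrow> x i l * x k j = x k j * x i l"
    and diag: "i \<in> B \<Longrightarrow> k \<in> B \<Longrightarrow> j \<in> B \<Longrightarrow> l \<in> B \<Longrightarrow> i < k \<Longrightarrow> j < l \<Longrightarrow>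
      x i j * x k l = x k l * x i j + scale (t - t') (x i l * x k j)"
begin

text \<open>The correction term in \<open>diag\<close> is a product of two entries that commute by
  \<open>anti\<close>, so the order in which transposition leaves them does not matter.\<close>

lemma transpose: "quantum_matrix scale t t' (\<lambda>i j. x j i) B"
proof
  show "x l i * x j k = x j k * x l i"
    if "i \<in> B" "k \<in> B" "j \<in> B" "l \<in> B" "i < k" "j < l" for i j k l
    using that by (intro anti[symmetric])
  then show "x j i * x l k = x l k * x j i + scale (t - t') (x l i * x j k)"
    if "i \<in> B" "k \<in> B" "j \<in> B" "l \<in> B" "i < k" "j < l" for i j k l
    using that diag[of j l i k] by simp
qed (simp_all add: t_inverse row col)

abbreviation minor :: "nat list \<Rightarrow> nat set \<Rightarrow> 'a" where "minor \<equiv> qminor (- t) x"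

abbreviation tminor :: "nat list \<Rightarrow> nat set \<Rightarrow> 'a" where "tminor \<equiv> qminor (- t) (\<lambda>i j. x j i)"

text \<open>Taking two columns in the opposite order costs one factor - t, so the two leading rows
  enter only through their 2 by 2 quantum minors. Relations between rows are thereby reduced to the
  2 by 2 case.\<close>

lemma minor_two_rows:
  assumes "finite S"
  shows "minor (i # k # is) S = (\<Sum>j\<in>S. \<Sum>l | l \<in> S \<and> j < l.
    scale ((- t) ^ (count_below S j + count_below S l - 1))
      ((x i j * x k l - scale t (x i l * x k j)) * minor is (S - {j, l})))"
proof -
  have "minor (i # k # is) S = (\<Sum>j\<in>S. \<Sum>l\<in>S - {j}.
      scale ((- t) ^ (count_below S j + count_below (S - {j}) l)) (x i j * x k l * minor is (S - {j, l})))"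
    by (simp add: qminor.simps sum_distrib_left scale_sum_right power_add mult.assoc Diff_insert[symmetric] insert_commute)
  also have "\<dots> = (\<Sum>j\<in>S. \<Sum>l | l \<in> S \<and> j < l.
      scale ((- t) ^ (count_below S j + count_below S l - 1))
        ((x i j * x k l - scale t (x i l * x k j)) * minor is (S - {j, l})))"
    unfolding sum_off_diagonal[OF assms]
  proof (intro sum.cong refl)
    fix j l assume "j \<in> S" "l \<in> {l. l \<in> S \<and> j < l}"
    then have jl: "j \<in> S" "l \<in> S" "j < l" by auto
    have 1: "count_below S j + count_below (S - {j}) l = count_below S j + count_below S l - 1"
      and 2: "count_below S l + count_below (S - {l}) j = Suc (count_below S j + count_below S l - 1)"
      using jl count_below_remove[OF assms \<open>j \<in> S\<close>, of l] count_below_remove[OF assms \<open>l \<in> S\<close>, of j] by auto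
    show "scale ((- t) ^ (count_below S j + count_below (S - {j}) l)) (x i j * x k l * minor is (S - {j, l}))
        + scale ((- t) ^ (count_below S l + count_below (S - {l}) j)) (x i l * x k j * minor is (S - {l, j}))
      = scale ((- t) ^ (count_below S j + count_below S l - 1))
        ((x i j * x k l - scale t (x i l * x k j)) * minor is (S - {j, l}))"
      unfolding 1 2
      by (simp add: algebra_simps insert_commute scale_minus_left scale_right_diff_distrib)
  qed
  finally show ?thesis .
qed

lemma minor_equal_rows:
  assumes "i \<in> B" "S \<subseteq> B" "finite S"
  shows "minor (i # i # is) S = 0"
  unfolding minor_two_rows[OF assms(3)]
  by (intro sum.neutral ballI) (use assms in \<open>auto simp: row subset_iff\<close>)

lemma minor_swap_rows:
  assumes "i \<in> B" "k \<in> B" "i < k" "S \<subseteq> B" "finite S"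
  shows "minor (k # i # is) S = scale (- t) (minor (i # k # is) S)"
proof -
  have "x k j * x i l - scale t (x k l * x i j) = scale (- t) (x i j * x k l - scale t (x i l * x k j))"
    if "j \<in> S" "l \<in> S" "j < l" for j l
  proof -
    have jl: "j \<in> B" "l \<in> B" using that assms by auto
    \<comment> \<open>On the right side \<open>diag\<close> is applied to
      \<open>x i j * x k l\<close>; the product \<open>x i l * x k j\<close> then has the
      coefficient t^2 - t (t - t') = t t' = 1.\<close>
    show ?thesis
      using assms jl that t_inverse
      by (simp add: diag[of i k j l] anti[of i k j l, symmetric] algebra_simps scale_right_distrib
        scale_left_diff_distrib scale_right_diff_distrib)
  qed
  then show ?thesis
    unfolding minor_two_rows[OF assms(5)] scale_sum_right
    by (intro sum.cong refl) (simp add: mult.commute)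
qed



text \<open>One pass of insertion sort: each smaller row that row i moves past costs a factor - t,
  and meeting an equal row kills the minor.\<close>

lemma minor_insort:
  assumes "i \<in> B" "set js \<subseteq> B" "sorted_wrt (<) js" "S \<subseteq> B" "finite S"
  shows "minor (i # js) S = scale (if i \<in> set js then 0 else (- t) ^ count_below (set js) i) (minor (insort i js) S)"
  using assms(2-5)
proof (induction js arbitrary: S)
  case (Cons j js)
  consider "i < j" | "i = j" | "j < i" by (rule linorder_cases)
  then show ?case
  proof cases
    case 1
    then have e: "{j' \<in> set (j # js). j' < i} = {}" and "i \<notin> set (j # js)"
      using Cons.prems(2) by auto
    then show ?thesis unfolding e using 1 by simp
  next
    case 2
    then show ?thesis using minor_equal_rows Cons.prems assms(1) by simp
  next
    case 3
    have e: "{j' \<in> set (j # js). j' < i} = insert j {j' \<in> set js. j' < i}" using 3 by auto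
    have "j \<notin> {j' \<in> set js. j' < i}" using Cons.prems by auto
    then have c: "count_below (set (j # js)) i = Suc (count_below (set js) i)"
      unfolding e by simp
    have "minor (i # j # js) S = scale (- t) (minor ([j] @ i # js) S)"
      using minor_swap_rows[of j i S js] 3 Cons.prems assms(1) by simp
    also have "minor ([j] @ i # js) S
        = scale (if i \<in> set js then 0 else (- t) ^ count_below (set js) i) (minor ([j] @ insort i js) S)"
      by (rule qminor_cong_prefix, rule Cons.IH) (use Cons.prems finite_subset in auto)
    finally show ?thesis unfolding c using 3 by simp
  qed
qed simp

lemma minor_sort:
  assumes "set is \<subseteq> B" "S \<subseteq> B" "finite S"
  shows "minor is S = scale (if distinct is then (- t) ^ inversions is else 0) (minor (sort is) S)"
  using assms
proof (induction "is" arbitrary: S)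
  case (Cons i "is")
  have "minor ([i] @ is) S = scale (if distinct is then (- t) ^ inversions is else 0) (minor ([i] @ sort is) S)"
    by (rule qminor_cong_prefix, rule Cons.IH) (use Cons.prems finite_subset in auto)
  moreover have "minor (i # sort is) S
      = scale (if i \<in> set is then 0 else (- t) ^ count_below (set is) i) (minor (sort (i # is)) S)"
    if "distinct is"
    using minor_insort[of i "sort is" S] Cons.prems that by (simp add: strict_sorted_iff)
  ultimately show ?case by (simp add: power_add mult.commute)
qed simp

lemma minor_eq_0: "set is \<subseteq> B \<Longrightarrow> S \<subseteq> B \<Longrightarrow> finite S \<Longrightarrow> \<not> distinct is \<Longrightarrow> minor is S = 0"
  using minor_sort[of "is" S] by simp

text \<open>The family \<open>y\<close> is one more column, to the right of all the others. Moving
  \<open>y k\<close> to the left past a row i < k leaves a correction in which row i is replaced by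
  row k; summed over the columns these corrections form a minor with row k twice, which is 0. Row k
  itself contributes the factor t, and the rows after k commute with \<open>y k\<close>.\<close>

lemma minor_right_column:
  assumes y: "\<And>i j. i \<in> B \<Longrightarrow> j \<in> B \<Longrightarrow> x i j * y i = scale t (y i * x i j)"
      "\<And>i j k. i \<in> B \<Longrightarrow> j \<in> B \<Longrightarrow> k \<in> B \<Longrightarrow> i < k \<Longrightarrow> x i j * y k = y k * x i j + scale (t - t') (y i * x k j)"
      "\<And>i j k. i \<in> B \<Longrightarrow> j \<in> B \<Longrightarrow> k \<in> B \<Longrightarrow> k < i \<Longrightarrow> x i j * y k = y k * x i j"
    and "set is \<subseteq> B" "sorted_wrt (<) is" "k \<in> B" "S \<subseteq> B" "finite S"
  shows "k \<in> set is \<Longrightarrow> minor is S * y k = scale t (y k * minor is S)"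
    and "(\<And>i. i \<in> set is \<Longrightarrow> k < i) \<Longrightarrow> minor is S * y k = y k * minor is S"
  using assms(4-)
proof (induction "is" arbitrary: S)
  case (Cons i "is")
  {
    case 2
    show ?case
      unfolding qminor.simps sum_distrib_left sum_distrib_right
    proof (rule sum.cong[OF refl])
      fix j assume j: "j \<in> S"
      have "minor is (S - {j}) * y k = y k * minor is (S - {j})"
        using 2 by (intro Cons.IH(2)) auto
      moreover have "x i j * y k = y k * x i j"
        using 2 j by (intro y(3)) auto
      ultimately show "scale ((- t) ^ count_below S j) (x i j * minor is (S - {j})) * y k
          = y k * scale ((- t) ^ count_below S j) (x i j * minor is (S - {j}))"
        by (simp add: mult.assoc) (simp flip: mult.assoc)
    qed
  next
    case 1
    show ?case
    proof (cases "k = i")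
      case True
      show ?thesis
        unfolding qminor.simps sum_distrib_left sum_distrib_right scale_sum_right
      proof (rule sum.cong[OF refl])
        fix j assume j: "j \<in> S"
        have "minor is (S - {j}) * y k = y k * minor is (S - {j})"
          using 1 True by (intro Cons.IH(2)) auto
        moreover have "x i j * y k = scale t (y k * x i j)"
          using 1 j True y(1)[of k j] by auto
        ultimately show "scale ((- t) ^ count_below S j) (x i j * minor is (S - {j})) * y k
            = scale t (y k * scale ((- t) ^ count_below S j) (x i j * minor is (S - {j})))"
          by (simp add: mult.assoc) (simp add: mult.commute flip: mult.assoc)
      qed
    next
      case False
      with 1 have k: "k \<in> set is" "i < k" "i \<in> B" by auto
      have "minor (i # is) S * y k = (\<Sum>j\<in>S. scale ((- t) ^ count_below S j)
          (scale t (y k * (x i j * minor is (S - {j}))) + scale (t * (t - t')) (y i * (x k j * minor is (S - {j})))))"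
        unfolding qminor.simps sum_distrib_right
      proof (rule sum.cong[OF refl])
        fix j assume j: "j \<in> S"
        have "minor is (S - {j}) * y k = scale t (y k * minor is (S - {j}))"
          using 1 k by (intro Cons.IH(1)) auto
        moreover have "x i j * y k = y k * x i j + scale (t - t') (y i * x k j)"
          using 1 j k by (intro y(2)) auto
        ultimately show "scale ((- t) ^ count_below S j) (x i j * minor is (S - {j})) * y k
          = scale ((- t) ^ count_below S j)
            (scale t (y k * (x i j * minor is (S - {j}))) + scale (t * (t - t')) (y i * (x k j * minor is (S - {j}))))"
          by (simp add: mult.assoc) (simp add: mult.commute mult.left_commute distrib_right scale_right_distrib mult.assoc flip: mult.assoc[of "x i j"])
      qed
      also have "\<dots> = scale t (y k * minor (i # is) S) + scale (t * (t - t')) (y i * minor (k # is) S)"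
        unfolding qminor.simps
        by (simp add: sum_distrib_left scale_sum_right scale_right_distrib sum.distrib mult_ac)
      also have "minor (k # is) S = 0"
        using 1 k by (intro minor_eq_0) auto
      finally show ?thesis by simp
    qed
  }
qed (simp_all add: qminor.simps)

text \<open>For a column to the left of the others the corrections come from the rows after k, so
  the induction strips the last row instead of the first. Again they add up to a minor with row k
  repeated.\<close>

lemma minor_left_column:
  assumes y: "\<And>i j. i \<in> B \<Longrightarrow> j \<in> B \<Longrightarrow> x i j * y i = scale t' (y i * x i j)"
      "\<And>i j k. i \<in> B \<Longrightarrow> j \<in> B \<Longrightarrow> k \<in> B \<Longrightarrow> k < i \<Longrightarrow> x i j * y k = y k * x i j - scale (t - t') (y i * x k j)"
      "\<And>i j k. i \<in> B \<Longrightarrow> j \<in> B \<Longrightarrow> k \<in> B \<Longrightarrow> i < k \<Longrightarrow> x i j * y k = y k * x i j"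
    and "set is \<subseteq> B" "sorted_wrt (<) is" "k \<in> B" "S \<subseteq> B" "finite S"
  shows "k \<in> set is \<Longrightarrow> minor is S * y k = scale t' (y k * minor is S)"
    and "(\<And>i. i \<in> set is \<Longrightarrow> i < k) \<Longrightarrow> minor is S * y k = y k * minor is S"
proof -
  have commute: "minor is S * y k = y k * minor is S"
    if "\<And>i. i \<in> set is \<Longrightarrow> i < k" "set is \<subseteq> B" "k \<in> B" "S \<subseteq> B" for "is" S k
    using that
  proof (induction "is" arbitrary: S)
    case (Cons i "is")
    have IH: "minor is (S - {j}) * y k = y k * minor is (S - {j})" for j
      using Cons.prems by (intro Cons.IH) auto
    have "x i j * y k = y k * x i j" if "j \<in> S" for j
      using Cons.prems that by (intro y(3)) auto
    with IH have "scale ((- t) ^ count_below S j) (x i j * minor is (S - {j})) * y k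
          = y k * scale ((- t) ^ count_below S j) (x i j * minor is (S - {j}))" if "j \<in> S" for j
      using that by (simp add: mult.assoc) (simp flip: mult.assoc)
    then show ?case unfolding qminor.simps sum_distrib_left sum_distrib_right by (rule sum.cong[OF refl])
  qed (simp add: qminor.simps)
  show "minor is S * y k = y k * minor is S" if "\<And>i. i \<in> set is \<Longrightarrow> i < k"
    using commute assms that by blast
  show "minor is S * y k = scale t' (y k * minor is S)" if "k \<in> set is"
    using that assms(4-)
  proof (induction "is" arbitrary: S rule: rev_induct)
    case (snoc i "is")
    \<comment> \<open>Row i is the last one, so the factor \<open>y i\<close> of a correction can be
      moved in front of all the other rows.\<close>
    have comm_i: "minor is S' * y i = y i * minor is S'" if "S' \<subseteq> S" for S'
      using snoc.prems that by (intro commute) (auto simp: sorted_wrt_append)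
    show ?case
    proof (cases "k = i")
      case True
      show ?thesis
        unfolding qminor_snoc[OF snoc.prems(6)] sum_distrib_left sum_distrib_right scale_sum_right
      proof (rule sum.cong[OF refl])
        fix j assume j: "j \<in> S"
        have "x i j * y k = scale t' (y k * x i j)"
          using snoc.prems j True y(1)[of k j] by auto
        then show "scale ((- t) ^ count_above S j) (minor is (S - {j}) * x i j) * y k
            = scale t' (y k * scale ((- t) ^ count_above S j) (minor is (S - {j}) * x i j))"
          using comm_i[of "S - {j}"] True
          by (simp add: mult.assoc) (simp add: mult.commute flip: mult.assoc)
      qed
    next
      case False
      with snoc.prems have k: "k \<in> set is" "k < i" "i \<in> B" by (auto simp: sorted_wrt_append)
      have "minor (is @ [i]) S * y k = (\<Sum>j\<in>S. scale ((- t) ^ count_above S j)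
          (scale t' (y k * (minor is (S - {j}) * x i j)) - scale (t - t') (y i * (minor is (S - {j}) * x k j))))"
        unfolding qminor_snoc[OF snoc.prems(6)] sum_distrib_right
      proof (rule sum.cong[OF refl])
        fix j assume j: "j \<in> S"
        have "minor is (S - {j}) * y k = scale t' (y k * minor is (S - {j}))"
          using snoc.prems k by (intro snoc.IH) (auto simp: sorted_wrt_append)
        moreover have "x i j * y k = y k * x i j - scale (t - t') (y i * x k j)"
          using snoc.prems j k by (intro y(2)) auto
        ultimately show "scale ((- t) ^ count_above S j) (minor is (S - {j}) * x i j) * y k
          = scale ((- t) ^ count_above S j)
            (scale t' (y k * (minor is (S - {j}) * x i j)) - scale (t - t') (y i * (minor is (S - {j}) * x k j)))"
          using comm_i[of "S - {j}"]
          by (simp add: mult.assoc) (simp add: right_diff_distrib scale_right_diff_distrib flip: mult.assoc)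
      qed
      also have "\<dots> = scale t' (y k * minor (is @ [i]) S) - scale (t - t') (y i * minor (is @ [k]) S)"
        unfolding qminor_snoc[OF snoc.prems(6)]
        by (simp add: sum_distrib_left scale_sum_right scale_right_diff_distrib sum_subtractf mult_ac)
      also have "minor (is @ [k]) S = 0"
        using snoc.prems k by (intro minor_eq_0) auto
      finally show ?thesis by simp
    qed
  qed simp
qed

text \<open>Since r is the smallest row, an entry \<open>x i c\<close> taken from a column c before
  j is in anti-diagonal position to \<open>x r j\<close> and commutes with it. The entry from row r
  can therefore be pulled to the front without corrections.\<close>

lemma tminor_first_row:
  assumes "r \<in> R" "\<And>i. i \<in> R \<Longrightarrow> r \<le> i" "set js \<subseteq> B" "sorted_wrt (<) js" "R \<subseteq> B" "finite R"
  shows "tminor js R = (\<Sum>j\<in>set js. scale ((- t) ^ count_below (set js) j)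
    (x r j * tminor (remove1 j js) (R - {r})))"
  using assms
proof (induction js arbitrary: R)
  case (Cons c js)
  have c: "c \<in> B" "c \<notin> set js" "\<And>j. j \<in> set js \<Longrightarrow> c < j" using Cons.prems by auto
  have below_r: "count_below R r = 0" using Cons.prems(2) by fastforce
  have below_c: "count_below (set (c # js)) c = 0" using c by fastforce
  have below_Suc: "count_below (set (c # js)) j = Suc (count_below (set js) j)" if "j \<in> set js" for j
  proof -
    have "{j' \<in> set (c # js). j' < j} = insert c {j' \<in> set js. j' < j}" using c that by auto
    then show ?thesis using c by simp
  qed
  have "(\<Sum>i\<in>R - {r}. scale ((- t) ^ count_below R i) (x i c * tminor js (R - {i})))
    = (\<Sum>i\<in>R - {r}. \<Sum>j\<in>set js. scale ((- t) ^ count_below (set (c # js)) j)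
        (x r j * (scale ((- t) ^ count_below (R - {r}) i) (x i c * tminor (remove1 j js) (R - {r} - {i})))))"
  proof (rule sum.cong[OF refl])
    fix i assume i: "i \<in> R - {r}"
    then have "r < i" "i \<in> B" "r \<in> B" using Cons.prems by force+
    have cnt: "count_below R i = Suc (count_below (R - {r}) i)"
      using count_below_remove[OF \<open>finite R\<close> \<open>r \<in> R\<close>, of i] \<open>r < i\<close> by auto
    have "tminor js (R - {i}) = (\<Sum>j\<in>set js. scale ((- t) ^ count_below (set js) j)
        (x r j * tminor (remove1 j js) (R - {i} - {r})))"
      using Cons.prems i by (intro Cons.IH) auto
    moreover have "x i c * (x r j * z) = x r j * (x i c * z)" if "j \<in> set js" for j z
    proof -
      have "x r j * x i c = x i c * x r j"
        using c(1) c(3)[OF that] that Cons.prems \<open>r < i\<close> \<open>i \<in> B\<close> \<open>r \<in> B\<close>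
        by (intro anti) auto
      then show ?thesis by (simp flip: mult.assoc)
    qed
    ultimately show "scale ((- t) ^ count_below R i) (x i c * tminor js (R - {i}))
      = (\<Sum>j\<in>set js. scale ((- t) ^ count_below (set (c # js)) j)
        (x r j * (scale ((- t) ^ count_below (R - {r}) i) (x i c * tminor (remove1 j js) (R - {r} - {i})))))"
      by (simp add: below_Suc[simplified] cnt sum_distrib_left scale_sum_right mult_ac Diff_insert[symmetric] insert_commute)
  qed
  also have "\<dots> = (\<Sum>j\<in>set js. scale ((- t) ^ count_below (set (c # js)) j)
        (x r j * tminor (c # remove1 j js) (R - {r})))"
    unfolding qminor.simps sum_distrib_left scale_sum_right by (rule sum.swap)
  also have "\<dots> = (\<Sum>j\<in>set js. scale ((- t) ^ count_below (set (c # js)) j)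
        (x r j * tminor (remove1 j (c # js)) (R - {r})))"
    by (rule sum.cong[OF refl]) (use c in auto)
  finally show ?case
    unfolding qminor.simps using Cons.prems c below_r below_c
    by (simp only: sum.remove[of R r] list.set sum.insert[OF finite_set c(2)] below_r below_c remove1.simps if_True simp_thms)
qed (auto simp: qminor.simps)

text \<open>Row and column expansions run through the same monomials: sorting a monomial by columns instead of
  rows only exchanges entries in anti-diagonal position, which commute.\<close>

lemma minor_transpose:
  assumes "set is \<subseteq> B" "sorted_wrt (<) is" "set js \<subseteq> B" "sorted_wrt (<) js" "length is = length js"
  shows "minor is (set js) = tminor js (set is)"
  using assms
proof (induction "is" arbitrary: js)
  case Nil
  then show ?case by (simp add: qminor.simps)
next
  case (Cons r "is")
  have dist: "distinct js" using Cons.prems(4) by (simp add: strict_sorted_iff)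
  have "r \<notin> set is" using Cons.prems by auto
  have "minor (r # is) (set js) = (\<Sum>j\<in>set js. scale ((- t) ^ count_below (set js) j)
      (x r j * tminor (remove1 j js) (set is)))"
    unfolding qminor.simps
  proof (rule sum.cong[OF refl])
    fix j assume j: "j \<in> set js"
    have "minor is (set (remove1 j js)) = tminor (remove1 j js) (set is)"
      using Cons.prems j dist
      by (intro Cons.IH) (auto simp: length_remove1 sorted_remove1 strict_sorted_iff)
    then show "scale ((- t) ^ count_below (set js) j) (x r j * minor is (set js - {j}))
        = scale ((- t) ^ count_below (set js) j) (x r j * tminor (remove1 j js) (set is))"
      by (simp add: dist)
  qed
  also have "\<dots> = tminor js (set (r # is))"
    using tminor_first_row[of r "set (r # is)" js] Cons.prems \<open>r \<notin> set is\<close> by fastforce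
  finally show ?case .
qed

end

section \<open>The quantum determinant of a square block\<close>

locale quantum_square = quantum_matrix scale t t' x "{1..N}"
  for scale :: "'r::comm_ring_1 \<Rightarrow> 'a::{ring,monoid_mult} \<Rightarrow> 'a" and t t' x and N :: nat
begin

abbreviation rows :: "nat list" where "rows \<equiv> [1..<Suc N]"

definition qdet :: 'a where "qdet = minor rows {1..N}"

lemma qdet_transpose: "qdet = tminor rows {1..N}"
  unfolding qdet_def using minor_transpose[of rows rows] by (simp add: atLeastLessThanSuc_atLeastAtMost del: upt_Suc)

lemma minor_eq_qdet:
  assumes "set is \<subseteq> {1..N}" "length is = N"
  shows "minor is {1..N} = scale (if distinct is then (- t) ^ inversions is else 0) qdet"
proof (cases "distinct is")
  case True
  then have "set is = {1..N}"
    using assms by (intro card_subset_eq) (auto simp: distinct_card)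
  then have "sort is = rows"
    using True by (intro sorted_distinct_set_unique) (auto simp: atLeastLessThanSuc_atLeastAtMost simp del: upt_Suc)
  then show ?thesis using minor_sort[of "is" "{1..N}"] assms True by (simp add: qdet_def)
qed (use minor_eq_0 assms in auto)

text \<open>These are the exponents that arise when a row is put in front of, or behind, the
  complementary rows that make up an entry of the adjugate.\<close>

lemma inversions_rows:
  assumes "k \<in> {1..N}"
  shows "inversions (k # remove1 k rows) = k - 1" "inversions (remove1 k rows @ [k]) = N - k"
proof -
  have s: "set (remove1 k rows) = {1..N} - {k}"
    by (simp add: atLeastLessThanSuc_atLeastAtMost del: upt_Suc)
  have i: "inversions (remove1 k rows) = 0"
    by (intro inversions_sorted sorted_remove1) (simp del: upt_Suc)
  have *: "{j \<in> {1..N} - {k}. j < k} = {1..<k}" "{j \<in> {1..N} - {k}. k < j} = {Suc k..N}" using assms by auto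
  show "inversions (k # remove1 k rows) = k - 1"
    unfolding inversions.simps s i * by simp
  have "distinct (remove1 k rows @ [k])" unfolding distinct_append s by (simp del: upt_Suc)
  then show "inversions (remove1 k rows @ [k]) = N - k"
    by (simp only: inversions_snoc s i *) simp
qed

lemma count_below_atLeast1: "j \<in> {1..N} \<Longrightarrow> count_below {1..N} j = j - 1"
proof -
  assume "j \<in> {1..N}"
  then have "{j' \<in> {1..N}. j' < j} = {1..<j}" by auto
  then show ?thesis by simp
qed

lemma count_above_atMost: "j \<in> {1..N} \<Longrightarrow> count_above {1..N} j = N - j"
proof -
  assume "j \<in> {1..N}"
  then have "{j' \<in> {1..N}. j < j'} = {Suc j..N}" by auto
  then show ?thesis by simp
qed

text \<open>Both products with the adjugate are the determinant, so with
  \<open>Z = \<Sum> (- t)^(j - 1 + N - k) x\<^sub>i\<^sub>j A\<^sub>k\<^sub>j x\<^sub>k\<^sub>l\<close> one gets \<open>(- t)^(N - 1) qdet x\<^sub>i\<^sub>l = Z = (- t)^(N - 1) x\<^sub>i\<^sub>l qdet\<close>.\<close>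

lemma qdet_central:
  assumes "i \<in> {1..N}" "l \<in> {1..N}"
  shows "qdet * x i l = x i l * qdet"
proof -
  \<comment> \<open>The adjugate entry without its sign; the signs are kept in the expansions
    below.\<close>
  define A where "A k j = minor (remove1 k rows) ({1..N} - {j})" for k j
  have set_rows: "set rows = {1..N}" by auto
  have set_remove: "set (remove1 k rows) = {1..N} - {k}" for k
    unfolding set_rows[symmetric] by (rule set_remove1_eq) simp
  have len: "length (remove1 k rows) = N - 1" if "k \<in> {1..N}" for k
    using that set_rows by (simp add: length_remove1 del: upt_Suc)
  have sorted: "sorted_wrt (<) (remove1 k rows)" for k
    by (simp add: strict_sorted_iff sorted_remove1 del: upt_Suc)
  \<comment> \<open>The same complementary minor read by columns, so that a row expansion and a
    column expansion both apply to it.\<close>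
  have A: "A k j = tminor (remove1 j rows) ({1..N} - {k})" if "k \<in> {1..N}" "j \<in> {1..N}" for k j
    using minor_transpose[of "remove1 k rows" "remove1 j rows"] that
    unfolding A_def set_remove by (simp add: len sorted set_remove del: upt_Suc One_nat_def)
  have dist: "distinct (i # remove1 k rows) \<longleftrightarrow> i = k" "distinct (remove1 k rows @ [i]) \<longleftrightarrow> i = k"
    if "i \<in> {1..N}" "k \<in> {1..N}" for i k
    using that by (auto simp: set_remove simp del: upt_Suc)
  have row_exp: "(\<Sum>j\<in>{1..N}. scale ((- t) ^ (j - 1)) (x i j * A k j)) = scale (if i = k then (- t) ^ (k - 1) else 0) qdet"
    if "k \<in> {1..N}" for k
  proof -
    have "(\<Sum>j\<in>{1..N}. scale ((- t) ^ (j - 1)) (x i j * A k j)) = minor (i # remove1 k rows) {1..N}"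
      unfolding qminor.simps A_def by (rule sum.cong[OF refl]) (simp only: count_below_atLeast1)
    also have "\<dots> = scale (if i = k then (- t) ^ (k - 1) else 0) qdet"
      using that assms dist(1)[of i k] inversions_rows(1)[of k] len[of k]
      by (subst minor_eq_qdet) (auto simp del: upt_Suc dest: notin_set_remove1)
    finally show ?thesis .
  qed
  interpret tr: quantum_square scale t t' "\<lambda>i j. x j i" N
    unfolding quantum_square_def by (rule transpose)
  \<comment> \<open>The new column is expanded in last position because in Z the factor
    \<open>x k l\<close> stands to the right of the adjugate entry. Unless j = l, a column is
    repeated.\<close>
  have col_exp: "(\<Sum>k\<in>{1..N}. scale ((- t) ^ (N - k)) (A k j * x k l)) = scale (if j = l then (- t) ^ (N - j) else 0) qdet"
    if "j \<in> {1..N}" for j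
  proof -
    have "(\<Sum>k\<in>{1..N}. scale ((- t) ^ (N - k)) (A k j * x k l)) = tminor (remove1 j rows @ [l]) {1..N}"
      unfolding qminor_snoc[OF finite_atLeastAtMost]
      by (rule sum.cong[OF refl]) (simp only: A[OF _ that] count_above_atMost)
    also have "\<dots> = scale (if j = l then (- t) ^ (N - j) else 0) qdet"
      using that assms dist(2)[of l j] inversions_rows(2)[of j] len[of j]
      by (subst tr.minor_eq_qdet) (auto simp: tr.qdet_def qdet_transpose simp del: upt_Suc dest: notin_set_remove1)
    finally show ?thesis .
  qed
  define Z where "Z = (\<Sum>j\<in>{1..N}. \<Sum>k\<in>{1..N}. scale ((- t) ^ (j - 1) * (- t) ^ (N - k)) (x i j * A k j * x k l))"
  have "Z = (\<Sum>k\<in>{1..N}. scale ((- t) ^ (N - k)) ((\<Sum>j\<in>{1..N}. scale ((- t) ^ (j - 1)) (x i j * A k j)) * x k l))"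
    unfolding Z_def by (subst sum.swap) (simp add: sum_distrib_right scale_sum_right mult.commute)
  also have "\<dots> = (\<Sum>k\<in>{1..N}. if k = i then scale ((- t) ^ (N - k + (k - 1))) (qdet * x k l) else 0)"
    by (rule sum.cong[OF refl]) (auto simp: row_exp simp flip: power_add simp del: One_nat_def)
  also have "\<dots> = scale ((- t) ^ (N - 1)) (qdet * x i l)" using assms by simp
  finally have Z1: "Z = scale ((- t) ^ (N - 1)) (qdet * x i l)" .
  have "Z = (\<Sum>j\<in>{1..N}. scale ((- t) ^ (j - 1)) (x i j * (\<Sum>k\<in>{1..N}. scale ((- t) ^ (N - k)) (A k j * x k l))))"
    unfolding Z_def by (simp add: sum_distrib_left scale_sum_right mult.assoc)
  also have "\<dots> = (\<Sum>j\<in>{1..N}. if j = l then scale ((- t) ^ (j - 1 + (N - j))) (x i j * qdet) else 0)"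
    by (rule sum.cong[OF refl]) (auto simp: col_exp simp flip: power_add simp del: One_nat_def)
  also have "\<dots> = scale ((- t) ^ (N - 1)) (x i l * qdet)" using assms by simp
  finally have Z2: "Z = scale ((- t) ^ (N - 1)) (x i l * qdet)" .
  have inv: "scale ((- t') ^ (N - 1)) (scale ((- t) ^ (N - 1)) z) = z" for z
    by (simp add: power_mult_distrib[symmetric] mult.commute[of t'] t_inverse)
  have "qdet * x i l = scale ((- t') ^ (N - 1)) Z" unfolding Z1 inv ..
  also have "\<dots> = x i l * qdet" unfolding Z2 inv ..
  finally show ?thesis .
qed

end


section \<open>Evaluation homomorphisms\<close>

lemma letters_zero [simp]: "letters 0 = []"
  by (simp add: zero_word_def)

lemma letters_plus [simp]: "letters (u + v) = letters u @ letters v"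
  by (simp add: plus_word_def)

context scalar_algebra
begin

definition free_eval :: "('g \<Rightarrow> 'a) \<Rightarrow> ('g word \<Rightarrow>\<^sub>0 'r) \<Rightarrow> 'a"
  where "free_eval \<phi> = lin_ext scale (\<lambda>w. \<Prod>g\<leftarrow>letters w. \<phi> g)"

lemma free_eval_hom: "module_hom fscale scale (free_eval \<phi>)"
  unfolding free_eval_def by (rule lin_ext_hom[OF module_axioms])

lemmas free_eval_simps =
  module_hom.add[OF free_eval_hom] module_hom.scale[OF free_eval_hom] module_hom.zero[OF free_eval_hom]
  module_hom.diff[OF free_eval_hom] module_hom.sum[OF free_eval_hom]

lemma free_eval_single: "free_eval \<phi> (Poly_Mapping.single w c) = scale c (\<Prod>g\<leftarrow>letters w. \<phi> g)"
  unfolding free_eval_def by (rule lin_ext_single[OF module_axioms])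

lemma free_eval_gen: "free_eval \<phi> (Poly_Mapping.single (Word [g]) 1) = \<phi> g"
  by (simp add: free_eval_single)

lemma free_eval_one: "free_eval \<phi> 1 = 1"
  using free_eval_single[of \<phi> 0 1] by simp

lemma free_eval_mult: "free_eval \<phi> (x * y) = free_eval \<phi> x * free_eval \<phi> y"
proof (induction x rule: poly_mapping_single_induct)
  case (single v c)
  show ?case
    by (induction y rule: poly_mapping_single_induct)
      (simp_all add: free_eval_simps free_eval_single mult_single distrib_left mult.commute)
qed (simp_all add: free_eval_simps distrib_right)

lemma free_eval_prod_list: "free_eval \<phi> (\<Prod>a\<leftarrow>xs. f a) = (\<Prod>a\<leftarrow>xs. free_eval \<phi> (f a))"
  by (induction xs) (simp_all add: free_eval_one free_eval_mult)

lemma free_eval_ideal: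
  assumes "\<And>s. s \<in> S \<Longrightarrow> free_eval \<phi> s = 0" "x \<in> two_sided_ideal S"
  shows "free_eval \<phi> x = 0"
  using assms(2) by induction (simp_all add: free_eval_simps free_eval_mult assms(1))

end

lemma tens2_sum_left: "(\<Sum>i\<in>A. f i) \<otimes> b = (\<Sum>i\<in>A. f i \<otimes> b)"
  by (induction A rule: infinite_finite_induct) (simp_all add: tens2_add_left)

lemma tens2_sum_right: "a \<otimes> (\<Sum>i\<in>A. f i) = (\<Sum>i\<in>A. a \<otimes> f i)"
  by (induction A rule: infinite_finite_induct) (simp_all add: tens2_add_right)

lemma t2scale_mult_left: "t2scale c t * u = t2scale c (t * u :: ('k::field, 'm::finite, 'n::finite) kGL2)"
  unfolding times_kGL2_def by (rule ext2_scale[OF times_bilin])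

lemma t2scale_mult_right: "t * t2scale c u = t2scale c (t * u :: ('k::field, 'm::finite, 'n::finite) kGL2)"
proof (induction t rule: kGL2_induct)
  case (tens a b)
  have "(a \<otimes> b) * u = ext2 t2scale (\<lambda>c d. tens_prod a b c d) u" for u :: "('k, 'm, 'n) kGL2"
    unfolding times_kGL2_def by (rule ext2_tens[OF times_bilin])
  then show ?case by (simp add: ext2_scale[OF tens_prod_bilin_right])
qed (simp add: distrib_right kGL2.scale_right_distrib)

locale gl_algebra = scalar_algebra scale
  for scale :: "'k::field laurent \<Rightarrow> 'a::{ring,monoid_mult} \<Rightarrow> 'a"
begin

text \<open>Evaluates an arbitrary representative. The value is independent of the choice only under
  \<open>respects_gl\<close>, which is why all facts about it carry that hypothesis.\<close>

definition gl_map :: "(('m::finite, 'n::finite) gen \<Rightarrow> 'a) \<Rightarrow> ('k, 'm, 'n) kGL \<Rightarrow> 'a"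
  where "gl_map \<phi> x = free_eval \<phi> (rep_kGL x)"

definition respects_gl :: "(('m::finite, 'n::finite) gen \<Rightarrow> 'a) \<Rightarrow> bool"
  where "respects_gl \<phi> \<longleftrightarrow> (\<forall>s \<in> (gl_rel :: ('k, 'm, 'n) falg set). free_eval \<phi> s = 0)"

lemma gl_map_abs:
  assumes "respects_gl \<phi>"
  shows "gl_map \<phi> (abs_kGL x) = free_eval \<phi> x"
  using free_eval_ideal[OF _ rep_abs_kGL[of x], of \<phi>] assms
  by (simp add: gl_map_def respects_gl_def free_eval_simps)

lemma gl_map_hom:
  assumes "respects_gl \<phi>"
  shows "module_hom qscale scale (gl_map \<phi>)"
proof (unfold_locales)
  fix x y and c
  show "gl_map \<phi> (x + y) = gl_map \<phi> x + gl_map \<phi> y"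
    by (cases x rule: kGL_cases; cases y rule: kGL_cases)
      (simp add: plus_kGL.abs_eq gl_map_abs[OF assms] free_eval_simps)
  show "gl_map \<phi> (qscale c x) = scale c (gl_map \<phi> x)"
    by (cases x rule: kGL_cases) (simp add: qscale_abs gl_map_abs[OF assms] free_eval_simps)
qed

lemma gl_map_mult: "respects_gl \<phi> \<Longrightarrow> gl_map \<phi> (x * y) = gl_map \<phi> x * gl_map \<phi> y"
  by (cases x rule: kGL_cases; cases y rule: kGL_cases)
    (simp add: times_kGL.abs_eq gl_map_abs free_eval_mult)

lemma gl_map_one: "respects_gl \<phi> \<Longrightarrow> gl_map \<phi> 1 = 1"
  by (simp add: one_kGL.abs_eq gl_map_abs free_eval_one)

lemma gl_map_gen: "respects_gl \<phi> \<Longrightarrow> gl_map \<phi> (abs_kGL (fgen g)) = \<phi> g"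
  by (simp add: gl_map_abs fgen_def free_eval_gen)

end

section \<open>The relations in matrix form\<close>

lemma qpow_mult: "qpow a * qpow b = qpow (a + b)"
  by (simp add: qpow_def mult_single)

lemma qpow_0: "qpow 0 = 1"
  by (simp add: qpow_def)

lemma ipar_cases: "ipar i = 0 \<or> ipar i = 1"
  by (simp add: ipar_def)

text \<open>The entries of the R-matrix: \<open>e\<^sub>i \<otimes> e\<^sub>k\<close> is sent to
  \<open>rflip i k e\<^sub>k \<otimes> e\<^sub>i + rdiag i k e\<^sub>i \<otimes> e\<^sub>k\<close>.\<close>

definition rflip :: "('m::finite, 'n::finite) idx \<Rightarrow> ('m, 'n) idx \<Rightarrow> 'k::field laurent"
  where "rflip i k = (if i = k then 0 else (- 1) ^ (ipar i * ipar k))"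

text \<open>The values \<open>qinv\<close> and \<open>- qv\<close> are the two roots of the
  quadratic Hecke relation satisfied by R, and \<open>qinv - qv\<close> is their sum, the trace of R
  on a pair of distinct indices.\<close>

definition rdiag :: "('m::finite, 'n::finite) idx \<Rightarrow> ('m, 'n) idx \<Rightarrow> 'k::field laurent"
  where "rdiag i k = (if i = k then (if ipar i = 0 then qinv else - qv)
    else if num i < num k then qinv - qv else 0)"

lemma rflip_commute: "rflip i k = rflip k i"
  by (simp add: rflip_def mult.commute)

lemma num_neq: "i \<noteq> j \<Longrightarrow> num i < num j \<or> num j < num i"
  by (metis linorder_neqE_nat num_inject)

lemma num_less_imp_neq: "num i < num j \<Longrightarrow> i \<noteq> j" "num i < num j \<Longrightarrow> j \<noteq> i"
  by auto

context gl_algebra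
begin

text \<open>R is a symmetric matrix, since \<open>rflip\<close> is symmetric and the rest is
  diagonal. One operation thus describes both left multiplication by R, on a row pair, and right
  multiplication, on a column pair.\<close>

definition rmat :: "(('m::finite, 'n::finite) idx \<Rightarrow> ('m, 'n) idx \<Rightarrow> 'a) \<Rightarrow> ('m, 'n) idx \<Rightarrow> ('m, 'n) idx \<Rightarrow> 'a"
  where "rmat f i k = scale (rflip i k) (f k i) + scale (rdiag i k) (f i k)"

text \<open>With these signs the matrix \<open>T \<otimes> T\<close> is multiplicative under comultiplication.\<close>

definition tt :: "(('m::finite, 'n::finite) idx \<Rightarrow> ('m, 'n) idx \<Rightarrow> 'a) \<Rightarrow>
    ('m, 'n) idx \<Rightarrow> ('m, 'n) idx \<Rightarrow> ('m, 'n) idx \<Rightarrow> ('m, 'n) idx \<Rightarrow> 'a"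
  where "tt a i k j l = scale ((- 1) ^ ((ipar i + ipar j) * ipar k)) (a i j * a k l)"

text \<open>The relation R (T \<otimes> T) = (T \<otimes> T) R of Faddeev, Reshetikhin and
  Takhtajan, entry by entry.\<close>

definition rtt :: "(('m::finite, 'n::finite) idx \<Rightarrow> ('m, 'n) idx \<Rightarrow> 'a) \<Rightarrow> bool"
  where "rtt a \<longleftrightarrow> (\<forall>i k j l. rmat (\<lambda>i k. tt a i k j l) i k = rmat (\<lambda>j l. tt a i k j l) j l)"

definition gl_matrix :: "(('m::finite, 'n::finite) idx \<Rightarrow> ('m, 'n) idx \<Rightarrow> 'a) \<Rightarrow> bool"
  where "gl_matrix a \<longleftrightarrow>
    (\<forall>i j. apar i j = 1 \<longrightarrow> a i j * a i j = 0) \<and>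
    (\<forall>i j l. num j < num l \<longrightarrow>
      a i j * a i l = scale ((- 1) ^ (apar i j * apar i l) * qpow ((- 1) ^ (ipar i + 1))) (a i l * a i j)) \<and>
    (\<forall>i j k. num i < num k \<longrightarrow>
      a i j * a k j = scale ((- 1) ^ (apar i j * apar k j) * qpow ((- 1) ^ (ipar j + 1))) (a k j * a i j)) \<and>
    (\<forall>i j k l. num i < num k \<and> num j > num l \<or> num i > num k \<and> num j < num l \<longrightarrow>
      a i j * a k l = scale ((- 1) ^ (apar i j * apar k l)) (a k l * a i j)) \<and>
    (\<forall>i j k l. num i < num k \<longrightarrow> num j < num l \<longrightarrow>
      a i j * a k l = scale ((- 1) ^ (apar i j * apar k l)) (a k l * a i j) +
        scale ((- 1) ^ (ipar j * ipar k + ipar j * ipar l + ipar k * ipar l) * (qinv - qv)) (a i l * a k j))"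

text \<open>The relative position of the two rows and of the two columns decides which terms of R
  survive. In each position the identity becomes one of the defining relations, and the signs are
  checked over all parities.\<close>

lemma gl_matrix_imp_rtt:
  fixes a :: "('m::finite, 'n::finite) idx \<Rightarrow> ('m, 'n) idx \<Rightarrow> 'a"
  assumes "gl_matrix a"
  shows "rtt a"
proof -
  note a = assms[unfolded gl_matrix_def]
  have q: "qv * qinv = (1 :: 'k laurent)" "qinv * qv = (1 :: 'k laurent)" by (simp_all add: qpow_mult qpow_0)
  note qi = scale_left_distrib scale_left_diff_distrib
  show ?thesis
    unfolding rtt_def
  proof (intro allI)
    fix i k j l :: "('m, 'n) idx"
    consider "i = k" "j = l" | "i = k" "num j < num l" | "i = k" "num l < num j"
      | "num i < num k" "j = l" | "num k < num i" "j = l"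
      | "num i < num k" "num j < num l" | "num i < num k" "num l < num j"
      | "num k < num i" "num j < num l" | "num k < num i" "num l < num j"
      using num_neq by metis
    then show "rmat (\<lambda>i k. tt a i k j l) i k = rmat (\<lambda>j l. tt a i k j l) j l"
    proof cases
      \<comment> \<open>At a repeated entry the two sides differ only in the diagonal value of R.
        These values agree for equal parities; otherwise the entry is odd and its square is
        0.\<close>
      case 1
      show ?thesis
      proof (cases "apar i j = 1")
        case True
        then show ?thesis using a 1 by (simp add: rmat_def tt_def)
      next
        case False
        then have "ipar i = ipar j" using ipar_cases[of i] ipar_cases[of j] by (auto simp: apar_def)
        then show ?thesis using 1 by (simp add: rmat_def rflip_def rdiag_def)
      qed
    next
      case 2
      then have ne: "j \<noteq> l" by auto
      have r: "a k j * a k l = scale ((- 1) ^ (apar k j * apar k l) * qpow ((- 1) ^ (ipar k + 1))) (a k l * a k j)"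
        using a 2 by blast
      show ?thesis using 2 ne ipar_cases[of k] ipar_cases[of j] ipar_cases[of l]
        by (elim disjE) (simp_all add: rmat_def rflip_def rdiag_def tt_def apar_def r scale_right_distrib ring_distribs q qi)
    next
      case 3
      then have ne: "j \<noteq> l" by auto
      have r: "a k l * a k j = scale ((- 1) ^ (apar k l * apar k j) * qpow ((- 1) ^ (ipar k + 1))) (a k j * a k l)"
        using a 3 by blast
      show ?thesis using 3 ne ipar_cases[of k] ipar_cases[of j] ipar_cases[of l]
        by (elim disjE) (simp_all add: rmat_def rflip_def rdiag_def tt_def apar_def r scale_right_distrib ring_distribs q qi)
    next
      case 4
      then have ne: "i \<noteq> k" by auto
      have r: "a i l * a k l = scale ((- 1) ^ (apar i l * apar k l) * qpow ((- 1) ^ (ipar l + 1))) (a k l * a i l)"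
        using a 4 by blast
      show ?thesis using 4 ne ipar_cases[of i] ipar_cases[of l] ipar_cases[of k]
        by (elim disjE) (simp_all add: rmat_def rflip_def rdiag_def tt_def apar_def r scale_right_distrib ring_distribs q qi)
    next
      case 5
      then have ne: "i \<noteq> k" by auto
      have r: "a k l * a i l = scale ((- 1) ^ (apar k l * apar i l) * qpow ((- 1) ^ (ipar l + 1))) (a i l * a k l)"
        using a 5 by blast
      show ?thesis using 5 ne ipar_cases[of i] ipar_cases[of l] ipar_cases[of k]
        by (elim disjE) (simp_all add: rmat_def rflip_def rdiag_def tt_def apar_def r scale_right_distrib ring_distribs q qi)
    next
      case 6
      then have ne: "i \<noteq> k" "j \<noteq> l" by auto
      have r: "a i l * a k j = scale ((- 1) ^ (apar i l * apar k j)) (a k j * a i l)"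
        using a 6 by blast
      show ?thesis using 6 ne ipar_cases[of i] ipar_cases[of j] ipar_cases[of k] ipar_cases[of l]
        by (elim disjE) (simp_all add: rmat_def rflip_def rdiag_def tt_def apar_def r scale_right_distrib ring_distribs q qi)
    next
      case 7
      then have ne: "i \<noteq> k" "j \<noteq> l" by auto
      have r: "a i l * a k j = scale ((- 1) ^ (apar i l * apar k j)) (a k j * a i l) +
        scale ((- 1) ^ (ipar l * ipar k + ipar l * ipar j + ipar k * ipar j) * (qinv - qv)) (a i j * a k l)"
        using a 7 by blast
      show ?thesis using 7 ne ipar_cases[of i] ipar_cases[of j] ipar_cases[of k] ipar_cases[of l]
        by (elim disjE) (simp_all add: rmat_def rflip_def rdiag_def tt_def apar_def r scale_right_distrib ring_distribs q qi)
    next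
      \<comment> \<open>The triangular term of R yields \<open>a i j * a k l\<close>, while
        \<open>diag\<close> yields the same two entries in the opposite order; \<open>r2\<close>
        reconciles them.\<close>
      case 8
      then have ne: "i \<noteq> k" "j \<noteq> l" by auto
      have r: "a k j * a i l = scale ((- 1) ^ (apar k j * apar i l)) (a i l * a k j) +
        scale ((- 1) ^ (ipar j * ipar i + ipar j * ipar l + ipar i * ipar l) * (qinv - qv)) (a k l * a i j)"
        using a 8 by blast
      have r2: "a i j * a k l = scale ((- 1) ^ (apar i j * apar k l)) (a k l * a i j)"
        using a 8 by blast
      show ?thesis using 8 ne ipar_cases[of i] ipar_cases[of j] ipar_cases[of k] ipar_cases[of l]
        by (elim disjE) (simp_all add: rmat_def rflip_def rdiag_def tt_def apar_def r r2 scale_right_distrib ring_distribs q qi)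
    next
      case 9
      then have ne: "i \<noteq> k" "j \<noteq> l" by auto
      have r: "a i l * a k j = scale ((- 1) ^ (apar i l * apar k j)) (a k j * a i l)"
        using a 9 by blast
      show ?thesis using 9 ne ipar_cases[of i] ipar_cases[of j] ipar_cases[of k] ipar_cases[of l]
        by (elim disjE) (simp_all add: rmat_def rflip_def rdiag_def tt_def apar_def r scale_right_distrib ring_distribs q qi)
    qed
  qed
qed

end


section \<open>From the RTT relation back to the defining relations\<close>

context gl_algebra
begin

lemma rtt_imp_gl_matrix:
  fixes a :: "('m::finite, 'n::finite) idx \<Rightarrow> ('m, 'n) idx \<Rightarrow> 'a"
  assumes "rtt a" and sq: "\<And>i j. apar i j = 1 \<Longrightarrow> a i j * a i j = 0"
  shows "gl_matrix a"
proof -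
  have R: "rmat (\<lambda>i k. tt a i k r s) v w = rmat (\<lambda>j l. tt a v w j l) r s" for v w r s
    using assms(1) by (simp add: rtt_def)
  note defs = rmat_def rflip_def rdiag_def tt_def apar_def
  have sq1: "scale ((- 1) ^ n) (scale ((- 1) ^ n) y) = y" for n y
    by (simp add: power_mult_distrib[symmetric])
  have flip: "scale (rflip i k) (scale (rflip i k) y) = y" if "i \<noteq> k" for i k :: "('m, 'n) idx" and y
    using that by (simp add: rflip_def power_mult_distrib[symmetric])
  have aa: "a i j * a k l = scale ((- 1) ^ ((ipar i + ipar j) * ipar k)) (tt a i k j l)" for i j k l
    unfolding tt_def sq1 ..
  have row: "a i j * a i l = scale ((- 1) ^ (apar i j * apar i l) * qpow ((- 1) ^ (ipar i + 1))) (a i l * a i j)"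
    if "num j < num l" for i j l
  proof -
    have ne: "l \<noteq> j" using that by auto
    \<comment> \<open>Taking the columns in decreasing order makes the triangular term
      \<open>rdiag l j\<close> vanish.\<close>
    have E: "scale (rflip l j) (tt a i i j l) = scale (rdiag i i) (tt a i i l j)"
      using R[of l j i i] that ne by (simp add: rmat_def rdiag_def[of l j] rflip_def[of i i])
    have "a i j * a i l = scale ((- 1) ^ ((ipar i + ipar j) * ipar i) * rflip l j * rdiag i i
        * (- 1) ^ ((ipar i + ipar l) * ipar i)) (a i l * a i j)"
      unfolding scale_scale[symmetric] tt_def[symmetric] E[symmetric] flip[OF ne] by (rule aa)
    also have "(- 1) ^ ((ipar i + ipar j) * ipar i) * rflip l j * rdiag i i * (- 1) ^ ((ipar i + ipar l) * ipar i)
        = (- 1) ^ (apar i j * apar i l) * (qpow ((- 1) ^ (ipar i + 1)) :: 'k laurent)"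
      using ne ipar_cases[of i] ipar_cases[of j] ipar_cases[of l]
      by (elim disjE) (simp_all add: rflip_def rdiag_def apar_def)
    finally show ?thesis .
  qed
  have col: "a i j * a k j = scale ((- 1) ^ (apar i j * apar k j) * qpow ((- 1) ^ (ipar j + 1))) (a k j * a i j)"
    if "num i < num k" for i j k
    using R[of j j k i] that that[THEN num_less_imp_neq(1)] that[THEN num_less_imp_neq(2)] ipar_cases[of i] ipar_cases[of j] ipar_cases[of k]
    by (elim disjE) (simp_all add: defs)
  have anti: "a i j * a k l = scale ((- 1) ^ (apar i j * apar k l)) (a k l * a i j)"
    if "num i < num k" "num l < num j" for i j k l
    using R[of l j i k] that that[THEN num_less_imp_neq(1)] that[THEN num_less_imp_neq(2)] ipar_cases[of i] ipar_cases[of j] ipar_cases[of k] ipar_cases[of l]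
    by (elim disjE) (simp_all add: defs)
  have anti': "a i j * a k l = scale ((- 1) ^ (apar i j * apar k l)) (a k l * a i j)"
    if "num k < num i" "num j < num l" for i j k l
    using anti[OF that] by (simp add: mult.commute power_add[symmetric])
  have diag: "a i j * a k l = scale ((- 1) ^ (apar i j * apar k l)) (a k l * a i j) +
        scale ((- 1) ^ (ipar j * ipar k + ipar j * ipar l + ipar k * ipar l) * (qinv - qv)) (a i l * a k j)"
    if "num i < num k" "num j < num l" for i j k l
  proof -
    have swap: "a k j * a i l = scale ((- 1) ^ (apar k j * apar i l)) (a i l * a k j)"
      using that by (intro anti')
    have ne: "k \<noteq> i" "j \<noteq> l" using that by auto
    \<comment> \<open>With the rows in decreasing order the triangular term occurs on the column
      side only, where it becomes the correction term of the relation.\<close>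
    have E: "scale (rflip k i) (tt a i k j l) = scale (rflip j l) (tt a k i l j) + scale (qinv - qv) (tt a k i j l)"
      using R[of j l k i] that ne by (simp add: rmat_def rdiag_def)
    have "a i j * a k l = scale ((- 1) ^ ((ipar i + ipar j) * ipar k) * rflip k i) (scale (rflip j l) (tt a k i l j)
        + scale (qinv - qv) (tt a k i j l))"
      unfolding E[symmetric] scale_scale[symmetric] flip[OF ne(1)] by (rule aa)
    also have "\<dots> = scale ((- 1) ^ ((ipar i + ipar j) * ipar k) * rflip k i * (rflip j l * (- 1) ^ ((ipar k + ipar l) * ipar i)))
          (a k l * a i j)
        + scale ((- 1) ^ ((ipar i + ipar j) * ipar k) * rflip k i *
            ((qinv - qv) * ((- 1) ^ ((ipar k + ipar j) * ipar i) * (- 1) ^ (apar k j * apar i l)))) (a i l * a k j)"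
      unfolding tt_def swap by (simp only: scale_right_distrib scale_scale)
    also have "(- 1) ^ ((ipar i + ipar j) * ipar k) * rflip k i * (rflip j l * (- 1) ^ ((ipar k + ipar l) * ipar i))
        = ((- 1) ^ (apar i j * apar k l) :: 'k laurent)"
      using ne ipar_cases[of i] ipar_cases[of j] ipar_cases[of k] ipar_cases[of l]
      by (elim disjE) (simp_all add: rflip_def apar_def)
    also have "(- 1) ^ ((ipar i + ipar j) * ipar k) * rflip k i *
            ((qinv - qv) * ((- 1) ^ ((ipar k + ipar j) * ipar i) * (- 1) ^ (apar k j * apar i l)))
        = (- 1) ^ (ipar j * ipar k + ipar j * ipar l + ipar k * ipar l) * (qinv - qv :: 'k laurent)"
      using ne ipar_cases[of i] ipar_cases[of j] ipar_cases[of k] ipar_cases[of l]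
      by (elim disjE) (simp_all add: rflip_def apar_def)
    finally show ?thesis .
  qed
  show ?thesis
    unfolding gl_matrix_def using sq row col anti anti' diag by blast
qed

lemma free_eval_fgen: "free_eval \<phi> (fgen g) = \<phi> g"
  unfolding fgen_def by (rule free_eval_gen)

lemma respects_glI:
  assumes "gl_matrix (\<lambda>i j. \<phi> (Mat i j))"
    and "free_eval \<phi> fD1 * \<phi> D1_inv = 1" "\<phi> D1_inv * free_eval \<phi> fD1 = 1"
    and "free_eval \<phi> fD2 * \<phi> D2_inv = 1" "\<phi> D2_inv * free_eval \<phi> fD2 = 1"
  shows "respects_gl \<phi>"
  unfolding respects_gl_def
proof
  fix s :: "('k, 'b, 'c) falg"
  assume "s \<in> gl_rel"
  then show "free_eval \<phi> s = 0"
  proof cases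
    case (odd_sq i j)
    with assms(1) show ?thesis
      unfolding gl_matrix_def by (simp add: free_eval_simps free_eval_mult free_eval_fgen)
  next
    case (row j l i)
    then have "\<phi> (Mat i j) * \<phi> (Mat i l)
        = scale ((- 1) ^ (apar i j * apar i l) * qpow ((- 1) ^ (ipar i + 1))) (\<phi> (Mat i l) * \<phi> (Mat i j))"
      using assms(1) unfolding gl_matrix_def by blast
    with row show ?thesis by (simp add: free_eval_simps free_eval_mult free_eval_fgen)
  next
    case (col i k j)
    then have "\<phi> (Mat i j) * \<phi> (Mat k j)
        = scale ((- 1) ^ (apar i j * apar k j) * qpow ((- 1) ^ (ipar j + 1))) (\<phi> (Mat k j) * \<phi> (Mat i j))"
      using assms(1) unfolding gl_matrix_def by blast
    with col show ?thesis by (simp add: free_eval_simps free_eval_mult free_eval_fgen)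
  next
    case (anti i k j l)
    then have "\<phi> (Mat i j) * \<phi> (Mat k l) = scale ((- 1) ^ (apar i j * apar k l)) (\<phi> (Mat k l) * \<phi> (Mat i j))"
      using assms(1) unfolding gl_matrix_def by blast
    with anti show ?thesis by (simp add: free_eval_simps free_eval_mult free_eval_fgen)
  next
    case (diag i k j l)
    then have "\<phi> (Mat i j) * \<phi> (Mat k l) = scale ((- 1) ^ (apar i j * apar k l)) (\<phi> (Mat k l) * \<phi> (Mat i j)) +
        scale ((- 1) ^ (ipar j * ipar k + ipar j * ipar l + ipar k * ipar l) * (qinv - qv)) (\<phi> (Mat i l) * \<phi> (Mat k j))"
      using assms(1) unfolding gl_matrix_def by blast
    with diag show ?thesis by (simp add: free_eval_simps free_eval_mult free_eval_fgen)
  qed (simp_all add: free_eval_simps free_eval_mult free_eval_one assms(2-) free_eval_fgen)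
qed

end

section \<open>The matrices of generators, of their coproducts and of their counits\<close>

interpretation GL: gl_algebra "qscale :: 'k::field laurent \<Rightarrow> ('k, 'm::finite, 'n::finite) kGL \<Rightarrow> _"
  by unfold_locales (simp_all add: qscale_mult_left qscale_mult_right)

interpretation GL2: gl_algebra "t2scale :: 'k::field laurent \<Rightarrow> ('k, 'm::finite, 'n::finite) kGL2 \<Rightarrow> _"
  by unfold_locales (simp_all add: t2scale_mult_left t2scale_mult_right)

interpretation ground: gl_algebra "(*) :: 'k::field laurent \<Rightarrow> 'k laurent \<Rightarrow> _"
  by unfold_locales (simp_all add: algebra_simps)

lemma gl_rel_abs: "s \<in> gl_rel \<Longrightarrow> abs_kGL s = 0"
  unfolding zero_kGL.abs_eq abs_kGL_eq using two_sided_ideal.gen[of s gl_rel 1 1] by simp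

lemma abs_kGL_diff_eq_0: "abs_kGL (x - y) = 0 \<Longrightarrow> abs_kGL x = abs_kGL y"
  unfolding minus_kGL.abs_eq[symmetric] by simp

lemma gl_matrix_gmat: "GL.gl_matrix (gmat :: ('m::finite, 'n::finite) idx \<Rightarrow> _ \<Rightarrow> ('k::field, 'm, 'n) kGL)"
  unfolding GL.gl_matrix_def gmat_def times_kGL.abs_eq qscale_abs plus_kGL.abs_eq
  by (intro conjI allI impI abs_kGL_diff_eq_0; (unfold diff_diff_eq[symmetric])?)
    (intro gl_rel_abs gl_rel.intros; assumption)+

lemma gmat_relations:
  fixes i j k l :: "('m::finite, 'n::finite) idx"
  defines "g \<equiv> gmat :: _ \<Rightarrow> _ \<Rightarrow> ('k::field, 'm, 'n) kGL"
  shows gmat_odd_square: "apar i j = 1 \<Longrightarrow> g i j * g i j = 0"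
    and gmat_row: "num j < num l \<Longrightarrow>
      g i j * g i l = qscale ((- 1) ^ (apar i j * apar i l) * qpow ((- 1) ^ (ipar i + 1))) (g i l * g i j)"
    and gmat_col: "num i < num k \<Longrightarrow>
      g i j * g k j = qscale ((- 1) ^ (apar i j * apar k j) * qpow ((- 1) ^ (ipar j + 1))) (g k j * g i j)"
    and gmat_anti: "num i < num k \<and> num j > num l \<or> num i > num k \<and> num j < num l \<Longrightarrow>
      g i j * g k l = qscale ((- 1) ^ (apar i j * apar k l)) (g k l * g i j)"
    and gmat_diag: "num i < num k \<Longrightarrow> num j < num l \<Longrightarrow>
      g i j * g k l = qscale ((- 1) ^ (apar i j * apar k l)) (g k l * g i j) +
        qscale ((- 1) ^ (ipar j * ipar k + ipar j * ipar l + ipar k * ipar l) * (qinv - qv)) (g i l * g k j)"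
  using gl_matrix_gmat[where ?'k = 'k and ?'m = 'm and ?'n = 'n] unfolding g_def GL.gl_matrix_def by blast+

lemma rtt_gmat:
  "GL.rmat (\<lambda>i k. GL.tt gmat i k r s) v w
    = (GL.rmat (\<lambda>j l. GL.tt gmat v w j l) r s :: ('k::field, 'm::finite, 'n::finite) kGL)"
  using GL.gl_matrix_imp_rtt[OF gl_matrix_gmat[where ?'k = 'k and ?'m = 'm and ?'n = 'n]]
  unfolding GL.rtt_def by blast

lemma gmat_qgrade: "gmat i j \<in> qgrade (apar i j)"
  unfolding qgrade_def gmat_def by (simp add: qpart_abs fpart_fhom[OF fhom_fmat] apar_def)

lemma apar_less: "apar i j < 2"
  by (simp add: apar_def)

lemma tens2_gmat_mult:
  "(a \<otimes> gmat i j) * (gmat k l \<otimes> b) = t2scale ((- 1) ^ (apar i j * apar k l)) ((a * gmat k l) \<otimes> (gmat i j * b))"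
  by (rule tens2_times_homogeneous) (simp_all add: apar_less gmat_qgrade)

definition comat :: "('m::finite, 'n::finite) idx \<Rightarrow> ('m, 'n) idx \<Rightarrow> ('k::field, 'm, 'n) kGL2"
  where "comat i j = (\<Sum>k\<in>UNIV. gmat i k \<otimes> gmat k j)"

lemma comat_mult: "comat i j * comat k l = (\<Sum>u\<in>UNIV. \<Sum>v\<in>UNIV.
    t2scale ((- 1) ^ (apar u j * apar k v)) ((gmat i u * gmat k v) \<otimes> (gmat u j * gmat v l)))"
  by (simp add: comat_def sum_distrib_left sum_distrib_right tens2_gmat_mult) (rule sum.swap)

text \<open>The Koszul sign for moving \<open>gmat u j\<close> past \<open>gmat k v\<close> is
  exactly the discrepancy between the sign of the composite and the product of the signs of the two
  factors.\<close>

lemma tt_comat: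
  fixes i k j l :: "('m::finite, 'n::finite) idx"
  shows "(GL2.tt comat i k j l :: ('k::field, 'm, 'n) kGL2) = (\<Sum>u\<in>UNIV. \<Sum>v\<in>UNIV. GL.tt gmat i k u v \<otimes> GL.tt gmat u v j l)"
proof -
  have "(- 1 :: 'k laurent) ^ ((ipar i + ipar j) * ipar k) * (- 1) ^ (apar u j * apar k v)
      = (- 1) ^ ((ipar u + ipar j) * ipar v) * (- 1) ^ ((ipar i + ipar u) * ipar k)" for u v :: "('m, 'n) idx"
    using ipar_cases[of i] ipar_cases[of j] ipar_cases[of k] ipar_cases[of u] ipar_cases[of v]
    by (elim disjE) (simp_all add: apar_def)
  then show ?thesis
    by (simp add: GL2.tt_def GL.tt_def comat_mult kGL2.scale_sum_right tens2_scale_left tens2_scale_right)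
qed

text \<open>Associativity (A R) B = A (R B) for the sum over the intermediate pair (u, v); it holds
  in this form because R is symmetric.\<close>

lemma sum_rmat_tens:
  "(\<Sum>u\<in>UNIV. \<Sum>v\<in>UNIV. GL.rmat f u v \<otimes> g u v) = (\<Sum>u\<in>UNIV. \<Sum>v\<in>UNIV. f u v \<otimes> GL.rmat g u v)"
proof -
  have "(\<Sum>u\<in>UNIV. \<Sum>v\<in>UNIV. t2scale (rflip u v) (f v u \<otimes> g u v))
      = (\<Sum>u\<in>UNIV. \<Sum>v\<in>UNIV. t2scale (rflip u v) (f u v \<otimes> g v u))"
    by (subst sum.swap) (simp add: rflip_commute)
  then show ?thesis
    by (simp add: GL.rmat_def tens2_add_left tens2_add_right tens2_scale_left tens2_scale_right sum.distrib)
qed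

text \<open>With T and T' the signed matrices of the two tensor legs, R (T T') = (T R) T' = T (R T')
  = (T T') R.\<close>

lemma rtt_comat: "GL2.rtt (comat :: ('m::finite, 'n::finite) idx \<Rightarrow> _ \<Rightarrow> ('k::field, 'm, 'n) kGL2)"
  unfolding GL2.rtt_def
proof (intro allI)
  fix i k j l :: "('m, 'n) idx"
  have "(GL2.rmat (\<lambda>i k. GL2.tt comat i k j l) i k :: ('k, 'm, 'n) kGL2)
      = (\<Sum>u\<in>UNIV. \<Sum>v\<in>UNIV. GL.rmat (\<lambda>i k. GL.tt gmat i k u v) i k \<otimes> GL.tt gmat u v j l)"
    by (simp add: GL2.rmat_def GL.rmat_def tt_comat tens2_add_left tens2_scale_left sum.distrib kGL2.scale_sum_right)
  also have "\<dots> = (\<Sum>u\<in>UNIV. \<Sum>v\<in>UNIV. GL.rmat (GL.tt gmat i k) u v \<otimes> GL.tt gmat u v j l)"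
    by (simp only: rtt_gmat)
  also have "\<dots> = (\<Sum>u\<in>UNIV. \<Sum>v\<in>UNIV. GL.tt gmat i k u v \<otimes> GL.rmat (\<lambda>u v. GL.tt gmat u v j l) u v)"
    by (rule sum_rmat_tens)
  also have "\<dots> = (\<Sum>u\<in>UNIV. \<Sum>v\<in>UNIV. GL.tt gmat i k u v \<otimes> GL.rmat (GL.tt gmat u v) j l)"
    by (simp only: rtt_gmat)
  also have "\<dots> = GL2.rmat (GL2.tt comat i k) j l"
    by (simp add: GL2.rmat_def GL.rmat_def tt_comat tens2_add_right tens2_scale_right sum.distrib kGL2.scale_sum_right)
  finally show "GL2.rmat (\<lambda>i k. GL2.tt comat i k j l) i k
    = (GL2.rmat (\<lambda>j l. GL2.tt comat i k j l) j l :: ('k, 'm, 'n) kGL2)" .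
qed

text \<open>Cancels the terms in pairs. Showing that the sum equals its own negative would not be
  enough in characteristic 2. The double sum is transported along \<open>num\<close> to a linearly
  ordered index set.\<close>

lemma sum_pairs_eq_0:
  fixes f :: "('m::finite, 'n::finite) idx \<Rightarrow> ('m, 'n) idx \<Rightarrow> 'a::comm_monoid_add"
  assumes "\<And>u. f u u = 0" "\<And>u v. num u < num v \<Longrightarrow> f u v + f v u = 0"
  shows "(\<Sum>u\<in>UNIV. \<Sum>v\<in>UNIV. f u v) = 0"
proof -
  let ?A = "range (num :: ('m, 'n) idx \<Rightarrow> nat)"
  have reindex: "sum g B = (\<Sum>u\<in>num ` B. g (ix u))" for g and B :: "('m, 'n) idx set"
    using sum.reindex[of num B "\<lambda>u. g (ix u)"] by (simp add: inj_on_def num_inject num_inverse comp_def)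
  have "(\<Sum>u\<in>UNIV. \<Sum>v\<in>UNIV. f u v) = (\<Sum>u\<in>UNIV. \<Sum>v\<in>UNIV - {u}. f u v)"
  proof (rule sum.cong[OF refl])
    show "(\<Sum>v\<in>UNIV. f u v) = (\<Sum>v\<in>UNIV - {u}. f u v)" for u
      using sum.remove[of UNIV u "f u"] by (simp add: assms(1))
  qed
  also have "\<dots> = (\<Sum>u\<in>?A. \<Sum>v\<in>?A - {u}. f (ix u) (ix v))"
  proof -
    have "inj (num :: ('m, 'n) idx \<Rightarrow> nat)" by (simp add: inj_on_def num_inject)
    from image_set_diff[OF this, of UNIV "{_}"]
    have "num ` (UNIV - {ix u :: ('m, 'n) idx}) = ?A - {u}" if "u \<in> ?A" for u
      using that by (elim imageE) (simp add: num_inverse)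
    then show ?thesis unfolding reindex by (intro sum.cong) auto
  qed
  also have "\<dots> = 0"
    by (subst sum_off_diagonal) (auto intro!: sum.neutral simp: num_inverse assms(2))
  finally show ?thesis .
qed

text \<open>As i and j have opposite parities, for each u one of the entries (i, u) and (u, j) is
  odd, so the terms with u = v vanish. Exchanging u and v costs mutually inverse powers of q in row
  i and in column j; what remains is the sign -1, so the two terms cancel.\<close>

lemma comat_odd_square:
  fixes i j :: "('m::finite, 'n::finite) idx"
  assumes "apar i j = 1"
  shows "comat i j * comat i j = (0 :: ('k::field, 'm, 'n) kGL2)"
  unfolding comat_mult
proof (rule sum_pairs_eq_0)
  have ij: "ipar i = 0 \<and> ipar j = 1 \<or> ipar i = 1 \<and> ipar j = 0"
    using assms ipar_cases[of i] ipar_cases[of j] unfolding apar_def by (elim disjE) simp_all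
  fix u :: "('m, 'n) idx"
  show "t2scale ((- 1) ^ (apar u j * apar i u)) ((gmat i u * gmat i u) \<otimes> (gmat u j * gmat u j)) = 0"
  proof (cases "apar i u = 1")
    case True
    then show ?thesis by (simp add: gmat_odd_square)
  next
    case False
    then have "apar u j = 1"
      using ij ipar_cases[of u] by (elim disjE conjE) (simp_all add: apar_def)
    then show ?thesis by (simp add: gmat_odd_square)
  qed
  fix v :: "('m, 'n) idx" assume uv: "num u < num v"
  have row: "gmat i u * gmat i v
      = qscale ((- 1) ^ (apar i u * apar i v) * qpow ((- 1) ^ (ipar i + 1))) (gmat i v * gmat i u)"
    using uv by (rule gmat_row)
  have col: "gmat u j * gmat v j
      = qscale ((- 1) ^ (apar u j * apar v j) * qpow ((- 1) ^ (ipar j + 1))) (gmat v j * gmat u j)"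
    using uv by (rule gmat_col)
  have Q: "qpow ((- 1) ^ (ipar i + 1)) * qpow ((- 1) ^ (ipar j + 1)) = (1 :: 'k laurent)"
    using ij by (elim disjE conjE) (simp_all add: qpow_mult qpow_0)
  have "(- 1) ^ (apar u j * apar i v) * ((- 1) ^ (apar i u * apar i v) * (- 1) ^ (apar u j * apar v j))
      + (- 1) ^ (apar v j * apar i u) = (0 :: 'k laurent)"
    using ij ipar_cases[of u] ipar_cases[of v]
    by (elim disjE conjE) (simp_all add: apar_def)
  then have "(- 1) ^ (apar u j * apar i v) * ((- 1) ^ (apar i u * apar i v) * (- 1) ^ (apar u j * apar v j))
      * (qpow ((- 1) ^ (ipar i + 1)) * qpow ((- 1) ^ (ipar j + 1)))
      + (- 1) ^ (apar v j * apar i u) = (0 :: 'k laurent)"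
    by (simp only: Q mult_1_right)
  then show "t2scale ((- 1) ^ (apar u j * apar i v)) ((gmat i u * gmat i v) \<otimes> (gmat u j * gmat v j)) +
    t2scale ((- 1) ^ (apar v j * apar i u)) ((gmat i v * gmat i u) \<otimes> (gmat v j * gmat u j)) = (0 :: ('k, 'm, 'n) kGL2)"
    unfolding row col
    by (simp only: tens2_scale_left tens2_scale_right kGL2.scale_scale kGL2.scale_left_distrib[symmetric]
        mult_ac kGL2.scale_zero_left)
qed

lemma gl_matrix_comat: "GL2.gl_matrix comat"
  by (rule GL2.rtt_imp_gl_matrix[OF rtt_comat comat_odd_square])

lemma gl_matrix_counit:
  "ground.gl_matrix (\<lambda>i j :: ('m::finite, 'n::finite) idx. if i = j then 1 else (0 :: 'k::field laurent))"
proof -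
  define d :: "('m, 'n) idx \<Rightarrow> ('m, 'n) idx \<Rightarrow> 'k laurent" where "d i j = (if i = j then 1 else 0)" for i j
  have 1: "apar i j = 1 \<Longrightarrow> d i j = 0" for i j by (auto simp: d_def apar_def)
  have 2: "d i j * d k l = 0" if "i \<noteq> j \<or> k \<noteq> l" for i j k l using that by (auto simp: d_def)
  have 3: "d i j * d k l = (- 1) ^ (apar i j * apar k l) * (d k l * d i j)" for i j k l
    by (cases "i = j") (simp_all add: d_def apar_def)
  have "ground.gl_matrix d"
    unfolding ground.gl_matrix_def
  proof (intro conjI allI impI)
    fix i j k l :: "('m, 'n) idx"
    show "d i j * d i l = (- 1) ^ (apar i j * apar i l) * qpow ((- 1) ^ (ipar i + 1)) * (d i l * d i j)" if "num j < num l"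
    proof -
      have "i \<noteq> j \<or> i \<noteq> l" using that by auto
      then have "d i j * d i l = 0" "d i l * d i j = 0" using 2 by blast+
      then show ?thesis by (simp only: mult_zero_right)
    qed
    show "d i j * d k j = (- 1) ^ (apar i j * apar k j) * qpow ((- 1) ^ (ipar j + 1)) * (d k j * d i j)" if "num i < num k"
    proof -
      have "i \<noteq> j \<or> k \<noteq> j" using that by auto
      then have "d i j * d k j = 0" "d k j * d i j = 0" using 2 by blast+
      then show ?thesis by (simp only: mult_zero_right)
    qed
    show "d i j * d k l = (- 1) ^ (apar i j * apar k l) * (d k l * d i j) +
        (- 1) ^ (ipar j * ipar k + ipar j * ipar l + ipar k * ipar l) * (qinv - qv) * (d i l * d k j)"
      if "num i < num k" "num j < num l"
    proof -
      \<comment> \<open>Otherwise the numbers would satisfy i < k = j < l = i.\<close>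
      have "i \<noteq> l \<or> k \<noteq> j" using that by auto
      then have "d i l * d k j = 0" by (rule 2)
      then show ?thesis by (simp only: mult_zero_right add_0_right) (rule 3)
    qed
  qed (rule 3 | simp add: 1)+
  moreover have "d = (\<lambda>i j. if i = j then 1 else 0)" by (intro ext) (simp add: d_def)
  ultimately show ?thesis by simp
qed


section \<open>Expanding quantum determinants over permutations\<close>

lemma perm_length_eq_inversions: "perm_length N \<sigma> = inversions (map \<sigma> [1..<Suc N])"
  if "\<sigma> permutes {1..N}"
proof -
  have "inversions (map \<sigma> [a..<Suc N]) = card {(i, j). a \<le> i \<and> i < j \<and> j \<le> N \<and> \<sigma> i > \<sigma> j}" for a
  proof (induction "Suc N - a" arbitrary: a)
    case 0
    then have "[a..<Suc N] = []" "{(i, j). a \<le> i \<and> i < j \<and> j \<le> N \<and> \<sigma> i > \<sigma> j} = {}" by auto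
    then show ?case by (simp only: list.map inversions.simps card.empty)
  next
    case (Suc d)
    then have a: "a < Suc N" by simp
    have fin: "finite {(i, j). Suc a \<le> i \<and> i < j \<and> j \<le> N \<and> \<sigma> i > \<sigma> j}"
      by (rule finite_subset[of _ "{..N} \<times> {..N}"]) auto
    have inj: "inj_on \<sigma> A" for A using that by (meson permutes_inj_on)
    have "{(i, j). a \<le> i \<and> i < j \<and> j \<le> N \<and> \<sigma> i > \<sigma> j}
      = Pair a ` {j. a < j \<and> j \<le> N \<and> \<sigma> a > \<sigma> j} \<union> {(i, j). Suc a \<le> i \<and> i < j \<and> j \<le> N \<and> \<sigma> i > \<sigma> j}"
      by (auto simp: image_iff Suc_le_eq le_less)
    then have "card {(i, j). a \<le> i \<and> i < j \<and> j \<le> N \<and> \<sigma> i > \<sigma> j}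
      = card (Pair a ` {j. a < j \<and> j \<le> N \<and> \<sigma> a > \<sigma> j} \<union> {(i, j). Suc a \<le> i \<and> i < j \<and> j \<le> N \<and> \<sigma> i > \<sigma> j})"
      by simp
    also have "\<dots> = card {j. a < j \<and> j \<le> N \<and> \<sigma> a > \<sigma> j} + card {(i, j). Suc a \<le> i \<and> i < j \<and> j \<le> N \<and> \<sigma> i > \<sigma> j}"
      using fin by (subst card_Un_disjoint) (auto simp: card_image inj_on_def)
    also have "card {j. a < j \<and> j \<le> N \<and> \<sigma> a > \<sigma> j} = count_below (\<sigma> ` {Suc a..N}) (\<sigma> a)"
    proof -
      have "{j' \<in> \<sigma> ` {Suc a..N}. j' < \<sigma> a} = \<sigma> ` {j. a < j \<and> j \<le> N \<and> \<sigma> a > \<sigma> j}" by auto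
      then show ?thesis by (simp add: card_image[OF inj])
    qed
    also have "card {(i, j). Suc a \<le> i \<and> i < j \<and> j \<le> N \<and> \<sigma> i > \<sigma> j} = inversions (map \<sigma> [Suc a..<Suc N])"
      using Suc by (intro Suc.hyps(1)[symmetric]) simp
    finally show ?case
      using a by (simp add: upt_conv_Cons[of a] atLeastLessThanSuc_atLeastAtMost del: upt_Suc)
  qed
  from this[of 1] show ?thesis by (simp add: perm_length_def)
qed

lemma bij_betw_permutes_lists:
  "bij_betw (\<lambda>\<sigma>. map \<sigma> [1..<Suc N]) {\<sigma>. \<sigma> permutes {1..N}} (permutations_of_set {1..N})"
\<comment> \<open>List positions start at 0 and the permuted interval at 1, hence the shift; outside
  the interval a permutation is the identity, which fixes the default value.\<close>
proof (rule bij_betw_byWitness[where f' = "\<lambda>js i. if i \<in> {1..N} then js ! (i - 1) else i"])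
  show "\<forall>\<sigma>\<in>{\<sigma>. \<sigma> permutes {1..N}}. (\<lambda>i. if i \<in> {1..N} then map \<sigma> [1..<Suc N] ! (i - 1) else i) = \<sigma>"
    by (auto simp: permutes_def fun_eq_iff simp del: upt_Suc)
  have len: "length js = N" if "js \<in> permutations_of_set {1..N}" for js
    using length_finite_permutations_of_set[OF that] by simp
  show "\<forall>js\<in>permutations_of_set {1..N}. map (\<lambda>i. if i \<in> {1..N} then js ! (i - 1) else i) [1..<Suc N] = js"
    by (auto intro!: nth_equalityI simp: len simp del: upt_Suc)
  show "(\<lambda>\<sigma>. map \<sigma> [1..<Suc N]) ` {\<sigma>. \<sigma> permutes {1..N}} \<subseteq> permutations_of_set {1..N}"
  proof (intro image_subsetI permutations_of_setI)
    fix \<sigma> assume "\<sigma> \<in> {\<sigma>. \<sigma> permutes {1..N}}"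
    then have \<sigma>: "\<sigma> permutes {1..N}" by simp
    show "set (map \<sigma> [1..<Suc N]) = {1..N}"
      using permutes_image[OF \<sigma>] by (simp add: atLeastLessThanSuc_atLeastAtMost del: upt_Suc)
    show "distinct (map \<sigma> [1..<Suc N])"
      using permutes_inj_on[OF \<sigma>] by (simp add: distinct_map del: upt_Suc)
  qed
  show "(\<lambda>js i. if i \<in> {1..N} then js ! (i - 1) else i) ` permutations_of_set {1..N} \<subseteq> {\<sigma>. \<sigma> permutes {1..N}}"
  proof (intro image_subsetI CollectI)
    fix js assume js: "js \<in> permutations_of_set {1..N}"
    have "bij_betw (\<lambda>i. js ! (i - 1)) {1..N} {1..N}"
    proof -
      have "bij_betw (\<lambda>i. i - 1) {1..N} {..<N}"
        by (rule bij_betw_byWitness[where f' = Suc]) auto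
      moreover have "bij_betw ((!) js) {..<N} {1..N}"
        using bij_betw_nth[OF permutations_of_setD(2)[OF js]] permutations_of_setD(1)[OF js] len[OF js] by simp
      ultimately show ?thesis using bij_betw_trans by (fastforce simp: comp_def)
    qed
    then have "bij_betw (\<lambda>i. if i \<in> {1..N} then js ! (i - 1) else i) {1..N} {1..N}"
      by (subst bij_betw_cong[where g = "\<lambda>i. js ! (i - 1)"]) auto
    then show "(\<lambda>i. if i \<in> {1..N} then js ! (i - 1) else i) permutes {1..N}"
      by (rule bij_imp_permutes) auto
  qed
qed

context scalar_algebra
begin

lemma qminor_permutes:
  "qminor u x [1..<Suc N] {1..N} = (\<Sum>\<sigma> | \<sigma> permutes {1..N}.
     scale (u ^ perm_length N \<sigma>) (\<Prod>j\<leftarrow>[1..<Suc N]. x j (\<sigma> j)))"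
proof -
  have "qminor u x [1..<Suc N] {1..N} = (\<Sum>js\<in>permutations_of_set {1..N}.
      scale (u ^ inversions js) (\<Prod>(i, j)\<leftarrow>zip [1..<Suc N] js. x i j))"
    by (rule qminor_permutations) simp_all
  also have "\<dots> = (\<Sum>\<sigma> | \<sigma> permutes {1..N}. scale (u ^ inversions (map \<sigma> [1..<Suc N]))
      (\<Prod>(i, j)\<leftarrow>zip [1..<Suc N] (map \<sigma> [1..<Suc N]). x i j))"
    by (rule sum.reindex_bij_betw[OF bij_betw_permutes_lists, symmetric])
  also have "\<dots> = (\<Sum>\<sigma> | \<sigma> permutes {1..N}.
     scale (u ^ perm_length N \<sigma>) (\<Prod>j\<leftarrow>[1..<Suc N]. x j (\<sigma> j)))"
    by (intro sum.cong refl)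
      (simp add: perm_length_eq_inversions zip_map2 zip_same_conv_map comp_def del: upt_Suc)
  finally show ?thesis .
qed

lemma qminor_map_rows: "qminor u x (map \<kappa> is) S = qminor u (\<lambda>i. x (\<kappa> i)) is S"
  by (induction "is" arbitrary: S) (simp_all add: qminor.simps)

end

text \<open>The factors need not commute, so the product runs over a list whose order is kept. The
  choice functions are extensional, which makes each choice occur exactly once.\<close>

lemma prod_list_sum_distrib:
  fixes f :: "'j \<Rightarrow> 'c \<Rightarrow> 'a::{ring,monoid_mult}"
  assumes "distinct js"
  shows "(\<Prod>j\<leftarrow>js. \<Sum>k\<in>A. f j k) = (\<Sum>\<kappa>\<in>set js \<rightarrow>\<^sub>E A. \<Prod>j\<leftarrow>js. f j (\<kappa> j))"
  using assms
proof (induction js)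
  case (Cons j js)
  then have j: "j \<notin> set js" by simp
  have inj: "inj_on (\<lambda>(y, g). g(j := y)) (A \<times> (set js \<rightarrow>\<^sub>E A))"
    using inj_combinator[OF j, of "\<lambda>_. A"] by simp
  have "(\<Sum>\<kappa>\<in>set (j # js) \<rightarrow>\<^sub>E A. \<Prod>j\<leftarrow>j # js. f j (\<kappa> j))
      = (\<Sum>(y, g)\<in>A \<times> (set js \<rightarrow>\<^sub>E A). \<Prod>j'\<leftarrow>j # js. f j' ((g(j := y)) j'))"
    by (simp only: list.set PiE_insert_eq sum.reindex[OF inj]) (simp only: comp_def case_prod_unfold)
  also have "\<dots> = (\<Sum>(y, g)\<in>A \<times> (set js \<rightarrow>\<^sub>E A). f j y * (\<Prod>j'\<leftarrow>js. f j' (g j')))"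
  proof -
    have eq: "map (\<lambda>j'. f j' ((g(j := y)) j')) js = map (\<lambda>j'. f j' (g j')) js" for g y
      using j by (intro map_cong) auto
    show ?thesis by (simp only: case_prod_unfold list.map prod_list.Cons fun_upd_same eq)
  qed
  also have "\<dots> = (\<Sum>k\<in>A. f j k) * (\<Sum>\<kappa>\<in>set js \<rightarrow>\<^sub>E A. \<Prod>j\<leftarrow>js. f j (\<kappa> j))"
    by (simp add: sum_product sum.cartesian_product)
  finally show ?case using Cons by simp
qed simp

section \<open>Nilpotency of straightening algebras\<close>

text \<open>Moving the smallest letter to the left only creates larger letters, and a square-zero letter survives at
  most once.\<close>

lemma (in scalar_algebra) straightening_nilpotent:
  fixes z :: "'c \<Rightarrow> 'a" and key :: "'c \<Rightarrow> nat"
  assumes "finite V" "inj_on key V"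
    and sq: "\<And>c. c \<in> V \<Longrightarrow> z c * z c = 0"
    and straighten: "\<And>c d. c \<in> V \<Longrightarrow> d \<in> V \<Longrightarrow> key d < key c \<Longrightarrow>
      \<exists>\<alpha> \<beta> e f. z c * z d = scale \<alpha> (z d * z c) + scale \<beta> (z e * z f) \<and> e \<in> V \<and> f \<in> V \<and> key d < key e \<and> key d < key f"
    and "set cs \<subseteq> V" "card V < length cs"
  shows "(\<Prod>c\<leftarrow>cs. z c) = 0"
  using assms
proof (induction "card V" arbitrary: V cs)
  case 0
  then show ?case by auto
next
  case (Suc n)
  then have "V \<noteq> {}" by auto
  obtain d where d: "d \<in> V" "\<And>c. c \<in> V \<Longrightarrow> key d \<le> key c"
    using Suc.prems(1) \<open>V \<noteq> {}\<close> by (metis arg_min_if_finite(1) arg_min_least)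
  define V' where "V' = V - {d}"
  have less: "key d < key c" if "c \<in> V'" for c
    using that d Suc.prems(2) unfolding V'_def by (metis Diff_iff inj_onD insertI1 le_neq_implies_less)
  have above: "c \<in> V'" if "c \<in> V" "key d < key c" for c using that unfolding V'_def by auto
  \<comment> \<open>The normal forms of length p: the smallest letter d occurs at most once, and
    then in front.\<close>
  define gens where "gens p = {(\<Prod>c\<leftarrow>vs. z c) | vs. set vs \<subseteq> V' \<and> length vs = p}
      \<union> {z d * (\<Prod>c\<leftarrow>vs. z c) | vs. set vs \<subseteq> V' \<and> Suc (length vs) = p}" for p
  have gen1: "(\<Prod>c\<leftarrow>vs. z c) \<in> gens p" if "set vs \<subseteq> V'" "length vs = p" for vs p
    using that unfolding gens_def by blast
  have gen2: "z d * (\<Prod>c\<leftarrow>vs. z c) \<in> gens p" if "set vs \<subseteq> V'" "Suc (length vs) = p" for vs p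
    using that unfolding gens_def by blast
  \<comment> \<open>Left multiplication by a letter stays within the span of normal forms: a second
    d gives 0, and any other letter meeting a leading d either passes behind it or turns into two
    letters above d.\<close>
  have step: "z c * y \<in> span (gens (Suc p))" if "c \<in> V" "y \<in> span (gens p)" for c y p
    using that(2)
  proof (induction rule: span_induct_alt)
    case base
    show ?case by (simp add: span_zero)
  next
    case (step r g y)
    have "z c * g \<in> span (gens (Suc p))"
    proof (cases "c = d")
      case True
      from \<open>g \<in> gens p\<close> consider vs where "g = (\<Prod>c\<leftarrow>vs. z c)" "set vs \<subseteq> V'" "length vs = p"
        | vs where "g = z d * (\<Prod>c\<leftarrow>vs. z c)" "set vs \<subseteq> V'" "Suc (length vs) = p"
        unfolding gens_def by blast
      then show ?thesis
      proof cases
        case 1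
        then show ?thesis using True by (auto intro: span_base gen2)
      next
        case 2
        then show ?thesis using True d(1) Suc.prems(3) by (simp add: span_zero flip: mult.assoc)
      qed
    next
      case False
      then have c: "c \<in> V'" using \<open>c \<in> V\<close> by (simp add: V'_def)
      from \<open>g \<in> gens p\<close> consider vs where "g = (\<Prod>c\<leftarrow>vs. z c)" "set vs \<subseteq> V'" "length vs = p"
        | vs where "g = z d * (\<Prod>c\<leftarrow>vs. z c)" "set vs \<subseteq> V'" "Suc (length vs) = p"
        unfolding gens_def by blast
      then show ?thesis
      proof cases
        case 1
        then show ?thesis using c gen1[of "c # vs"] by (auto intro: span_base)
      next
        case 2
        obtain \<alpha> \<beta> e f where ef: "z c * z d = scale \<alpha> (z d * z c) + scale \<beta> (z e * z f)"
          "e \<in> V'" "f \<in> V'"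
          using Suc.prems(4)[OF \<open>c \<in> V\<close> d(1) less[OF c]] above by blast
        have "z c * g = scale \<alpha> (z d * (\<Prod>c\<leftarrow>c # vs. z c)) + scale \<beta> (\<Prod>c\<leftarrow>e # f # vs. z c)"
          unfolding 2(1) mult.assoc[symmetric] ef(1) by (simp add: distrib_right mult.assoc)
        moreover have "z d * (\<Prod>c\<leftarrow>c # vs. z c) \<in> gens (Suc p)" "(\<Prod>c\<leftarrow>e # f # vs. z c) \<in> gens (Suc p)"
          using 2 c ef by (auto intro!: gen2[of "c # vs", simplified] gen1[of "e # f # vs", simplified])
        ultimately show ?thesis by (simp only:) (intro span_add span_scale span_base)
      qed
    qed
    then show ?case using step by (simp add: distrib_left span_add span_scale)
  qed
  have word: "(\<Prod>c\<leftarrow>cs. z c) \<in> span (gens (length cs))" if "set cs \<subseteq> V" for cs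
    using that
  proof (induction cs)
    case Nil
    show ?case using gen1[of "[]" 0] by (auto intro: span_base)
  next
    case (Cons c cs)
    then show ?case using step[of c] by simp
  qed
  have card: "card V' = n" using Suc.hyps(2) d(1) Suc.prems(1) unfolding V'_def by simp
  \<comment> \<open>A normal form of length above \<open>card V\<close> contains more than
    \<open>card V'\<close> letters from \<open>V'\<close>, even after a leading d is dropped, so the
    induction hypothesis for \<open>V'\<close> applies.\<close>
  have vanish: "(\<Prod>c\<leftarrow>vs. z c) = 0" if "set vs \<subseteq> V'" "n < length vs" for vs
  proof (rule Suc.hyps(1)[of V'])
    show "\<exists>\<alpha> \<beta> e' f. z c * z e = scale \<alpha> (z e * z c) + scale \<beta> (z e' * z f) \<and> e' \<in> V' \<and> f \<in> V' \<and> key e < key e' \<and> key e < key f"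
      if "c \<in> V'" "e \<in> V'" "key e < key c" for c e
    proof -
      have "c \<in> V" "e \<in> V" using that by (auto simp: V'_def)
      note less_ec = that(3)
      then obtain \<alpha> \<beta> e' f where *: "z c * z e = scale \<alpha> (z e * z c) + scale \<beta> (z e' * z f)" "e' \<in> V" "f \<in> V"
        "key e < key e'" "key e < key f"
        using Suc.prems(4)[OF \<open>c \<in> V\<close> \<open>e \<in> V\<close> less_ec] by blast
      moreover have "e' \<in> V'" "f \<in> V'" using * less[OF \<open>e \<in> V'\<close>] by (auto intro: above)
      ultimately show ?thesis by blast
    qed
  qed (use that card Suc.prems(1,2,3) in \<open>auto simp: V'_def intro: inj_on_subset\<close>)
  have "g = 0" if "g \<in> gens (length cs)" for g
    using that Suc.hyps(2) Suc.prems(6) vanish unfolding gens_def by force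
  then have "gens (length cs) \<subseteq> {0}" by auto
  from span_minimal[OF this subspace_single_0] word[OF Suc.prems(5)] show ?case by blast
qed


section \<open>Diagonal blocks\<close>

lemma abs_kGL_sum: "abs_kGL (\<Sum>a\<in>A. f a) = (\<Sum>a\<in>A. abs_kGL (f a))"
  by (induction A rule: infinite_finite_induct) (simp_all add: zero_kGL.abs_eq plus_kGL.abs_eq[symmetric])

lemma abs_kGL_prod_list: "abs_kGL (\<Prod>a\<leftarrow>xs. f a) = (\<Prod>a\<leftarrow>xs. abs_kGL (f a))"
  by (induction xs) (simp_all add: one_kGL.abs_eq times_kGL.abs_eq[symmetric])

lemma tens2_mult_even:
  assumes "b \<in> qgrade 0 \<or> c \<in> qgrade 0"
  shows "(a \<otimes> b) * (c \<otimes> d) = (a * c) \<otimes> (b * d)"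
  using assms
proof
  assume b: "b \<in> qgrade 0"
  have "(a \<otimes> b) * (c \<otimes> d) = (a * (qpart 0 c + qpart 1 c)) \<otimes> (b * d)"
    by (simp add: tens2_times tens_prod_def qpart_qgrade[OF b] distrib_left tens2_add_left)
  then show ?thesis by (simp only: qpart_sum)
next
  assume c: "c \<in> qgrade 0"
  have "(a \<otimes> b) * (c \<otimes> d) = (a * c) \<otimes> ((qpart 0 b + qpart 1 b) * d)"
    by (simp add: tens2_times tens_prod_def qpart_qgrade[OF c] distrib_right tens2_add_right)
  then show ?thesis by (simp only: qpart_sum)
qed

lemma subspace_qgrade: "kGL.subspace (qgrade d)"
  by (auto simp: kGL.subspace_def qgrade_def qpart_add qpart_scale) (use qpart_scale[of d 0 0] in simp)

lemma unit_inv_eq: "x * y = 1 \<Longrightarrow> y * x = 1 \<Longrightarrow> unit_inv x = y"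
  unfolding unit_inv_def by (rule the_equality) (auto, metis mult.assoc mult_1_left mult_1_right)

text \<open>The even block (\<open>p = 0\<close>) consists of the first indices, the odd block (\<open>p = 1\<close>) of the last ones.\<close>

locale gl_block =
  fixes b :: "nat \<Rightarrow> ('m::finite, 'n::finite) idx" and N p :: nat and D D_inv :: "('k::field, 'm, 'n) kGL"
  assumes p: "p = 0 \<or> p = 1"
    and b_mono: "i \<in> {1..N} \<Longrightarrow> j \<in> {1..N} \<Longrightarrow> i < j \<Longrightarrow> num (b i) < num (b j)"
    and ipar_block: "i \<in> {1..N} \<Longrightarrow> ipar (b i) = p"
    and ipar_outside: "l \<notin> b ` {1..N} \<Longrightarrow> ipar l = 1 - p"
    and outside: "l \<notin> b ` {1..N} \<Longrightarrow> i \<in> {1..N} \<Longrightarrow> (if p = 0 then num (b i) < num l else num l < num (b i))"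
    and D_def: "D = (\<Sum>\<sigma> | \<sigma> permutes {1..N}. qscale ((- qpow ((- 1) ^ (p + 1))) ^ perm_length N \<sigma>)
        (\<Prod>j\<leftarrow>[1..<N + 1]. gmat (b j) (b (\<sigma> j))))"
    and D_inverse: "D * D_inv = 1" "D_inv * D = 1"
begin

abbreviation block :: "('m, 'n) idx set" where "block \<equiv> b ` {1..N}"

abbreviation t :: "'k laurent" where "t \<equiv> qpow ((- 1) ^ (p + 1))"

abbreviation t' :: "'k laurent" where "t' \<equiv> qpow ((- 1) ^ p)"

lemma b_inj: "inj_on b {1..N}"
  by (rule linorder_inj_onI) (use b_mono in force)+

abbreviation x :: "nat \<Rightarrow> nat \<Rightarrow> ('k, 'm, 'n) kGL" where "x i j \<equiv> gmat (b i) (b j)"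

lemma apar_block: "i \<in> {1..N} \<Longrightarrow> j \<in> {1..N} \<Longrightarrow> apar (b i) (b j) = 0"
  by (simp add: apar_def ipar_block mult_2[symmetric])

lemma apar_outside:
  assumes "i \<in> {1..N}" "l \<notin> block"
  shows "apar (b i) l = 1" "apar l (b i) = 1"
  using p assms by (auto simp: apar_def ipar_block ipar_outside)

sublocale mat: quantum_square qscale t t' x N
proof
  show "t * t' = 1" using p by (auto simp: qpow_mult qpow_0)
  fix i k j l
  show "x i j * x i l = qscale t (x i l * x i j)"
    if "i \<in> {1..N}" "j \<in> {1..N}" "l \<in> {1..N}" "j < l"
    using gmat_row[OF b_mono[OF that(2-4)], of "b i"] that by (simp add: apar_block ipar_block)
  show "x i j * x k j = qscale t (x k j * x i j)"
    if "i \<in> {1..N}" "k \<in> {1..N}" "j \<in> {1..N}" "i < k"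
    using gmat_col[OF b_mono[OF that(1,2,4)], of "b j"] that by (simp add: apar_block ipar_block)
  assume *: "i \<in> {1..N}" "k \<in> {1..N}" "j \<in> {1..N}" "l \<in> {1..N}" "i < k" "j < l"
  then have less: "num (b i) < num (b k)" "num (b j) < num (b l)" by (auto intro: b_mono)
  show "x i l * x k j = x k j * x i l"
    using gmat_anti[where i = "b i" and k = "b k" and j = "b l" and l = "b j"] less * by (simp add: apar_block)
  \<comment> \<open>In the odd block the correction term carries the sign -1, which turns 1/q - q
    into q - 1/q and so fits the inverted parameter.\<close>
  have "(- 1) ^ (p * p + p * p + p * p) * (qinv - qv) = t - t'"
    using p by auto
  then have c: "t - t' = (- 1) ^ (p * p + p * p + p * p) * (qinv - qv)" ..
  show "x i j * x k l = x k l * x i j + qscale (t - t') (x i l * x k j)"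
    unfolding c using gmat_diag[OF less, where ?'k = 'k] *
    by (simp only: apar_block ipar_block mult_zero_left power_0 kGL.scale_one)
qed

lemma D_eq: "D = mat.qdet"
  unfolding D_def mat.qdet_def GL.qminor_permutes by simp

lemma D_central: "i \<in> {1..N} \<Longrightarrow> j \<in> {1..N} \<Longrightarrow> D * x i j = x i j * D"
  unfolding D_eq by (rule mat.qdet_central)

lemma D_even: "D \<in> qgrade 0"
proof -
  have prod: "(\<Prod>j\<leftarrow>js. gmat (b j) (b (\<sigma> j))) \<in> qgrade 0" if "set js \<subseteq> {1..N}" "\<sigma> permutes {1..N}" for js \<sigma>
    using that(1)
  proof (induction js)
    case (Cons j js)
    then have "\<sigma> j \<in> {1..N}" using permutes_in_image[OF that(2), of j] by simp
    with Cons show ?case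
      using gmat_qgrade[of "b j" "b (\<sigma> j)"] by (auto intro!: qgrade_mult[where a = 0 and b = 0] simp: apar_block)
  qed (simp add: one_qgrade)
  show ?thesis
    unfolding D_def
    by (intro kGL.subspace_sum[OF subspace_qgrade] kGL.subspace_scale[OF subspace_qgrade] prod) auto
qed

text \<open>The product of \<open>D\<close> with the odd part of \<open>D_inv\<close> is the odd
  part of 1, hence 0, and \<open>D\<close> can be cancelled.\<close>

lemma D_inv_even: "D_inv \<in> qgrade 0"
proof -
  have D1: "D * qpart 1 D_inv \<in> qgrade 1" "D * qpart 0 D_inv \<in> qgrade 0"
    by (rule qgrade_mult[OF D_even qpart_in_qgrade], simp)+
  have "D * qpart 0 D_inv + D * qpart 1 D_inv = 1"
    by (simp only: distrib_left[symmetric] qpart_sum D_inverse)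
  then have "qpart 1 (D * qpart 0 D_inv + D * qpart 1 D_inv) = 0"
    by (simp add: qpart_qgrade[OF one_qgrade])
  then have "D * qpart 1 D_inv = 0"
    using qpart_qgrade[OF D1(1), of 1] qpart_qgrade[OF D1(2), of 1] by (simp add: qpart_add)
  then have "D_inv * D * qpart 1 D_inv = 0" by (simp add: mult.assoc)
  then have "qpart 1 D_inv = 0" by (simp add: D_inverse)
  then have "qpart 0 D_inv = D_inv" using qpart_sum[of D_inv] by simp
  then show ?thesis by (simp add: qgrade_def)
qed

text \<open>Supplies the hypotheses of \<open>minor_right_column\<close> for p = 0 and of
  \<open>minor_left_column\<close> for p = 1. Entries of the block are even, so exchanging them with
  an odd entry costs no sign.\<close>

lemma outer_column:
  assumes "l \<notin> block" "i \<in> {1..N}" "j \<in> {1..N}" "k \<in> {1..N}"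
  shows "p = 0 \<Longrightarrow> x i j * gmat (b i) l = qscale t (gmat (b i) l * x i j)"
    and "p = 0 \<Longrightarrow> i < k \<Longrightarrow> x i j * gmat (b k) l = gmat (b k) l * x i j + qscale (t - t') (gmat (b i) l * x k j)"
    and "p = 0 \<Longrightarrow> k < i \<Longrightarrow> x i j * gmat (b k) l = gmat (b k) l * x i j"
    and "p = 1 \<Longrightarrow> x i j * gmat (b i) l = qscale t' (gmat (b i) l * x i j)"
    and "p = 1 \<Longrightarrow> k < i \<Longrightarrow> x i j * gmat (b k) l = gmat (b k) l * x i j - qscale (t - t') (gmat (b i) l * x k j)"
    and "p = 1 \<Longrightarrow> i < k \<Longrightarrow> x i j * gmat (b k) l = gmat (b k) l * x i j"
proof -
  note par = apar_block apar_outside ipar_block ipar_outside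
  note side = outside[OF assms(1)]
  show "x i j * gmat (b i) l = qscale t (gmat (b i) l * x i j)" if "p = 0"
    using gmat_row[of "b j" l "b i", where ?'k = 'k] side[OF assms(3)] assms that by (simp add: par)
  show "x i j * gmat (b k) l = gmat (b k) l * x i j + qscale (t - t') (gmat (b i) l * x k j)" if "p = 0" "i < k"
    using gmat_diag[of "b i" "b k" "b j" l, where ?'k = 'k] side[OF assms(3)] b_mono[of i k] assms that by (simp add: par)
  show "x i j * gmat (b k) l = gmat (b k) l * x i j" if "p = 0" "k < i"
    using gmat_anti[where i = "b i" and k = "b k" and j = "b j" and l = l and ?'k = 'k] side[OF assms(3)] b_mono[of k i] assms that by (simp add: par)
  show "x i j * gmat (b i) l = qscale t' (gmat (b i) l * x i j)" if "p = 1"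
    using gmat_row[of l "b j" "b i", where ?'k = 'k] side[OF assms(3)] assms that by (simp add: par qpow_mult qpow_0)
  show "x i j * gmat (b k) l = gmat (b k) l * x i j" if "p = 1" "i < k"
    using gmat_anti[where i = "b i" and k = "b k" and j = "b j" and l = l and ?'k = 'k] side[OF assms(3)] b_mono[of i k] assms that by (simp add: par)
  show "x i j * gmat (b k) l = gmat (b k) l * x i j - qscale (t - t') (gmat (b i) l * x k j)" if "p = 1" "k < i"
  proof -
    have "gmat (b k) l * x i j = x i j * gmat (b k) l - qscale (qinv - qv) (x k j * gmat (b i) l)"
      using gmat_diag[of "b k" "b i" l "b j", where ?'k = 'k] side[OF assms(3)] b_mono[of k i] assms that
      by (simp add: par kGL.scale_left_diff_distrib)
    moreover have "gmat (b i) l * x k j = x k j * gmat (b i) l"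
      using gmat_anti[where i = "b i" and k = "b k" and j = l and l = "b j" and ?'k = 'k] side[OF assms(3)] b_mono[of k i] assms that by (simp add: par)
    ultimately show ?thesis using that by (simp add: kGL.scale_left_diff_distrib)
  qed
qed

lemma outer_row:
  assumes "l \<notin> block" "i \<in> {1..N}" "j \<in> {1..N}" "k \<in> {1..N}"
  shows "p = 0 \<Longrightarrow> x j i * gmat l (b i) = qscale t (gmat l (b i) * x j i)"
    and "p = 0 \<Longrightarrow> i < k \<Longrightarrow> x j i * gmat l (b k) = gmat l (b k) * x j i + qscale (t - t') (gmat l (b i) * x j k)"
    and "p = 0 \<Longrightarrow> k < i \<Longrightarrow> x j i * gmat l (b k) = gmat l (b k) * x j i"
    and "p = 1 \<Longrightarrow> x j i * gmat l (b i) = qscale t' (gmat l (b i) * x j i)"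
    and "p = 1 \<Longrightarrow> k < i \<Longrightarrow> x j i * gmat l (b k) = gmat l (b k) * x j i - qscale (t - t') (gmat l (b i) * x j k)"
    and "p = 1 \<Longrightarrow> i < k \<Longrightarrow> x j i * gmat l (b k) = gmat l (b k) * x j i"
proof -
  note par = apar_block apar_outside ipar_block ipar_outside
  note side = outside[OF assms(1)]
  show "x j i * gmat l (b i) = qscale t (gmat l (b i) * x j i)" if "p = 0"
    using gmat_col[of "b j" l "b i", where ?'k = 'k] side[OF assms(3)] assms that by (simp add: par)
  show "x j i * gmat l (b k) = gmat l (b k) * x j i + qscale (t - t') (gmat l (b i) * x j k)" if "p = 0" "i < k"
  proof -
    have "x j k * gmat l (b i) = gmat l (b i) * x j k"
      using gmat_anti[where i = "b j" and k = l and j = "b k" and l = "b i" and ?'k = 'k]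
        side[OF assms(3)] b_mono[of i k] assms that by (simp add: par)
    moreover have "x j i * gmat l (b k) = gmat l (b k) * x j i + qscale (t - t') (x j k * gmat l (b i))"
      using gmat_diag[of "b j" l "b i" "b k", where ?'k = 'k] side[OF assms(3)] b_mono[of i k] assms that
      by (simp add: par)
    ultimately show ?thesis by (simp only:)
  qed
  show "x j i * gmat l (b k) = gmat l (b k) * x j i" if "p = 0" "k < i"
    using gmat_anti[where i = "b j" and k = l and j = "b i" and l = "b k" and ?'k = 'k] side[OF assms(3)] b_mono[of k i] assms that by (simp add: par)
  show "x j i * gmat l (b i) = qscale t' (gmat l (b i) * x j i)" if "p = 1"
    using gmat_col[of l "b j" "b i", where ?'k = 'k] side[OF assms(3)] assms that by (simp add: par qpow_mult qpow_0)
  show "x j i * gmat l (b k) = gmat l (b k) * x j i" if "p = 1" "i < k"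
    using gmat_anti[where i = "b j" and k = l and j = "b i" and l = "b k" and ?'k = 'k] side[OF assms(3)] b_mono[of i k] assms that by (simp add: par)
  show "x j i * gmat l (b k) = gmat l (b k) * x j i - qscale (t - t') (gmat l (b i) * x j k)" if "p = 1" "k < i"
  proof -
    have "gmat l (b k) * x j i = x j i * gmat l (b k) - qscale (qinv - qv) (gmat l (b i) * x j k)"
      using gmat_diag[of l "b j" "b k" "b i", where ?'k = 'k] side[OF assms(3)] b_mono[of k i] assms that
      by (simp add: par kGL.scale_left_diff_distrib)
    then show ?thesis using that by (simp add: kGL.scale_left_diff_distrib)
  qed
qed

lemma D_outer_column:
  assumes "l \<notin> block" "k \<in> {1..N}"
  shows "D * gmat (b k) l = qscale qinv (gmat (b k) l * D)"
  using p
proof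
  assume "p = 0"
  then have "D * gmat (b k) l = qscale t (gmat (b k) l * D)"
    unfolding D_eq mat.qdet_def using assms by (intro mat.minor_right_column(1)[where y = "\<lambda>k. gmat (b k) l"] outer_column) (auto simp del: upt_Suc)
  then show ?thesis using \<open>p = 0\<close> by simp
next
  assume "p = 1"
  then have "D * gmat (b k) l = qscale t' (gmat (b k) l * D)"
    unfolding D_eq mat.qdet_def using assms by (intro mat.minor_left_column(1)[where y = "\<lambda>k. gmat (b k) l"] outer_column) (auto simp del: upt_Suc)
  then show ?thesis using \<open>p = 1\<close> by simp
qed

text \<open>A row outside the block is an outside column of the transposed matrix, and the
  determinant may equally be expanded by columns.\<close>

lemma D_outer_row:
  assumes "l \<notin> block" "k \<in> {1..N}"
  shows "D * gmat l (b k) = qscale qinv (gmat l (b k) * D)"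
proof -
  interpret tr: quantum_matrix qscale t t' "\<lambda>i j. x j i" "{1..N}" by (rule mat.transpose)
  show ?thesis
    using p
  proof
    assume "p = 0"
    then have "D * gmat l (b k) = qscale t (gmat l (b k) * D)"
      unfolding D_eq mat.qdet_transpose using assms by (intro tr.minor_right_column(1)[where y = "\<lambda>k. gmat l (b k)"] outer_row) (auto simp del: upt_Suc)
    then show ?thesis using \<open>p = 0\<close> by simp
  next
    assume "p = 1"
    then have "D * gmat l (b k) = qscale t' (gmat l (b k) * D)"
      unfolding D_eq mat.qdet_transpose using assms by (intro tr.minor_left_column(1)[where y = "\<lambda>k. gmat l (b k)"] outer_row) (auto simp del: upt_Suc)
    then show ?thesis using \<open>p = 1\<close> by simp
  qed
qed

end


section \<open>The coproduct of a block determinant\<close>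

context gl_block
begin

definition coterm :: "(nat \<Rightarrow> ('m, 'n) idx) \<Rightarrow> (nat \<Rightarrow> nat) \<Rightarrow> ('k, 'm, 'n) kGL2"
  where "coterm \<kappa> \<sigma> = (\<Prod>j\<leftarrow>[1..<N + 1]. gmat (b j) (\<kappa> j) \<otimes> gmat (\<kappa> j) (b (\<sigma> j)))"

text \<open>This is \<open>gl_R i\<close> for the even block and \<open>gl_S i\<close> for the odd
  one: i counts the intermediate indices outside the block, and these are the ones that make both
  legs of their factor odd.\<close>

definition coD :: "nat \<Rightarrow> ('k, 'm, 'n) kGL2"
  where "coD i = (\<Sum>\<sigma> | \<sigma> permutes {1..N}.
     \<Sum>\<kappa> | \<kappa> \<in> {1..N} \<rightarrow>\<^sub>E UNIV \<and> card {j \<in> {1..N}. \<kappa> j \<notin> block} = i.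
       t2scale ((- t) ^ perm_length N \<sigma>) (coterm \<kappa> \<sigma>))"

text \<open>The right side is the determinant formula evaluated at the coproducts of the entries, so
  it is what an algebra homomorphism extending them does to \<open>D\<close>.\<close>

lemma sum_coD:
  "(\<Sum>i\<le>N. coD i) = (\<Sum>\<sigma> | \<sigma> permutes {1..N}. t2scale ((- t) ^ perm_length N \<sigma>)
     (\<Prod>j\<leftarrow>[1..<N + 1]. comat (b j) (b (\<sigma> j))))"
proof -
  have "(\<Prod>j\<leftarrow>[1..<N + 1]. comat (b j) (b (\<sigma> j))) = (\<Sum>\<kappa>\<in>{1..N} \<rightarrow>\<^sub>E UNIV. coterm \<kappa> \<sigma>)" for \<sigma>
    unfolding comat_def coterm_def
    by (subst prod_list_sum_distrib) (simp_all add: atLeastLessThanSuc_atLeastAtMost del: upt_Suc)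
  moreover have "(\<Sum>\<kappa>\<in>{1..N} \<rightarrow>\<^sub>E UNIV. h \<kappa>)
    = (\<Sum>i\<le>N. \<Sum>\<kappa> | \<kappa> \<in> {1..N} \<rightarrow>\<^sub>E UNIV \<and> card {j \<in> {1..N}. \<kappa> j \<notin> block} = i. h \<kappa>)"
    for h :: "(nat \<Rightarrow> ('m, 'n) idx) \<Rightarrow> ('k, 'm, 'n) kGL2"
  proof (rule sum.group[symmetric])
    have "card {j \<in> {1..N}. \<kappa> j \<notin> block} \<le> card {1..N}" for \<kappa> by (rule card_mono) auto
    then show "(\<lambda>\<kappa>. card {j \<in> {1..N}. \<kappa> j \<notin> block}) ` ({1..N} \<rightarrow>\<^sub>E UNIV) \<subseteq> {..N}" by auto
  qed (auto intro: finite_PiE)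
  ultimately show ?thesis
    unfolding coD_def by (subst sum.swap) (simp only: kGL2.scale_sum_right)
qed

lemma prod_list_tens_even:
  assumes "\<And>j. j \<in> set js \<Longrightarrow> f j \<in> qgrade 0" "\<And>j. j \<in> set js \<Longrightarrow> g j \<in> qgrade 0"
  shows "(\<Prod>j\<leftarrow>js. f j \<otimes> g j) = (\<Prod>j\<leftarrow>js. f j) \<otimes> (\<Prod>j\<leftarrow>js. g j)"
  using assms by (induction js) (simp_all add: one_kGL2_def tens2_mult_even)

text \<open>Reconciles two conventions outside the interval: extensional functions are undefined
  there, permutations are the identity.\<close>

lemma sum_restricted_permutations:
  "(\<Sum>\<kappa>\<in>{1..N} \<rightarrow>\<^sub>E {1..N}. if distinct (map \<kappa> [1..<N + 1]) then h (map \<kappa> [1..<N + 1]) else 0)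
    = (\<Sum>\<sigma> | \<sigma> permutes {1..N}. h (map \<sigma> [1..<N + 1]))" for h :: "nat list \<Rightarrow> 'c::comm_monoid_add"
proof -
  have "(\<Sum>\<kappa>\<in>{1..N} \<rightarrow>\<^sub>E {1..N}. if distinct (map \<kappa> [1..<N + 1]) then h (map \<kappa> [1..<N + 1]) else 0)
      = (\<Sum>\<kappa> | \<kappa> \<in> {1..N} \<rightarrow>\<^sub>E {1..N} \<and> distinct (map \<kappa> [1..<N + 1]). h (map \<kappa> [1..<N + 1]))"
    by (rule sum.mono_neutral_cong_right) (auto intro: finite_PiE)
  also have "\<dots> = (\<Sum>\<sigma> | \<sigma> permutes {1..N}. h (map \<sigma> [1..<N + 1]))"
  proof (rule sum.reindex_bij_witness[where i = "\<lambda>\<sigma>. restrict \<sigma> {1..N}" and j = "\<lambda>\<kappa> i. if i \<in> {1..N} then \<kappa> i else i"])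
    fix \<kappa> assume \<kappa>: "\<kappa> \<in> {\<kappa>. \<kappa> \<in> {1..N} \<rightarrow>\<^sub>E {1..N} \<and> distinct (map \<kappa> [1..<N + 1])}"
    show "restrict (\<lambda>i. if i \<in> {1..N} then \<kappa> i else i) {1..N} = \<kappa>"
      using \<kappa> by (auto simp: fun_eq_iff PiE_def extensional_def)
    have inj: "inj_on \<kappa> {1..N}"
      using \<kappa> by (simp add: distinct_map atLeastLessThanSuc_atLeastAtMost del: upt_Suc)
    moreover have "\<kappa> ` {1..N} = {1..N}"
      using \<kappa> inj by (intro endo_inj_surj) auto
    ultimately have "bij_betw (\<lambda>i. if i \<in> {1..N} then \<kappa> i else i) {1..N} {1..N}"
      by (subst bij_betw_cong[where g = \<kappa>]) (auto simp: bij_betw_def)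
    then show "(\<lambda>i. if i \<in> {1..N} then \<kappa> i else i) \<in> {\<sigma>. \<sigma> permutes {1..N}}"
      by (intro CollectI bij_imp_permutes) auto
    show "h (map (\<lambda>i. if i \<in> {1..N} then \<kappa> i else i) [1..<N + 1]) = h (map \<kappa> [1..<N + 1])"
      by (intro arg_cong[where f = h] map_cong) auto
  next
    fix \<sigma> assume "\<sigma> \<in> {\<sigma>. \<sigma> permutes {1..N}}"
    then have \<sigma>: "\<sigma> permutes {1..N}" by simp
    show "(\<lambda>i. if i \<in> {1..N} then restrict \<sigma> {1..N} i else i) = \<sigma>"
      using \<sigma> by (auto simp: permutes_def fun_eq_iff)
    have "map (restrict \<sigma> {1..N}) [1..<N + 1] = map \<sigma> [1..<N + 1]" by (rule map_cong) auto
    moreover have "distinct (map \<sigma> [1..<N + 1])"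
      using permutes_inj_on[OF \<sigma>] by (simp add: distinct_map del: upt_Suc)
    moreover have "restrict \<sigma> {1..N} \<in> {1..N} \<rightarrow>\<^sub>E {1..N}"
      unfolding restrict_PiE_iff using permutes_in_image[OF \<sigma>] by blast
    ultimately show "restrict \<sigma> {1..N} \<in> {\<kappa>. \<kappa> \<in> {1..N} \<rightarrow>\<^sub>E {1..N} \<and> distinct (map \<kappa> [1..<N + 1])}"
      by (intro CollectI conjI) (simp_all only:)
  qed
  finally show ?thesis .
qed

text \<open>Multiplicativity of the quantum determinant. For a fixed intermediate function the sum
  over permutations is a minor whose rows are its values. It vanishes unless they are distinct and
  otherwise is \<open>D\<close> times a power of - t; this power is the coefficient needed to form
  \<open>D\<close> in the left leg.\<close>

lemma coD_0: "coD 0 = D \<otimes> D"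
proof -
  have S: "set [1..<N + 1] = {1..N}" by auto
  have even: "x i j \<in> qgrade 0" if "i \<in> {1..N}" "j \<in> {1..N}" for i j
    using gmat_qgrade[of "b i" "b j"] that by (simp add: apar_block)
  have "(\<Sum>\<kappa> | \<kappa> \<in> {1..N} \<rightarrow>\<^sub>E UNIV \<and> card {j \<in> {1..N}. \<kappa> j \<notin> block} = 0. coterm \<kappa> \<sigma>)
      = (\<Sum>\<kappa>\<in>{1..N} \<rightarrow>\<^sub>E {1..N}. (\<Prod>j\<leftarrow>[1..<N + 1]. x j (\<kappa> j)) \<otimes> (\<Prod>j\<leftarrow>[1..<N + 1]. x (\<kappa> j) (\<sigma> j)))"
    if \<sigma>: "\<sigma> permutes {1..N}" for \<sigma>
  proof -
    have "{\<kappa>. \<kappa> \<in> {1..N} \<rightarrow>\<^sub>E UNIV \<and> card {j \<in> {1..N}. \<kappa> j \<notin> block} = 0} = {1..N} \<rightarrow>\<^sub>E block"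
      by (auto simp: PiE_def Pi_def)
    then have "(\<Sum>\<kappa> | \<kappa> \<in> {1..N} \<rightarrow>\<^sub>E UNIV \<and> card {j \<in> {1..N}. \<kappa> j \<notin> block} = 0. coterm \<kappa> \<sigma>)
        = (\<Prod>j\<leftarrow>[1..<N + 1]. \<Sum>k\<in>block. gmat (b j) k \<otimes> gmat k (b (\<sigma> j)))"
      unfolding coterm_def by (simp only: prod_list_sum_distrib[OF distinct_upt] S)
    also have "\<dots> = (\<Prod>j\<leftarrow>[1..<N + 1]. \<Sum>k\<in>{1..N}. x j k \<otimes> x k (\<sigma> j))"
      by (simp only: sum.reindex[OF b_inj] comp_def)
    also have "\<dots> = (\<Sum>\<kappa>\<in>{1..N} \<rightarrow>\<^sub>E {1..N}. \<Prod>j\<leftarrow>[1..<N + 1]. x j (\<kappa> j) \<otimes> x (\<kappa> j) (\<sigma> j))"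
      by (simp only: prod_list_sum_distrib[OF distinct_upt] S)
    also have "\<dots> = (\<Sum>\<kappa>\<in>{1..N} \<rightarrow>\<^sub>E {1..N}. (\<Prod>j\<leftarrow>[1..<N + 1]. x j (\<kappa> j)) \<otimes> (\<Prod>j\<leftarrow>[1..<N + 1]. x (\<kappa> j) (\<sigma> j)))"
    proof (rule sum.cong[OF refl], rule prod_list_tens_even)
      fix \<kappa> j assume "\<kappa> \<in> {1..N} \<rightarrow>\<^sub>E {1..N}" "j \<in> set [1..<N + 1]"
      then have "\<kappa> j \<in> {1..N}" "j \<in> {1..N}" "\<sigma> j \<in> {1..N}"
        using permutes_in_image[OF \<sigma>, of j] unfolding S by auto
      then show "x j (\<kappa> j) \<in> qgrade 0" "x (\<kappa> j) (\<sigma> j) \<in> qgrade 0" by (auto intro: even)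
    qed
    finally show ?thesis .
  qed
  then have "coD 0 = (\<Sum>\<sigma> | \<sigma> permutes {1..N}. \<Sum>\<kappa>\<in>{1..N} \<rightarrow>\<^sub>E {1..N}. t2scale ((- t) ^ perm_length N \<sigma>)
      ((\<Prod>j\<leftarrow>[1..<N + 1]. x j (\<kappa> j)) \<otimes> (\<Prod>j\<leftarrow>[1..<N + 1]. x (\<kappa> j) (\<sigma> j))))"
    unfolding coD_def kGL2.scale_sum_right[symmetric] by (intro sum.cong refl arg_cong[where f = "t2scale _"]) auto
  also have "\<dots> = (\<Sum>\<kappa>\<in>{1..N} \<rightarrow>\<^sub>E {1..N}. (\<Prod>j\<leftarrow>[1..<N + 1]. x j (\<kappa> j)) \<otimes> mat.minor (map \<kappa> [1..<N + 1]) {1..N})"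
    by (subst sum.swap) (simp add: GL.qminor_map_rows GL.qminor_permutes[unfolded Suc_eq_plus1] tens2_sum_right tens2_scale_right del: upt_Suc One_nat_def)
  also have "\<dots> = (\<Sum>\<kappa>\<in>{1..N} \<rightarrow>\<^sub>E {1..N}. qscale (if distinct (map \<kappa> [1..<N + 1]) then (- t) ^ inversions (map \<kappa> [1..<N + 1]) else 0)
      (\<Prod>j\<leftarrow>[1..<N + 1]. x j (\<kappa> j))) \<otimes> D"
    unfolding tens2_sum_left
  proof (rule sum.cong[OF refl])
    fix \<kappa> assume "\<kappa> \<in> {1..N} \<rightarrow>\<^sub>E {1..N}"
    then have "\<kappa> ` {1..N} \<subseteq> {1..N}" by blast
    then have "set (map \<kappa> [1..<N + 1]) \<subseteq> {1..N}" unfolding set_map S .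
    from mat.minor_eq_qdet[OF this]
    have "mat.minor (map \<kappa> [1..<N + 1]) {1..N}
        = qscale (if distinct (map \<kappa> [1..<N + 1]) then (- t) ^ inversions (map \<kappa> [1..<N + 1]) else 0) D"
      unfolding D_eq by (simp only: length_map length_upt diff_add_inverse2 refl)
    then show "(\<Prod>j\<leftarrow>[1..<N + 1]. x j (\<kappa> j)) \<otimes> mat.minor (map \<kappa> [1..<N + 1]) {1..N}
      = qscale (if distinct (map \<kappa> [1..<N + 1]) then (- t) ^ inversions (map \<kappa> [1..<N + 1]) else 0)
          (\<Prod>j\<leftarrow>[1..<N + 1]. x j (\<kappa> j)) \<otimes> D"
      by (simp only: tens2_scale_left tens2_scale_right)
  qed
  also have "(\<Sum>\<kappa>\<in>{1..N} \<rightarrow>\<^sub>E {1..N}. qscale (if distinct (map \<kappa> [1..<N + 1]) then (- t) ^ inversions (map \<kappa> [1..<N + 1]) else 0)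
      (\<Prod>j\<leftarrow>[1..<N + 1]. x j (\<kappa> j)))
    = (\<Sum>\<kappa>\<in>{1..N} \<rightarrow>\<^sub>E {1..N}. if distinct (map \<kappa> [1..<N + 1]) then
        (\<lambda>js. qscale ((- t) ^ inversions js) (\<Prod>(i, j)\<leftarrow>zip [1..<N + 1] js. x i j)) (map \<kappa> [1..<N + 1]) else 0)"
    by (intro sum.cong refl) (simp add: zip_map2 zip_same_conv_map comp_def del: upt_Suc)
  also have "\<dots> = (\<Sum>\<sigma> | \<sigma> permutes {1..N}.
      qscale ((- t) ^ inversions (map \<sigma> [1..<N + 1])) (\<Prod>(i, j)\<leftarrow>zip [1..<N + 1] (map \<sigma> [1..<N + 1]). x i j))"
    by (rule sum_restricted_permutations[where h = "\<lambda>js. qscale ((- t) ^ inversions js) (\<Prod>(i, j)\<leftarrow>zip [1..<N + 1] js. x i j)"])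
  also have "\<dots> = D"
    unfolding D_def
    by (intro sum.cong refl) (simp add: perm_length_eq_inversions zip_map2 zip_same_conv_map comp_def del: upt_Suc)
  finally show ?thesis .
qed

lemma DD_comm_factor:
  assumes "i \<in> {1..N}" "j \<in> {1..N}"
  shows "(D \<otimes> D) * (gmat (b i) k \<otimes> gmat k (b j))
    = t2scale (if k \<in> block then 1 else qpow (- 2)) ((gmat (b i) k \<otimes> gmat k (b j)) * (D \<otimes> D))"
proof (cases "k \<in> block")
  case True
  then show ?thesis using assms by (auto simp: tens2_mult_even D_even D_central)
next
  case False
  then show ?thesis using assms
    by (simp add: tens2_mult_even D_even D_outer_column D_outer_row tens2_scale_left tens2_scale_right qpow_mult)
qed

lemma DD_comm_coterm:
  assumes \<sigma>: "\<sigma> permutes {1..N}"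
  shows "(D \<otimes> D) * coterm \<kappa> \<sigma> = t2scale (qpow (- 2 * int (card {j \<in> {1..N}. \<kappa> j \<notin> block}))) (coterm \<kappa> \<sigma> * (D \<otimes> D))"
proof -
  have prefix: "(D \<otimes> D) * (\<Prod>j\<leftarrow>js. gmat (b j) (\<kappa> j) \<otimes> gmat (\<kappa> j) (b (\<sigma> j)))
    = t2scale (qpow (- 2 * int (length (filter (\<lambda>j. \<kappa> j \<notin> block) js))))
      ((\<Prod>j\<leftarrow>js. gmat (b j) (\<kappa> j) \<otimes> gmat (\<kappa> j) (b (\<sigma> j))) * (D \<otimes> D))" if "set js \<subseteq> {1..N}" for js
    using that
  proof (induction js)
    case (Cons j js)
    then have j: "j \<in> {1..N}" "\<sigma> j \<in> {1..N}" using permutes_in_image[OF \<sigma>, of j] by auto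
    have "(D \<otimes> D) * ((gmat (b j) (\<kappa> j) \<otimes> gmat (\<kappa> j) (b (\<sigma> j))) * y)
      = t2scale (if \<kappa> j \<in> block then 1 else qpow (- 2)) ((gmat (b j) (\<kappa> j) \<otimes> gmat (\<kappa> j) (b (\<sigma> j))) * ((D \<otimes> D) * y))" for y
      unfolding mult.assoc[symmetric] DD_comm_factor[OF j] by simp
    with Cons show ?case by (simp add: mult.assoc qpow_mult)
  qed (simp add: qpow_0)
  have len: "length (filter (\<lambda>j. \<kappa> j \<notin> block) [1..<N + 1]) = card {j \<in> {1..N}. \<kappa> j \<notin> block}"
    by (subst distinct_length_filter) (auto intro!: arg_cong[where f = card] simp del: upt_Suc)
  show ?thesis
    unfolding coterm_def len[symmetric] by (rule prefix) auto
qed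

lemma DD_comm_coD: "(D \<otimes> D) * coD i = t2scale (qpow (- 2 * int i)) (coD i * (D \<otimes> D))"
  unfolding coD_def
  by (simp add: sum_distrib_left sum_distrib_right kGL2.scale_sum_right DD_comm_coterm mult.commute cong: conj_cong)


section \<open>Ideals generated by words in the odd entries of the block rows\<close>

lemma D_inv_outer:
  assumes "l \<notin> block" "k \<in> {1..N}"
  shows "gmat (b k) l * D_inv = qscale qinv (D_inv * gmat (b k) l)"
proof -
  have "gmat (b k) l * D_inv = D_inv * (D * gmat (b k) l) * D_inv"
    by (simp add: D_inverse flip: mult.assoc)
  also have "\<dots> = qscale qinv (D_inv * gmat (b k) l * (D * D_inv))"
    unfolding D_outer_column[OF assms] by (simp add: mult.assoc)
  finally show ?thesis by (simp add: D_inverse)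
qed

definition outer_word :: "(nat \<times> ('m, 'n) idx) list \<Rightarrow> ('k, 'm, 'n) kGL"
  where "outer_word cs = (\<Prod>c\<leftarrow>cs. gmat (b (fst c)) (snd c))"

text \<open>Only left multiplication is built in. Right multiplication by entries of the block rows
  and by \<open>D_inv\<close> is established below; these are the factors that the first tensor leg
  receives on the right.\<close>

definition odd_ideal :: "nat \<Rightarrow> ('k, 'm, 'n) kGL set"
  where "odd_ideal r = kGL.span {w * outer_word cs | w cs. length cs = r \<and> set cs \<subseteq> {1..N} \<times> - block}"

lemma odd_ideal_gen: "length cs = r \<Longrightarrow> set cs \<subseteq> {1..N} \<times> - block \<Longrightarrow> w * outer_word cs \<in> odd_ideal r"
  unfolding odd_ideal_def by (rule kGL.span_base) blast

lemma odd_ideal_induct [consumes 1, case_names zero step]: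
  assumes "a \<in> odd_ideal r" "P 0"
    "\<And>w cs a. length cs = r \<Longrightarrow> set cs \<subseteq> {1..N} \<times> - block \<Longrightarrow> P a \<Longrightarrow> P (w * outer_word cs + a)"
  shows "P a"
  using assms(1) unfolding odd_ideal_def
proof (induction rule: kGL.span_induct_alt)
  case (step c y a)
  then obtain w cs where "y = w * outer_word cs" "length cs = r" "set cs \<subseteq> {1..N} \<times> - block" by blast
  with assms(3)[OF this(2,3) step(2), of "qscale c w"] show ?case by (simp add: qscale_mult_left)
qed (rule assms(2))

lemmas odd_ideal_closed =
  kGL.span_zero[of "{w * outer_word cs | w cs. length cs = r \<and> set cs \<subseteq> {1..N} \<times> - block}" for r, folded odd_ideal_def]
  kGL.span_add[of _ "{w * outer_word cs | w cs. length cs = r \<and> set cs \<subseteq> {1..N} \<times> - block}" for r, folded odd_ideal_def]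
  kGL.span_scale[of _ "{w * outer_word cs | w cs. length cs = r \<and> set cs \<subseteq> {1..N} \<times> - block}" for r, folded odd_ideal_def]

lemma odd_ideal_left: "a \<in> odd_ideal r \<Longrightarrow> y * a \<in> odd_ideal r"
  by (induction rule: odd_ideal_induct)
    (auto simp: distrib_left mult.assoc[symmetric] intro!: odd_ideal_closed odd_ideal_gen)

lemma odd_ideal_Suc:
  assumes "a \<in> odd_ideal (Suc r)"
  shows "a \<in> odd_ideal r"
  using assms
proof (induction rule: odd_ideal_induct)
  case (step w cs a)
  then obtain i l cs' where "cs = (i, l) # cs'" by (cases cs) auto
  then have "w * outer_word cs = w * gmat (b i) l * outer_word cs'"
    by (simp add: outer_word_def mult.assoc)
  moreover have "w * gmat (b i) l * outer_word cs' \<in> odd_ideal r"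
    using step \<open>cs = (i, l) # cs'\<close> by (intro odd_ideal_gen) auto
  ultimately show ?case using step by (auto intro: odd_ideal_closed)
qed (rule odd_ideal_closed)

lemma odd_ideal_outer:
  assumes "a \<in> odd_ideal r" "i \<in> {1..N}" "l \<notin> block"
  shows "a * gmat (b i) l \<in> odd_ideal (Suc r)"
  using assms(1)
proof (induction rule: odd_ideal_induct)
  case (step w cs a)
  have "w * outer_word (cs @ [(i, l)]) \<in> odd_ideal (Suc r)"
    using step assms by (intro odd_ideal_gen) auto
  then show ?case using step by (auto simp: outer_word_def distrib_right mult.assoc intro: odd_ideal_closed)
qed (simp add: odd_ideal_closed)

text \<open>Forgets the coefficients and keeps what the filtration needs: a block entry moves to the
  left, and one odd entry of a block row remains at the right end.\<close>

lemma outer_inner_swap: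
  assumes "i \<in> {1..N}" "j \<in> {1..N}" "k \<in> {1..N}" "l \<notin> block"
  shows "\<exists>\<alpha> \<beta>. gmat (b k) l * x i j = qscale \<alpha> (x i j * gmat (b k) l) + qscale \<beta> (x k j * gmat (b i) l)"
proof -
  define c where "c = t - t'"
  note oc = outer_column[OF assms(4), folded c_def]
  have tt: "t' * t = 1" "t * t' = 1" using p by (auto simp: qpow_mult qpow_0)
  consider "k = i" | "p = 0" "i < k" | "p = 0" "k < i" | "p = 1" "k < i" | "p = 1" "i < k"
    using p linorder_neqE_nat by blast
  then show ?thesis
  proof cases
    case 1
    have "gmat (b k) l * x i j = qscale (if p = 0 then t' else t) (x i j * gmat (b k) l)"
      using p oc(1,4)[OF assms(1-3)] 1 tt by auto
    then show ?thesis by - (rule exI[of _ "if p = 0 then t' else t"], rule exI[of _ 0], simp)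
  next
    case 2
    have "gmat (b k) l * x i j = qscale 1 (x i j * gmat (b k) l) + qscale (- c) (x k j * gmat (b i) l)"
      using oc(2)[OF assms(1-3) 2] oc(3)[OF assms(3,2,1) 2] by simp
    then show ?thesis by blast
  next
    case 3
    have "gmat (b k) l * x i j = qscale 1 (x i j * gmat (b k) l) + qscale 0 (x k j * gmat (b i) l)"
      using oc(3)[OF assms(1-3) 3] by simp
    then show ?thesis by blast
  next
    case 4
    have "gmat (b k) l * x i j = qscale 1 (x i j * gmat (b k) l) + qscale c (x k j * gmat (b i) l)"
      using oc(5)[OF assms(1-3) 4] oc(6)[OF assms(3,2,1) 4] by simp
    then show ?thesis by blast
  next
    case 5
    have "gmat (b k) l * x i j = qscale 1 (x i j * gmat (b k) l) + qscale 0 (x k j * gmat (b i) l)"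
      using oc(6)[OF assms(1-3) 5] by simp
    then show ?thesis by blast
  qed
qed

lemma odd_ideal_inner:
  assumes "a \<in> odd_ideal r" "i \<in> {1..N}" "j \<in> {1..N}"
  shows "a * x i j \<in> odd_ideal r"
proof -
  \<comment> \<open>The row i has to be arbitrary in the induction, because the swap may trade it
    for the row of the odd letter.\<close>
  have word: "outer_word cs * x i j \<in> odd_ideal (length cs)"
    if "set cs \<subseteq> {1..N} \<times> - block" "i \<in> {1..N}" for cs i
    using that
  proof (induction cs arbitrary: i rule: rev_induct)
    case Nil
    show ?case using odd_ideal_gen[of "[]" 0 "x i j"] by (simp add: outer_word_def)
  next
    case (snoc c cs)
    obtain k l where c: "c = (k, l)" by force
    then have kl: "k \<in> {1..N}" "l \<notin> block" using snoc.prems by auto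
    obtain \<alpha> \<beta> where swap: "gmat (b k) l * x i j = qscale \<alpha> (x i j * gmat (b k) l) + qscale \<beta> (x k j * gmat (b i) l)"
      using outer_inner_swap[OF snoc.prems(2) assms(3) kl] by blast
    have "outer_word (cs @ [c]) * x i j = outer_word cs * (gmat (b k) l * x i j)"
      by (simp add: outer_word_def c mult.assoc)
    also have "\<dots> = qscale \<alpha> (outer_word cs * x i j * gmat (b k) l) + qscale \<beta> (outer_word cs * x k j * gmat (b i) l)"
      unfolding swap by (simp add: distrib_left mult.assoc)
    also have "\<dots> \<in> odd_ideal (Suc (length cs))"
      using snoc.IH snoc.prems kl by (intro odd_ideal_closed odd_ideal_outer) auto
    finally show ?case by simp
  qed
  show ?thesis
    using assms(1)
  proof (induction rule: odd_ideal_induct)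
    case (step w cs a)
    then show ?case
      using word[of cs i] assms(2) by (auto simp: distrib_right mult.assoc intro!: odd_ideal_closed odd_ideal_left)
  qed (simp add: odd_ideal_closed)
qed

lemma odd_ideal_D_inv:
  assumes "a \<in> odd_ideal r"
  shows "a * D_inv \<in> odd_ideal r"
proof -
  have word: "outer_word cs * D_inv \<in> odd_ideal (length cs)" if "set cs \<subseteq> {1..N} \<times> - block" for cs
    using that
  proof (induction cs rule: rev_induct)
    case Nil
    show ?case using odd_ideal_gen[of "[]" 0 D_inv] by (simp add: outer_word_def)
  next
    case (snoc c cs)
    obtain k l where c: "c = (k, l)" by force
    then have kl: "k \<in> {1..N}" "l \<notin> block" using snoc.prems by auto
    have "outer_word (cs @ [c]) * D_inv = qscale qinv (outer_word cs * D_inv * gmat (b k) l)"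
      by (simp add: outer_word_def c mult.assoc D_inv_outer[OF kl(2,1)])
    also have "\<dots> \<in> odd_ideal (Suc (length cs))"
      using snoc kl by (intro odd_ideal_closed odd_ideal_outer) auto
    finally show ?case by simp
  qed
  show ?thesis
    using assms
  proof (induction rule: odd_ideal_induct)
    case (step w cs a)
    then show ?case
      using word[of cs] by (auto simp: distrib_right mult.assoc intro!: odd_ideal_closed odd_ideal_left)
  qed (simp add: odd_ideal_closed)
qed

text \<open>There are N times \<open>card (- block)\<close> letters, each of square 0. Exchanging
  two of them in diagonal position creates the letters at the other two corners of the rectangle,
  both larger than the smaller of the two, so the straightening argument bounds the length of a
  nonzero word.\<close>

lemma odd_ideal_vanish:
  assumes "a \<in> odd_ideal r" "N * card (- block) < r"
  shows "a = 0"
proof -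
  let ?V = "{1..N} \<times> - block"
  \<comment> \<open>Lexicographic order, row before column, coded as one number with a base that
    exceeds every column number.\<close>
  define key where "key c = fst c * (CARD('m) + CARD('n) + 1) + num (snd c)" for c :: "nat \<times> ('m, 'n) idx"
  have num_le: "num l < CARD('m) + CARD('n) + 1" for l :: "('m, 'n) idx"
    using num[of l] by auto
  have key: "key (i, l) < key (k, r) \<longleftrightarrow> i < k \<or> i = k \<and> num l < num r" for i k l r
  proof -
    have "i * M + u < k * M + v \<longleftrightarrow> i < k \<or> i = k \<and> u < v" if "u < M" "v < M" for i k u v M :: nat
    proof (cases i k rule: linorder_cases)
      case less
      then have "i * M + M \<le> k * M" by (metis Suc_leI mult_Suc mult_le_mono1 add.commute)
      then show ?thesis using less that by simp
    next
      case greater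
      then have "k * M + M \<le> i * M" by (metis Suc_leI mult_Suc mult_le_mono1 add.commute)
      then show ?thesis using greater that by simp
    qed simp
    from this[OF num_le num_le, of i l k r] show ?thesis by (simp only: key_def fst_conv snd_conv)
  qed
  have neq: "c = d" if "key c = key d" for c d
  proof -
    obtain i l where c: "c = (i, l)" by force
    obtain k r where d: "d = (k, r)" by force
    have "\<not> key c < key d" "\<not> key d < key c" using that by simp_all
    then have "i = k" "num l = num r" unfolding c d key by auto
    then show ?thesis by (simp add: c d num_inject)
  qed
  have word: "outer_word cs = 0" if "set cs \<subseteq> ?V" "length cs = r" for cs
    unfolding outer_word_def
  proof (rule GL.straightening_nilpotent[where V = ?V and key = key])
    show "finite ?V" by simp
    show "inj_on key ?V" by (rule inj_onI) (rule neq)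
    show "set cs \<subseteq> ?V" "card ?V < length cs"
      using that assms(2) by (simp_all add: card_cartesian_product)
    show "gmat (b (fst c)) (snd c) * gmat (b (fst c)) (snd c) = (0 :: ('k, 'm, 'n) kGL)" if "c \<in> ?V" for c
      using that by (auto simp: apar_outside intro!: gmat_odd_square)
    fix c d assume c: "c \<in> ?V" and d: "d \<in> ?V" and less: "key d < key c"
    obtain i l where c': "c = (i, l)" by force
    obtain i' l' where d': "d = (i', l')" by force
    have il: "i \<in> {1..N}" "l \<notin> block" "i' \<in> {1..N}" "l' \<notin> block" using c d c' d' by auto
    have par: "apar (b i) l = 1" "apar (b i') l' = 1" "apar (b i) l' = 1" "apar (b i') l = 1"
      using il by (auto simp: apar_outside)
    show "\<exists>\<alpha> \<beta> e f. gmat (b (fst c)) (snd c) * gmat (b (fst d)) (snd d)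
        = qscale (\<alpha> :: 'k laurent) (gmat (b (fst d)) (snd d) * gmat (b (fst c)) (snd c))
          + qscale \<beta> (gmat (b (fst e)) (snd e) * gmat (b (fst f)) (snd f))
        \<and> e \<in> ?V \<and> f \<in> ?V \<and> key d < key e \<and> key d < key f"
    proof -
      \<comment> \<open>It is enough to straighten with these two corner letters, provided that the
        correction is nonzero in diagonal position only.\<close>
      have goal: ?thesis if "gmat (b i) l * gmat (b i') l' = qscale \<alpha> (gmat (b i') l' * gmat (b i) l)
          + qscale \<beta> (gmat (b i') l * gmat (b i) l')" "\<beta> \<noteq> 0 \<longrightarrow> i' < i \<and> num l' < num l" for \<alpha> \<beta> :: "'k laurent"
      proof (cases "\<beta> = 0")
        case True
        then have "gmat (b (fst c)) (snd c) * gmat (b (fst d)) (snd d)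
          = qscale \<alpha> (gmat (b (fst d)) (snd d) * gmat (b (fst c)) (snd c))
            + qscale 0 (gmat (b (fst c)) (snd c) * gmat (b (fst c)) (snd c))"
          using that(1) unfolding c' d' by simp
        note eq = this
        \<comment> \<open>With coefficient 0 any letter above d may stand in the correction term; c
          is one.\<close>
        show ?thesis
          by (rule exI[of _ \<alpha>], rule exI[of _ 0], rule exI[of _ c], rule exI[of _ c]) (intro conjI eq c less)
      next
        case False
        have "gmat (b (fst c)) (snd c) * gmat (b (fst d)) (snd d)
          = qscale \<alpha> (gmat (b (fst d)) (snd d) * gmat (b (fst c)) (snd c))
            + qscale \<beta> (gmat (b (fst (i', l))) (snd (i', l)) * gmat (b (fst (i, l'))) (snd (i, l')))"
          using that(1) unfolding c' d' by simp
        note eq = this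
        have mem: "(i', l) \<in> ?V" "(i, l') \<in> ?V" "key d < key (i', l)" "key d < key (i, l')"
          using False that(2) il unfolding d' key by auto
        show ?thesis
          by (rule exI[of _ \<alpha>], rule exI[of _ \<beta>], rule exI[of _ "(i', l)"], rule exI[of _ "(i, l')"]) (intro conjI eq mem)
      qed
      have inv: "qscale (c * d) (qscale (c * e) y) = y" if "c * c = 1" "d * e = 1"
        for c d e :: "'k laurent" and y :: "('k, 'm, 'n) kGL"
      proof -
        have "c * d * (c * e) = (c * c) * (d * e)" by (simp only: mult_ac)
        then show ?thesis by (simp only: kGL.scale_scale that mult_1_left kGL.scale_one)
      qed
      have s: "(- 1 :: 'k laurent) ^ n * (- 1) ^ n = 1" for n by (simp add: power_mult_distrib[symmetric])
      have inv': "qscale ((- 1) ^ 1 * qpow (- e) :: 'k laurent) (qscale ((- 1) ^ 1 * qpow e) y) = y"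
        for e and y :: "('k, 'm, 'n) kGL"
        by (rule inv[OF s]) (simp add: qpow_mult qpow_0)
      consider "i' = i" "num l' < num l" | "i' < i" "l' = l" | "i' < i" "num l' < num l" | "i' < i" "num l < num l'"
        using less key[of i' l' i l] num_neq[of l l'] unfolding c' d' by force
      then show ?thesis
      proof cases
        case 1
        define e :: int where "e = (- 1) ^ (ipar (b i) + 1)"
        have E: "gmat (b i) l' * gmat (b i) l = qscale ((- 1) ^ 1 * qpow e :: 'k laurent) (gmat (b i) l * gmat (b i) l')"
          using gmat_row[OF 1(2), of "b i", where ?'k = 'k] unfolding par e_def[symmetric] by simp
        have "gmat (b i) l * gmat (b i) l' = qscale ((- 1) ^ 1 * qpow (- e) :: 'k laurent) (gmat (b i) l' * gmat (b i) l)"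
          unfolding E inv' ..
        with 1 show ?thesis by (intro goal[of "(- 1) ^ 1 * qpow (- e)" 0]) simp_all
      next
        case 2
        define e :: int where "e = (- 1) ^ (ipar l + 1)"
        have "num (b i') < num (b i)" using 2 il by (intro b_mono)
        from gmat_col[OF this, of l, where ?'k = 'k]
        have E: "gmat (b i') l * gmat (b i) l = qscale ((- 1) ^ 1 * qpow e :: 'k laurent) (gmat (b i) l * gmat (b i') l)"
          unfolding par e_def[symmetric] by simp
        have "gmat (b i) l * gmat (b i') l = qscale ((- 1) ^ 1 * qpow (- e) :: 'k laurent) (gmat (b i') l * gmat (b i) l)"
          unfolding E inv' ..
        with 2 show ?thesis by (intro goal[of "(- 1) ^ 1 * qpow (- e)" 0]) simp_all
      next
        case 3
        have "num (b i') < num (b i)" using 3 il by (intro b_mono)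
        from gmat_diag[OF this 3(2), where ?'k = 'k] obtain \<beta> :: "'k laurent" where
          "gmat (b i') l' * gmat (b i) l = - (gmat (b i) l * gmat (b i') l') + qscale \<beta> (gmat (b i') l * gmat (b i) l')"
          unfolding par by auto
        then have "gmat (b i) l * gmat (b i') l' = qscale (- 1 :: 'k laurent) (gmat (b i') l' * gmat (b i) l)
            + qscale \<beta> (gmat (b i') l * gmat (b i) l')"
          by simp
        then show ?thesis by (rule goal) (simp add: 3)
      next
        case 4
        have "num (b i') < num (b i)" using 4 il by (intro b_mono)
        with 4 have "gmat (b i) l * gmat (b i') l' = qscale (- 1 :: 'k laurent) (gmat (b i') l' * gmat (b i) l)"
          using gmat_anti[where i = "b i" and j = l and k = "b i'" and l = l' and ?'k = 'k] unfolding par by simp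
        then show ?thesis by (intro goal[of "- 1" 0]) simp_all
      qed
    qed
  qed
  show ?thesis
    using assms(1) by (induction rule: odd_ideal_induct) (simp_all add: word)
qed

end


section \<open>The grading of the tensor square, and geometric series\<close>

lemma t2grade_add: "t \<in> t2grade d \<Longrightarrow> u \<in> t2grade d \<Longrightarrow> t + u \<in> t2grade d"
  unfolding t2grade_def by (rule kGL2.span_add)

lemma t2grade_scale: "t \<in> t2grade d \<Longrightarrow> t2scale c t \<in> t2grade d"
  unfolding t2grade_def by (rule kGL2.span_scale)

lemma t2grade_sum: "(\<And>a. a \<in> A \<Longrightarrow> f a \<in> t2grade d) \<Longrightarrow> (\<Sum>a\<in>A. f a) \<in> t2grade d"
  unfolding t2grade_def by (rule kGL2.span_sum)

lemma t2grade_zero: "0 \<in> t2grade d"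
  unfolding t2grade_def by (rule kGL2.span_zero)

lemma t2grade_tens:
  "a \<in> qgrade r \<Longrightarrow> b \<in> qgrade s \<Longrightarrow> r < 2 \<Longrightarrow> s < 2 \<Longrightarrow> d = (r + s) mod 2 \<Longrightarrow> a \<otimes> b \<in> t2grade d"
  unfolding t2grade_def by (rule kGL2.span_base) blast

lemma t2grade_induct [consumes 1, case_names zero add]:
  assumes "t \<in> t2grade d" "P 0"
    "\<And>a b r s t. r < 2 \<Longrightarrow> s < 2 \<Longrightarrow> a \<in> qgrade r \<Longrightarrow> b \<in> qgrade s \<Longrightarrow> d = (r + s) mod 2 \<Longrightarrow> P t \<Longrightarrow> P (a \<otimes> b + t)"
  shows "P t"
  using assms(1) unfolding t2grade_def
proof (induction rule: kGL2.span_induct_alt)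
  case (step c y t)
  then obtain a b r s where y: "y = a \<otimes> b" "r < 2" "s < 2" "a \<in> qgrade r" "b \<in> qgrade s" "d = (r + s) mod 2" by blast
  have "qscale c a \<in> qgrade r" using kGL.subspace_scale[OF subspace_qgrade y(4)] .
  from assms(3)[OF y(2,3) this y(5,6) step(2)] show ?case by (simp add: y(1) tens2_scale_left)
qed (rule assms(2))

lemma t2grade_mult:
  assumes "t \<in> t2grade d" "u \<in> t2grade e" "f = (d + e) mod 2"
  shows "t * u \<in> t2grade f"
  using assms(1)
proof (induction rule: t2grade_induct)
  case (add a b r s t)
  note ab = add
  have "(a \<otimes> b) * u \<in> t2grade f"
    using assms(2)
  proof (induction rule: t2grade_induct)
    case (add c g r' s' u)
    have "f = ((r + r') mod 2 + (s + s') mod 2) mod 2"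
    proof -
      have "r = 0 \<or> r = 1" "s = 0 \<or> s = 1" "r' = 0 \<or> r' = 1" "s' = 0 \<or> s' = 1"
        using ab(1,2) add(1,2) by auto
      then show ?thesis unfolding assms(3) ab(5) add(5) by (elim disjE) simp_all
    qed
    then have "(a * c) \<otimes> (b * g) \<in> t2grade f"
      by (intro t2grade_tens[OF qgrade_mult[OF ab(3) add(3) refl] qgrade_mult[OF ab(4) add(4) refl]]) simp_all
    then show ?case
      using add ab by (simp add: distrib_left tens2_times_homogeneous t2grade_add t2grade_scale)
  qed (simp add: t2grade_zero)
  with add show ?case by (simp add: distrib_right t2grade_add)
qed (simp add: t2grade_zero)

lemma t2grade_one: "1 \<in> t2grade 0"
  unfolding one_kGL2_def by (rule t2grade_tens[OF one_qgrade one_qgrade]) auto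

lemma t2grade_power: "t \<in> t2grade 0 \<Longrightarrow> t ^ n \<in> t2grade 0"
  by (induction n) (auto intro: t2grade_one t2grade_mult)

lemma t2grade_comat: "comat i j \<in> t2grade (apar i j)"
  unfolding comat_def
proof (rule t2grade_sum)
  fix k
  have "apar i j = (apar i k + apar k j) mod 2"
    using ipar_cases[of i] ipar_cases[of j] ipar_cases[of k] by (auto simp: apar_def)
  then show "gmat i k \<otimes> gmat k j \<in> t2grade (apar i j)"
    by (intro t2grade_tens[OF gmat_qgrade gmat_qgrade]) (auto simp: apar_less)
qed

text \<open>Only g needs a definite parity: the Koszul sign then depends on the parity components of
  c alone, while the first leg becomes \<open>a * g\<close> in every term.\<close>

lemma tens2_mult_gen:
  assumes "g \<in> qgrade e" "e < 2"
  shows "(a \<otimes> c) * (g \<otimes> d) = (a * g) \<otimes> (qpart 0 c * d) + t2scale ((- 1) ^ e) ((a * g) \<otimes> (qpart 1 c * d))"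
proof -
  have "e = 0 \<or> e = 1" using assms(2) by auto
  then show ?thesis
    by (auto simp: tens2_times tens_prod_def qpart_qgrade[OF assms(1)])
qed

lemma geometric_inverse:
  fixes w :: "'a::{ring,monoid_mult}"
  assumes "w ^ K = 0"
  shows "(1 + w) * (\<Sum>i<K. (- w) ^ i) = 1" "(\<Sum>i<K. (- w) ^ i) * (1 + w) = 1"
proof -
  have "(1 + w) * (\<Sum>i<n. (- w) ^ i) = 1 - (- w) ^ n" for n
  proof (induction n)
    case (Suc n)
    have "(1 + w) * (\<Sum>i<Suc n. (- w) ^ i) = (1 + w) * (\<Sum>i<n. (- w) ^ i) + ((- w) ^ n + w * (- w) ^ n)"
      by (simp only: sum.lessThan_Suc distrib_left) (simp only: distrib_right mult_1_left)
    then show ?case by (simp add: Suc)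
  qed simp
  moreover have "(\<Sum>i<n. (- w) ^ i) * (1 + w) = 1 - (- w) ^ n" for n
  proof (induction n)
    case (Suc n)
    have "(\<Sum>i<Suc n. (- w) ^ i) * (1 + w) = (\<Sum>i<n. (- w) ^ i) * (1 + w) + ((- w) ^ n + (- w) ^ n * w)"
      by (simp only: sum.lessThan_Suc distrib_right) (simp only: distrib_left mult_1_right)
    then show ?case by (simp add: Suc power_Suc2 del: power_Suc)
  qed simp
  moreover have "(- w) ^ n = w ^ n \<or> (- w) ^ n = - (w ^ n)" for n
    by (induction n) auto
  from this[of K] have "(- w) ^ K = 0" using assms by auto
  ultimately show "(1 + w) * (\<Sum>i<K. (- w) ^ i) = 1" "(\<Sum>i<K. (- w) ^ i) * (1 + w) = 1" by simp_all
qed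

lemma (in scalar_algebra) scale_minus_one_power: "scale ((- 1) ^ n) (w ^ n) = (- w) ^ n"
proof (induction n)
  case (Suc n)
  have "scale ((- 1) ^ Suc n) (w ^ Suc n) = - (w * scale ((- 1) ^ n) (w ^ n))" by simp
  then show ?case unfolding Suc by simp
qed simp

section \<open>The inverse of the coproduct of a block determinant\<close>

context gl_block
begin

text \<open>Filters the first leg only; once the ideal there is 0, the whole tensor vanishes
  whatever the second leg is.\<close>

definition tens_ideal :: "nat \<Rightarrow> ('k, 'm, 'n) kGL2 set"
  where "tens_ideal r = kGL2.span {a \<otimes> c | a c. a \<in> odd_ideal r}"

lemma tens_ideal_gen: "a \<in> odd_ideal r \<Longrightarrow> a \<otimes> c \<in> tens_ideal r"
  unfolding tens_ideal_def by (rule kGL2.span_base) blast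

lemma tens_ideal_scale: "y \<in> tens_ideal r \<Longrightarrow> t2scale c y \<in> tens_ideal r"
  unfolding tens_ideal_def by (rule kGL2.span_scale)

lemma tens_ideal_add: "y \<in> tens_ideal r \<Longrightarrow> z \<in> tens_ideal r \<Longrightarrow> y + z \<in> tens_ideal r"
  unfolding tens_ideal_def by (rule kGL2.span_add)

lemma tens_ideal_sum: "(\<And>a. a \<in> A \<Longrightarrow> f a \<in> tens_ideal r) \<Longrightarrow> (\<Sum>a\<in>A. f a) \<in> tens_ideal r"
  unfolding tens_ideal_def by (rule kGL2.span_sum)

lemma tens_ideal_Suc: "tens_ideal (Suc r) \<subseteq> tens_ideal r"
  unfolding tens_ideal_def by (rule kGL2.span_mono) (auto dest: odd_ideal_Suc)

lemma tens_ideal_antimono: "r \<le> s \<Longrightarrow> tens_ideal s \<subseteq> tens_ideal r"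
  by (rule lift_Suc_antimono_le[of tens_ideal]) (rule tens_ideal_Suc)

lemma tens_ideal_mult:
  assumes "y \<in> tens_ideal r" "g \<in> qgrade e" "e < 2" "\<And>a. a \<in> odd_ideal r \<Longrightarrow> a * g \<in> odd_ideal s"
  shows "y * (g \<otimes> d) \<in> tens_ideal s"
  using assms(1) unfolding tens_ideal_def[of r]
proof (induction rule: kGL2.span_induct_alt)
  case base
  then show ?case by (simp add: tens_ideal_def kGL2.span_zero)
next
  case (step c y z)
  then obtain a c' where y: "y = a \<otimes> c'" "a \<in> odd_ideal r" by blast
  have "y * (g \<otimes> d) \<in> tens_ideal s"
    unfolding y tens2_mult_gen[OF assms(2,3)]
    by (intro tens_ideal_add tens_ideal_scale tens_ideal_gen assms(4) y)
  with step show ?case by (simp add: distrib_right tens_ideal_add tens_ideal_scale)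
qed

text \<open>Reading the factors from left to right, an index inside the block keeps the first leg in
  its ideal, and an outside index adds one odd letter.\<close>

lemma tens_ideal_coterm:
  assumes "y \<in> tens_ideal r"
  shows "y * coterm \<kappa> \<sigma> \<in> tens_ideal (r + card {j \<in> {1..N}. \<kappa> j \<notin> block})"
proof -
  have prefix: "y * (\<Prod>j\<leftarrow>js. gmat (b j) (\<kappa> j) \<otimes> gmat (\<kappa> j) (b (\<sigma> j)))
      \<in> tens_ideal (r + length (filter (\<lambda>j. \<kappa> j \<notin> block) js))"
    if "set js \<subseteq> {1..N}" "y \<in> tens_ideal r" for js y r
    using that
  proof (induction js arbitrary: y r)
    case (Cons j js)
    have "y * (gmat (b j) (\<kappa> j) \<otimes> gmat (\<kappa> j) (b (\<sigma> j))) \<in> tens_ideal (r + (if \<kappa> j \<in> block then 0 else 1))"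
    proof (rule tens_ideal_mult[OF Cons.prems(2) gmat_qgrade apar_less])
      fix a assume a: "a \<in> odd_ideal r"
      have j: "j \<in> {1..N}" using Cons.prems(1) by simp
      show "a * gmat (b j) (\<kappa> j) \<in> odd_ideal (r + (if \<kappa> j \<in> block then 0 else 1))"
      proof (cases "\<kappa> j \<in> block")
        case True
        then obtain i where i: "\<kappa> j = b i" "i \<in> {1..N}" by blast
        show ?thesis using odd_ideal_inner[OF a j i(2)] i True by simp
      next
        case False
        then show ?thesis using odd_ideal_outer[OF a j False] by simp
      qed
    qed
    from Cons.IH[OF _ this] Cons.prems(1) show ?case by (auto simp: mult.assoc split: if_splits)
  qed simp
  have len: "length (filter (\<lambda>j. \<kappa> j \<notin> block) [1..<N + 1]) = card {j \<in> {1..N}. \<kappa> j \<notin> block}"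
    by (subst distinct_length_filter) (auto intro!: arg_cong[where f = card] simp del: upt_Suc)
  show ?thesis
    unfolding coterm_def len[symmetric] by (rule prefix) (use assms in auto)
qed

lemma tens_ideal_coD: "y \<in> tens_ideal r \<Longrightarrow> y * coD i \<in> tens_ideal (r + i)"
  unfolding coD_def sum_distrib_left t2scale_mult_right
  using tens_ideal_coterm by (fastforce intro!: tens_ideal_sum tens_ideal_scale)

lemma tens_ideal_vanish:
  assumes "y \<in> tens_ideal r" "N * card (- block) < r"
  shows "y = 0"
  using assms(1) unfolding tens_ideal_def
  by (induction rule: kGL2.span_induct_alt) (auto dest: odd_ideal_vanish[OF _ assms(2)])

lemma DD_inverse: "(D \<otimes> D) * (D_inv \<otimes> D_inv) = 1" "(D_inv \<otimes> D_inv) * (D \<otimes> D) = 1"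
  by (simp_all add: tens2_mult_even D_even D_inv_even D_inverse one_kGL2_def)

lemma unit_inv_coD_0: "unit_inv (coD 0) = D_inv \<otimes> D_inv"
  unfolding coD_0 by (rule unit_inv_eq[OF DD_inverse])

text \<open>The formula of the theorem with the number of terms left open; every K above the
  nilpotency bound gives the same element.\<close>

definition coD_inv :: "nat \<Rightarrow> ('k, 'm, 'n) kGL2" where
  "coD_inv K = (\<Sum>i = 1..K. t2scale ((- 1) ^ (i - 1)) (unit_inv (coD 0) *
     (unit_inv (coD 0) * (\<Sum>j = 1..N. t2scale (qpow (- 2 * int j)) (coD j))) ^ (i - 1)))"

text \<open>With \<open>R = D \<otimes> D\<close> and \<open>V\<close> the sum of the other terms, \<open>W = R\<inverse> V' = V R\<inverse>\<close> because moving \<open>R\<close> past \<open>coD j\<close>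
  costs \<open>q\<close> to the power \<open>- 2 j\<close>; \<open>W\<close> is nilpotent since it raises the degree in the odd generators.\<close>

lemma coD_inverse:
  assumes "N * card (- block) < K"
  shows "(\<Sum>i\<le>N. coD i) * coD_inv K = 1" "coD_inv K * (\<Sum>i\<le>N. coD i) = 1"
proof -
  define R where "R = D \<otimes> D"
  define Ri where "Ri = D_inv \<otimes> D_inv"
  define V where "V = (\<Sum>j = 1..N. coD j)"
  define V' where "V' = (\<Sum>j = 1..N. t2scale (qpow (- 2 * int j)) (coD j))"
  define W where "W = Ri * V'"
  have R: "R * Ri = 1" "Ri * R = 1" unfolding R_def Ri_def by (rule DD_inverse)+
  have RV: "R * V = V' * R"
    unfolding R_def V_def V'_def by (simp add: sum_distrib_left sum_distrib_right DD_comm_coD)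
  have "W * R = Ri * R * V" by (simp add: W_def mult.assoc RV)
  then have WR: "W * R = V" by (simp add: R)
  have "{..N} = insert 0 {1..N}" by auto
  then have total: "(\<Sum>i\<le>N. coD i) = R + V"
    by (simp add: V_def coD_0 R_def)
  \<comment> \<open>Each further factor W contributes \<open>Ri\<close>, which preserves the
    filtration, and some \<open>coD j\<close> with j at least 1, which raises it.\<close>
  have deg: "W ^ n \<in> tens_ideal n" for n
  proof (induction n)
    case 0
    show ?case
      using tens_ideal_gen[OF odd_ideal_gen[of "[]" 0 1]] by (simp add: one_kGL2_def outer_word_def)
  next
    case (Suc n)
    have "W ^ n * Ri \<in> tens_ideal n"
      unfolding Ri_def by (rule tens_ideal_mult[OF Suc D_inv_even]) (auto intro: odd_ideal_D_inv)
    then have "W ^ n * Ri * coD j \<in> tens_ideal (Suc n)" if "j \<in> {1..N}" for j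
      using tens_ideal_coD tens_ideal_antimono[of "Suc n" "n + j"] that by fastforce
    then have "W ^ n * Ri * V' \<in> tens_ideal (Suc n)"
      unfolding V'_def sum_distrib_left t2scale_mult_right by (intro tens_ideal_sum tens_ideal_scale)
    then show ?case by (simp add: W_def mult.assoc power_Suc2 del: power_Suc)
  qed
  have nil: "W ^ K = 0" by (rule tens_ideal_vanish[OF deg assms])
  have "coD_inv K = (\<Sum>i = 1..K. Ri * (- W) ^ (i - 1))"
    unfolding coD_inv_def unit_inv_coD_0 V'_def[symmetric] Ri_def[symmetric] W_def[symmetric]
    by (simp only: t2scale_mult_right[symmetric] GL2.scale_minus_one_power)
  also have "\<dots> = Ri * (\<Sum>i<K. (- W) ^ i)"
    unfolding sum_distrib_left
    by (rule sum.reindex_bij_witness[of _ Suc "\<lambda>i. i - 1"]) auto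
  finally have inv: "coD_inv K = Ri * (\<Sum>i<K. (- W) ^ i)" .
  have total': "R + V = (1 + W) * R" by (simp add: distrib_right WR)
  have "V * Ri = W" by (simp add: WR[symmetric] mult.assoc R)
  then have "(R + V) * Ri = 1 + W" by (simp add: distrib_right R)
  then have "(R + V) * coD_inv K = (1 + W) * (\<Sum>i<K. (- W) ^ i)"
    by (simp add: inv flip: mult.assoc)
  then show "(\<Sum>i\<le>N. coD i) * coD_inv K = 1"
    by (simp add: total geometric_inverse[OF nil])
  have "coD_inv K * (R + V) = Ri * ((\<Sum>i<K. (- W) ^ i) * (1 + W)) * R"
    by (simp add: inv total' mult.assoc)
  then show "coD_inv K * (\<Sum>i\<le>N. coD i) = 1"
    by (simp add: total geometric_inverse[OF nil] R)
qed

lemma coD_even: "coD i \<in> t2grade 0"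
proof -
  have prefix: "(\<Prod>j\<leftarrow>js. gmat (b j) (\<kappa> j) \<otimes> gmat (\<kappa> j) (b (\<sigma> j))) \<in> t2grade 0"
    if \<sigma>: "\<sigma> permutes {1..N}" and "set js \<subseteq> {1..N}" for js \<sigma> and \<kappa> :: "nat \<Rightarrow> ('m, 'n) idx"
    using that(2)
  proof (induction js)
    case (Cons j js)
    then have "j \<in> {1..N}" "\<sigma> j \<in> {1..N}" using permutes_in_image[OF \<sigma>, of j] by auto
    then have "apar (\<kappa> j) (b (\<sigma> j)) = apar (b j) (\<kappa> j)" by (simp add: apar_def ipar_block add.commute)
    then have "gmat (b j) (\<kappa> j) \<otimes> gmat (\<kappa> j) (b (\<sigma> j)) \<in> t2grade 0"
      by (intro t2grade_tens[OF gmat_qgrade gmat_qgrade]) (simp_all add: apar_less)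
    with Cons show ?case by (auto intro: t2grade_mult)
  qed (simp add: t2grade_one)
  have "coterm \<kappa> \<sigma> \<in> t2grade 0" if "\<sigma> permutes {1..N}" for \<kappa> \<sigma>
    unfolding coterm_def by (rule prefix[OF that]) auto
  then show ?thesis
    unfolding coD_def by (intro t2grade_sum t2grade_scale) auto
qed

lemma coD_inv_even: "coD_inv K \<in> t2grade 0"
proof -
  have "unit_inv (coD 0) \<in> t2grade 0"
    unfolding unit_inv_coD_0 by (rule t2grade_tens[OF D_inv_even D_inv_even]) auto
  then show ?thesis
    unfolding coD_inv_def
    by (intro t2grade_sum t2grade_scale t2grade_mult[where d = 0 and e = 0] t2grade_power coD_even) auto
qed

end


section \<open>The superalgebra structure of the tensor cube\<close>

lemma tens3_zero [simp]: "tens3 0 b c = 0" "tens3 a 0 c = 0" "tens3 a b 0 = 0"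
  using tens3_linear(1)[of 0 0 b c] tens3_linear(2)[of a 0 0 c] tens3_linear(3)[of a b 0 0] by simp_all

lemma kGL3_hom_induct [case_names tens add]:
  assumes tens: "\<And>a b c r s t. r < 2 \<Longrightarrow> s < 2 \<Longrightarrow> t < 2 \<Longrightarrow> a \<in> qgrade r \<Longrightarrow> b \<in> qgrade s \<Longrightarrow> c \<in> qgrade t \<Longrightarrow> P (tens3 a b c)"
    and add: "\<And>t u. P t \<Longrightarrow> P u \<Longrightarrow> P (t + u)"
  shows "P t"
proof -
  have pure: "P (tens3 a b c)" for a b c
  proof -
    have "P (tens3 (qpart r a) (qpart s b) (qpart t c))" if "r < 2" "s < 2" "t < 2" for r s t
      using tens[OF that qpart_in_qgrade qpart_in_qgrade qpart_in_qgrade] .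
    then have "P (tens3 (qpart 0 a + qpart 1 a) (qpart 0 b + qpart 1 b) (qpart 0 c + qpart 1 c))"
      unfolding tens3_linear by (intro add) auto
    then show ?thesis by (simp only: qpart_sum)
  qed
  have "P (abs_kGL3 x)" for x
  proof (induction x rule: poly_mapping_single_induct)
    case zero
    show ?case using pure[of 0 0 0] by (simp add: zero_kGL3_def)
  next
    case (single p c)
    obtain a b d where p: "p = (a, b, d)" by (cases p)
    have "abs_kGL3 (Poly_Mapping.single p c) = tens3 (qscale c a) b d"
      unfolding tens3_linear by (simp add: p tens3_def flip: abs_kGL3_scale)
    then show ?case by (simp only: pure)
  next
    case (add x y)
    then show ?case by (simp add: abs_kGL3_add assms)
  qed
  from this[of "rep_kGL3 t"] show ?thesis by simp
qed

definition ext3 :: "('k::field laurent \<Rightarrow> 'c::ab_group_add \<Rightarrow> 'c) \<Rightarrow>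
    (('k, 'm::finite, 'n::finite) kGL \<Rightarrow> ('k, 'm, 'n) kGL \<Rightarrow> ('k, 'm, 'n) kGL \<Rightarrow> 'c) \<Rightarrow> ('k, 'm, 'n) kGL3 \<Rightarrow> 'c"
  where "ext3 s f t = lin_ext s (\<lambda>(a, b, c). f a b c) (rep_kGL3 t)"

definition trilin3 :: "('k::field laurent \<Rightarrow> 'c::ab_group_add \<Rightarrow> 'c) \<Rightarrow>
    (('k, 'm::finite, 'n::finite) kGL \<Rightarrow> ('k, 'm, 'n) kGL \<Rightarrow> ('k, 'm, 'n) kGL \<Rightarrow> 'c) \<Rightarrow> bool"
  where "trilin3 s f \<longleftrightarrow> module s \<and>
    (\<forall>a a' b c. f (a + a') b c = f a b c + f a' b c) \<and> (\<forall>a b b' c. f a (b + b') c = f a b c + f a b' c) \<and>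
    (\<forall>a b c c'. f a b (c + c') = f a b c + f a b c') \<and> (\<forall>k a b c. f (qscale k a) b c = s k (f a b c)) \<and>
    (\<forall>k a b c. f a (qscale k b) c = s k (f a b c)) \<and> (\<forall>k a b c. f a b (qscale k c) = s k (f a b c))"

lemma ext3_abs:
  fixes s :: "'k::field laurent \<Rightarrow> 'c::ab_group_add \<Rightarrow> 'c"
    and f :: "('k, 'm::finite, 'n::finite) kGL \<Rightarrow> ('k, 'm, 'n) kGL \<Rightarrow> ('k, 'm, 'n) kGL \<Rightarrow> 'c"
  assumes "trilin3 s f"
  shows "ext3 s f (abs_kGL3 x) = lin_ext s (\<lambda>(a, b, c). f a b c) x"
proof -
  have m: "module s" using assms by (simp add: trilin3_def)
  interpret h: module_hom fscale s "lin_ext s (\<lambda>(a, b, c). f a b c)" by (rule lin_ext_hom[OF m])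
  have "lin_ext s (\<lambda>(a, b, c). f a b c) y = 0" if "y \<in> free.span tens3_rel" for y
  proof (rule h.eq_0_on_span[OF _ that])
    fix z :: "('k, 'm, 'n) kGL \<times> ('k, 'm, 'n) kGL \<times> ('k, 'm, 'n) kGL \<Rightarrow>\<^sub>0 'k laurent"
    assume "z \<in> tens3_rel"
    then show "lin_ext s (\<lambda>(a, b, c). f a b c) z = 0"
      by cases (use assms in \<open>simp_all only: h.diff h.add h.scale lin_ext_single[OF m] h.m2.scale_one
          prod.case trilin3_def diff_self\<close>)
  qed
  from this[OF rep_abs_kGL3[of x]] show ?thesis
    unfolding ext3_def by (simp add: h.diff)
qed

lemma ext3_tens: "trilin3 s f \<Longrightarrow> ext3 s f (tens3 a b c) = f a b c"
  unfolding tens3_def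
  by (simp add: ext3_abs lin_ext_single module.scale_one trilin3_def)

lemma ext3_hom:
  fixes s :: "'k::field laurent \<Rightarrow> 'c::ab_group_add \<Rightarrow> 'c"
    and f :: "('k, 'm::finite, 'n::finite) kGL \<Rightarrow> ('k, 'm, 'n) kGL \<Rightarrow> ('k, 'm, 'n) kGL \<Rightarrow> 'c"
  assumes "trilin3 s f"
  shows "module_hom t3scale s (ext3 s f)"
proof -
  have m: "module s" using assms by (simp add: trilin3_def)
  interpret h: module_hom fscale s "lin_ext s (\<lambda>(a, b, c). f a b c)" by (rule lin_ext_hom[OF m])
  show ?thesis
  proof
    fix t u :: "('k, 'm, 'n) kGL3" and r
    obtain x where x: "t = abs_kGL3 x" by (rule kGL3_cases)
    obtain y where y: "u = abs_kGL3 y" by (rule kGL3_cases)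
    note * = x y
    show "ext3 s f (t + u) = ext3 s f t + ext3 s f u" "ext3 s f (t3scale r t) = s r (ext3 s f t)"
      unfolding * by (simp_all add: ext3_abs[OF assms] h.add h.scale flip: abs_kGL3_add abs_kGL3_scale)
  qed
qed

lemmas ext3_add = module_hom.add[OF ext3_hom]
lemmas ext3_scale = module_hom.scale[OF ext3_hom]

lemma ext3_fun_add: "module s \<Longrightarrow> ext3 s (\<lambda>a b c. f a b c + g a b c) t = ext3 s f t + ext3 s g t"
  by (simp add: ext3_def lin_ext_def module.scale_right_distrib sum.distrib case_prod_beta)

lemma ext3_fun_scale: "module s \<Longrightarrow> ext3 s (\<lambda>a b c. s k (f a b c)) t = s k (ext3 s f t)"
  by (simp add: ext3_def lin_ext_def module.scale_sum_right module.scale_left_commute case_prod_beta)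

text \<open>In the sign, a' moves past b and c, and b' moves past c. The four sums split exactly
  these elements into their parity components.\<close>

definition tens_prod3 :: "('k::field, 'm::finite, 'n::finite) kGL \<Rightarrow> ('k, 'm, 'n) kGL \<Rightarrow> ('k, 'm, 'n) kGL \<Rightarrow>
    ('k, 'm, 'n) kGL \<Rightarrow> ('k, 'm, 'n) kGL \<Rightarrow> ('k, 'm, 'n) kGL \<Rightarrow> ('k, 'm, 'n) kGL3"
  where "tens_prod3 a b c a' b' c' =
    (\<Sum>s\<in>{0, 1}. \<Sum>t\<in>{0, 1}. \<Sum>r'\<in>{0, 1}. \<Sum>s'\<in>{0, 1}. t3scale ((- 1) ^ (r' * (s + t) + s' * t))
      (tens3 (a * qpart r' a') (qpart s b * qpart s' b') (qpart t c * c')))"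

lemma tens_prod3_right: "trilin3 t3scale (\<lambda>a' b' c'. tens_prod3 a b c a' b' c')"
  unfolding trilin3_def
  by (intro conjI allI kGL3.module_axioms)
    (simp_all only: tens_prod3_def qpart_add qpart_scale distrib_left distrib_right
      qscale_mult_left qscale_mult_right tens3_linear kGL3.scale_right_distrib kGL3.scale_scale
      kGL3.scale_sum_right sum.distrib mult.commute)

lemma tens_prod3_left:
  "tens_prod3 (a + d) b c a' b' c' = tens_prod3 a b c a' b' c' + tens_prod3 d b c a' b' c'"
  "tens_prod3 a (b + d) c a' b' c' = tens_prod3 a b c a' b' c' + tens_prod3 a d c a' b' c'"
  "tens_prod3 a b (c + d) a' b' c' = tens_prod3 a b c a' b' c' + tens_prod3 a b d a' b' c'"
  "tens_prod3 (qscale k a) b c a' b' c' = t3scale k (tens_prod3 a b c a' b' c')"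
  "tens_prod3 a (qscale k b) c a' b' c' = t3scale k (tens_prod3 a b c a' b' c')"
  "tens_prod3 a b (qscale k c) a' b' c' = t3scale k (tens_prod3 a b c a' b' c')"
  by (simp_all only: tens_prod3_def qpart_add qpart_scale distrib_left distrib_right
      qscale_mult_left qscale_mult_right tens3_linear kGL3.scale_right_distrib kGL3.scale_scale
      kGL3.scale_sum_right sum.distrib mult.commute)

instantiation kGL3 :: (field, finite, finite) "{one, times}"
begin
definition one_kGL3 :: "('a, 'b, 'c) kGL3" where "one_kGL3 = tens3 1 1 1"
definition times_kGL3 :: "('a, 'b, 'c) kGL3 \<Rightarrow> ('a, 'b, 'c) kGL3 \<Rightarrow> ('a, 'b, 'c) kGL3"
  where "times_kGL3 t u = ext3 t3scale (\<lambda>a b c. ext3 t3scale (\<lambda>a' b' c'. tens_prod3 a b c a' b' c') u) t"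
instance ..
end

lemma times_trilin: "trilin3 t3scale (\<lambda>a b c. ext3 t3scale (\<lambda>a' b' c'. tens_prod3 a b c a' b' c') u)"
  unfolding trilin3_def tens_prod3_left
  by (simp add: kGL3.module_axioms ext3_fun_add ext3_fun_scale)

lemma tens3_times: "tens3 a b c * tens3 a' b' c' = tens_prod3 a b c a' b' c'"
  unfolding times_kGL3_def
  by (rule trans[OF ext3_tens[OF times_trilin] ext3_tens[OF tens_prod3_right]])

lemma tens3_times_homogeneous:
  assumes "b \<in> qgrade s" "c \<in> qgrade t" "a' \<in> qgrade r'" "b' \<in> qgrade s'" "s < 2" "t < 2" "r' < 2" "s' < 2"
  shows "tens3 a b c * tens3 a' b' c' = t3scale ((- 1) ^ (r' * (s + t) + s' * t)) (tens3 (a * a') (b * b') (c * c'))"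
proof -
  have sum: "(\<Sum>i\<in>{0, 1}. if i = j then f i else 0) = f j" if "j < 2" for j :: nat and f :: "nat \<Rightarrow> 'd::comm_monoid_add"
    using that by (auto simp: less_2_cases_iff)
  have "tens3 a b c * tens3 a' b' c' = (\<Sum>i\<in>{0, 1}. if i = s then (\<Sum>j\<in>{0, 1}. if j = t then (\<Sum>k\<in>{0, 1}. if k = r' then
      (\<Sum>l\<in>{0, 1}. if l = s' then t3scale ((- 1) ^ (k * (i + j) + l * j)) (tens3 (a * a') (b * b') (c * c')) else 0) else 0) else 0) else 0)"
    unfolding tens3_times tens_prod3_def
    by (intro sum.cong refl) (auto simp: qpart_qgrade[OF assms(1)] qpart_qgrade[OF assms(2)] qpart_qgrade[OF assms(3)] qpart_qgrade[OF assms(4)])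
  also have "\<dots> = t3scale ((- 1) ^ (r' * (s + t) + s' * t)) (tens3 (a * a') (b * b') (c * c'))"
    by (simp only: sum assms)
  finally show ?thesis .
qed

lemma kGL3_distrib:
  fixes t u v :: "('k::field, 'm::finite, 'n::finite) kGL3"
  shows "(t + u) * v = t * v + u * v" "t * (u + v) = t * u + t * v"
proof -
  show "(t + u) * v = t * v + u * v"
    unfolding times_kGL3_def by (rule ext3_add[OF times_trilin])
  show "t * (u + v) = t * u + t * v"
    unfolding times_kGL3_def ext3_add[OF tens_prod3_right] by (rule ext3_fun_add[OF kGL3.module_axioms])
qed

lemma kGL3_scale_mult:
  fixes t u :: "('k::field, 'm::finite, 'n::finite) kGL3"
  shows "t3scale c t * u = t3scale c (t * u)" "t * t3scale c u = t3scale c (t * u)"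
  unfolding times_kGL3_def ext3_scale[OF tens_prod3_right]
  by (rule ext3_scale[OF times_trilin], rule ext3_fun_scale[OF kGL3.module_axioms])

lemma minus_one_power_cong: "even a = even b \<Longrightarrow> (- 1 :: 'a::ring_1) ^ a = (- 1) ^ b"
  by (simp add: minus_one_power_iff)

lemma kGL3_mult_1:
  fixes t :: "('k::field, 'm::finite, 'n::finite) kGL3"
  shows "1 * t = t" "t * 1 = t"
proof -
  show "1 * t = t"
    by (induction t rule: kGL3_hom_induct)
      (simp_all add: kGL3_distrib one_kGL3_def tens3_times_homogeneous[OF one_qgrade one_qgrade])
  show "t * 1 = t"
  proof (induction t rule: kGL3_hom_induct)
    case (tens a b c r s t)
    then show ?case
      by (simp add: one_kGL3_def tens3_times_homogeneous[OF tens(5,6) one_qgrade one_qgrade])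
  qed (simp add: kGL3_distrib)
qed

lemma kGL3_assoc:
  fixes t u v :: "('k::field, 'm::finite, 'n::finite) kGL3"
  shows "t * u * v = t * (u * v)"
proof (induction t rule: kGL3_hom_induct)
  case (tens a b c r s t)
  note 1 = tens
  show ?case
  proof (induction u rule: kGL3_hom_induct)
    case (tens a' b' c' r' s' t')
    note 2 = tens
    show ?case
    proof (induction v rule: kGL3_hom_induct)
      case (tens a'' b'' c'' r'' s'' t'')
      have bc: "b * b' \<in> qgrade ((s + s') mod 2)" "c * c' \<in> qgrade ((t + t') mod 2)"
        using 1 2 by (auto intro: qgrade_mult)
      have ab: "a' * a'' \<in> qgrade ((r' + r'') mod 2)" "b' * b'' \<in> qgrade ((s' + s'') mod 2)"
        using 2 tens by (auto intro: qgrade_mult)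
      \<comment> \<open>Both groupings make the same pairs of letters pass each other. Modulo 2 the
        exponents are sums of products of parities, so the comparison is propositional.\<close>
      have "even (r' * (s + t) + s' * t + (r'' * ((s + s') mod 2 + (t + t') mod 2) + s'' * ((t + t') mod 2)))
        = even (r'' * (s' + t') + s'' * t' + (((r' + r'') mod 2) * (s + t) + ((s' + s'') mod 2) * t))"
        by (simp only: even_add even_mult_iff even_mod_2_iff) argo
      then have sgn: "(- 1 :: 'k laurent) ^ (r' * (s + t) + s' * t) * (- 1) ^ (r'' * ((s + s') mod 2 + (t + t') mod 2) + s'' * ((t + t') mod 2))
        = (- 1) ^ (r'' * (s' + t') + s'' * t') * (- 1) ^ (((r' + r'') mod 2) * (s + t) + ((s' + s'') mod 2) * t)"
        unfolding power_add[symmetric] by (rule minus_one_power_cong)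
      have "tens3 a b c * tens3 a' b' c' * tens3 a'' b'' c''
        = t3scale ((- 1) ^ (r' * (s + t) + s' * t) * (- 1) ^ (r'' * ((s + s') mod 2 + (t + t') mod 2) + s'' * ((t + t') mod 2)))
          (tens3 (a * a' * a'') (b * b' * b'') (c * c' * c''))"
        using 1 2 tens
        by (simp add: tens3_times_homogeneous[OF 1(5,6) 2(4,5)] tens3_times_homogeneous[OF bc tens(4,5)] kGL3_scale_mult)
      also have "\<dots> = tens3 a b c * (tens3 a' b' c' * tens3 a'' b'' c'')"
        unfolding sgn using 1 2 tens
        by (simp add: tens3_times_homogeneous[OF 2(5,6) tens(4,5)] tens3_times_homogeneous[OF 1(5,6) ab] kGL3_scale_mult mult.assoc)
      finally show ?case .
    qed (simp add: kGL3_distrib)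
  qed (simp add: kGL3_distrib)
qed (simp add: kGL3_distrib)

instance kGL3 :: (field, finite, finite) "{ring, monoid_mult}"
  by standard (simp_all add: kGL3_distrib kGL3_mult_1 kGL3_assoc)

interpretation GL3: gl_algebra "t3scale :: 'k::field laurent \<Rightarrow> ('k, 'm::finite, 'n::finite) kGL3 \<Rightarrow> _"
  by unfold_locales (simp_all add: kGL3_scale_mult)


section \<open>Coassociativity and counit laws\<close>

lemma append_right_bilin: "bilin2 t3scale (\<lambda>c d. tens3 c d b)"
  by (simp add: bilin2_def kGL3.module_axioms tens3_linear)

lemma append_left_bilin: "bilin2 t3scale (\<lambda>c d. tens3 a c d)"
  by (simp add: bilin2_def kGL3.module_axioms tens3_linear)

text \<open>The Koszul rule for the grouping with two legs on the left: u moves past b as a whole,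
  so only its total degree r enters the sign.\<close>

lemma append_right_mult:
  assumes "b \<in> qgrade \<beta>" "\<beta> < 2" "u \<in> t2grade r" "r < 2"
  shows "ext2 t3scale (\<lambda>c e. tens3 c e b) t * ext2 t3scale (\<lambda>c e. tens3 c e d) u
    = t3scale ((- 1) ^ (\<beta> * r)) (ext2 t3scale (\<lambda>c e. tens3 c e (b * d)) (t * u))"
proof (induction t rule: kGL2_hom_induct)
  case (tens c e \<gamma> \<epsilon>)
  note ce = tens
  show ?case
    using assms(3)
  proof (induction rule: t2grade_induct)
    case zero
    show ?case by (simp add: module_hom.zero[OF ext2_hom[OF append_right_bilin]])
  next
    case (add c' e' \<gamma>' \<epsilon>' u)
    have "even (\<gamma>' * (\<epsilon> + \<beta>) + \<epsilon>' * \<beta>) = even (\<beta> * r + \<epsilon> * \<gamma>')"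
      unfolding add(5) by (simp only: even_add even_mult_iff even_mod_2_iff) argo
    then have sgn: "(- 1 :: 'a laurent) ^ (\<gamma>' * (\<epsilon> + \<beta>) + \<epsilon>' * \<beta>) = (- 1) ^ (\<beta> * r) * (- 1) ^ (\<epsilon> * \<gamma>')"
      unfolding power_add[symmetric] by (rule minus_one_power_cong)
    have "tens3 c e b * tens3 c' e' d = t3scale ((- 1) ^ (\<beta> * r) * (- 1) ^ (\<epsilon> * \<gamma>')) (tens3 (c * c') (e * e') (b * d))"
      unfolding sgn[symmetric] using ce add assms by (intro tens3_times_homogeneous)
    with add show ?case
      using ce by (simp add: distrib_left ext2_add[OF append_right_bilin] ext2_scale[OF append_right_bilin]
        ext2_tens[OF append_right_bilin] tens2_times_homogeneous[OF ce(2) add(1) ce(4) add(3)] kGL3.scale_right_distrib)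
  qed
qed (simp add: kGL2_distrib kGL3_distrib ext2_add[OF append_right_bilin] kGL3.scale_right_distrib)

text \<open>Here the sign comes from c moving past both legs of t, so it is t that has to be
  homogeneous.\<close>

lemma append_left_mult:
  assumes "c \<in> qgrade \<gamma>" "\<gamma> < 2" "t \<in> t2grade r" "r < 2"
  shows "ext2 t3scale (\<lambda>b d. tens3 a b d) t * ext2 t3scale (\<lambda>b d. tens3 c b d) u
    = t3scale ((- 1) ^ (r * \<gamma>)) (ext2 t3scale (\<lambda>b d. tens3 (a * c) b d) (t * u))"
proof (induction u rule: kGL2_hom_induct)
  case (tens b' d' \<beta>' \<delta>')
  note bd' = tens
  show ?case
    using assms(3)
  proof (induction rule: t2grade_induct)
    case zero
    show ?case by (simp add: module_hom.zero[OF ext2_hom[OF append_left_bilin]])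
  next
    case (add b d \<beta> \<delta> t)
    have "even (\<gamma> * (\<beta> + \<delta>) + \<beta>' * \<delta>) = even (r * \<gamma> + \<delta> * \<beta>')"
      unfolding add(5) by (simp only: even_add even_mult_iff even_mod_2_iff) argo
    then have sgn: "(- 1 :: 'a laurent) ^ (\<gamma> * (\<beta> + \<delta>) + \<beta>' * \<delta>) = (- 1) ^ (r * \<gamma>) * (- 1) ^ (\<delta> * \<beta>')"
      unfolding power_add[symmetric] by (rule minus_one_power_cong)
    have "tens3 a b d * tens3 c b' d' = t3scale ((- 1) ^ (r * \<gamma>) * (- 1) ^ (\<delta> * \<beta>')) (tens3 (a * c) (b * b') (d * d'))"
      unfolding sgn[symmetric] using bd' add assms by (intro tens3_times_homogeneous)
    with add show ?case
      using bd' by (simp add: distrib_right ext2_add[OF append_left_bilin] ext2_scale[OF append_left_bilin]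
        ext2_tens[OF append_left_bilin] tens2_times_homogeneous[OF add(2) bd'(1) add(4) bd'(3)] kGL3.scale_right_distrib)
  qed
qed (simp add: kGL2_distrib kGL3_distrib ext2_add[OF append_left_bilin] kGL3.scale_right_distrib)

locale comult_hom =
  fixes f :: "('k::field, 'm::finite, 'n::finite) kGL \<Rightarrow> ('k, 'm, 'n) kGL2"
  assumes hom: "superalg_hom qscale qgrade t2scale t2grade f"
begin

lemma f_hom: "module_hom qscale t2scale f"
  and f_one: "f 1 = 1"
  and f_mult: "f (x * y) = f x * f y"
  and f_grade: "d < 2 \<Longrightarrow> x \<in> qgrade d \<Longrightarrow> f x \<in> t2grade d"
  using hom unfolding superalg_hom_def by (auto simp: less_2_cases_iff)

lemma comult_left_hom: "module_hom t2scale t3scale (comult_left f)"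
  unfolding comult_left_def
  by (rule ext2_hom) (simp add: bilin2_def kGL3.module_axioms module_hom.add[OF f_hom]
      module_hom.scale[OF f_hom] ext2_add[OF append_right_bilin] ext2_scale[OF append_right_bilin] tens3_linear
      ext2_fun_add[OF kGL3.module_axioms] ext2_fun_scale[OF kGL3.module_axioms])

lemma comult_right_hom: "module_hom t2scale t3scale (comult_right f)"
proof -
  have "ext2 t3scale (tens3 (a + a')) t = ext2 t3scale (tens3 a) t + ext2 t3scale (tens3 a') t"
    for a a' :: "('k, 'm, 'n) kGL" and t
    using ext2_fun_add[OF kGL3.module_axioms, of "tens3 a" "tens3 a'" t]
    by (simp only: tens3_linear(1)[symmetric])
  moreover have "ext2 t3scale (tens3 (qscale r a)) t = t3scale r (ext2 t3scale (tens3 a) t)"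
    for a :: "('k, 'm, 'n) kGL" and r t
    using ext2_fun_scale[OF kGL3.module_axioms, of r "tens3 a" t]
    by (simp only: tens3_linear(4)[symmetric])
  ultimately show ?thesis unfolding comult_right_def
    by (intro ext2_hom) (simp add: bilin2_def kGL3.module_axioms module_hom.add[OF f_hom]
      module_hom.scale[OF f_hom] ext2_add[OF append_left_bilin] ext2_scale[OF append_left_bilin])
qed

text \<open>Since f preserves degrees, replacing c by \<open>f c\<close> leaves the sign for passing
  b unchanged, so the Koszul rules in the square and in the cube agree.\<close>

lemma comult_left_mult: "comult_left f (t * u) = comult_left f t * comult_left f u"
proof (induction t rule: kGL2_hom_induct)
  case (tens a b \<alpha> \<beta>)
  note ab = tens
  show ?case
  proof (induction u rule: kGL2_hom_induct)
    case (tens c d \<gamma> \<delta>)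
    show ?case
      unfolding tens2_times_homogeneous[OF ab(2) tens(1) ab(4) tens(3)] module_hom.scale[OF comult_left_hom]
        comult_left_tens[OF f_hom] f_mult append_right_mult[OF ab(4,2) f_grade[OF tens(1,3)] tens(1)] ..
  qed (simp add: kGL2_distrib kGL3_distrib module_hom.add[OF comult_left_hom])
qed (simp add: kGL2_distrib kGL3_distrib module_hom.add[OF comult_left_hom])

lemma comult_right_mult: "comult_right f (t * u) = comult_right f t * comult_right f u"
proof (induction t rule: kGL2_hom_induct)
  case (tens a b \<alpha> \<beta>)
  note ab = tens
  show ?case
  proof (induction u rule: kGL2_hom_induct)
    case (tens c d \<gamma> \<delta>)
    show ?case
      unfolding tens2_times_homogeneous[OF ab(2) tens(1) ab(4) tens(3)] module_hom.scale[OF comult_right_hom]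
        comult_right_tens[OF f_hom] f_mult append_left_mult[OF tens(3,1) f_grade[OF ab(2,4)] ab(2)] ..
  qed (simp add: kGL2_distrib kGL3_distrib module_hom.add[OF comult_right_hom])
qed (simp add: kGL2_distrib kGL3_distrib module_hom.add[OF comult_right_hom])

lemma comult_left_one: "comult_left f 1 = 1"
  by (simp add: one_kGL2_def comult_left_tens[OF f_hom] f_one ext2_tens[OF append_right_bilin] one_kGL3_def)

lemma comult_right_one: "comult_right f 1 = 1"
  by (simp add: one_kGL2_def comult_right_tens[OF f_hom] f_one ext2_tens[OF append_left_bilin] one_kGL3_def)

end

locale counit_hom =
  fixes f :: "('k::field, 'm::finite, 'n::finite) kGL \<Rightarrow> 'k laurent"
  assumes hom: "superalg_hom qscale qgrade (*) laurent_grade f"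
begin

lemma f_hom: "module_hom qscale (*) f"
  and f_one: "f 1 = 1"
  and f_mult: "f (x * y) = f x * f y"
  and f_odd: "x \<in> qgrade 1 \<Longrightarrow> f x = 0"
  using hom unfolding superalg_hom_def laurent_grade_def by auto

lemma counit_left_hom: "module_hom t2scale qscale (counit_left f)"
  unfolding counit_left_def
  by (rule ext2_hom) (simp add: bilin2_def kGL.module_axioms module_hom.add[OF f_hom]
    module_hom.scale[OF f_hom] kGL.scale_left_distrib kGL.scale_right_distrib mult.commute)

lemma counit_right_hom: "module_hom t2scale qscale (counit_right f)"
  unfolding counit_right_def
  by (rule ext2_hom) (simp add: bilin2_def kGL.module_axioms module_hom.add[OF f_hom]
    module_hom.scale[OF f_hom] kGL.scale_left_distrib kGL.scale_right_distrib mult.commute)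

text \<open>A sign can only arise when c is odd, and then \<open>f c = 0\<close> makes both sides
  vanish.\<close>

lemma counit_left_mult: "counit_left f (t * u) = counit_left f t * counit_left f u"
proof (induction t rule: kGL2_hom_induct)
  case (tens a b \<alpha> \<beta>)
  note ab = tens
  show ?case
  proof (induction u rule: kGL2_hom_induct)
    case (tens c d \<gamma> \<delta>)
    have "\<gamma> = 0 \<or> f c = 0" using tens by (auto simp: less_2_cases_iff f_odd)
    then show ?case
      unfolding tens2_times_homogeneous[OF ab(2) tens(1) ab(4) tens(3)] module_hom.scale[OF counit_left_hom]
        counit_left_tens[OF f_hom] f_mult
      by (elim disjE) (simp_all only: mult_0 mult_0_right power_0 kGL.scale_one qscale_mult_left qscale_mult_right
        kGL.scale_scale mult_1_left mult.commute[of "f _" "f _"] mult_zero_left mult_zero_right kGL.scale_zero_left kGL.scale_zero_right)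
  qed (simp add: kGL2_distrib distrib_left module_hom.add[OF counit_left_hom])
qed (simp add: kGL2_distrib distrib_right module_hom.add[OF counit_left_hom])

lemma counit_right_mult: "counit_right f (t * u) = counit_right f t * counit_right f u"
proof (induction t rule: kGL2_hom_induct)
  case (tens a b \<alpha> \<beta>)
  note ab = tens
  show ?case
  proof (induction u rule: kGL2_hom_induct)
    case (tens c d \<gamma> \<delta>)
    have "\<beta> = 0 \<or> f b = 0" using ab by (auto simp: less_2_cases_iff f_odd)
    then show ?case
      unfolding tens2_times_homogeneous[OF ab(2) tens(1) ab(4) tens(3)] module_hom.scale[OF counit_right_hom]
        counit_right_tens[OF f_hom] f_mult
      by (elim disjE) (simp_all only: mult_0 mult_0_right power_0 kGL.scale_one qscale_mult_left qscale_mult_right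
        kGL.scale_scale mult_1_left mult.commute[of "f _" "f _"] mult_zero_left mult_zero_right kGL.scale_zero_left kGL.scale_zero_right)
  qed (simp add: kGL2_distrib distrib_left module_hom.add[OF counit_right_hom])
qed (simp add: kGL2_distrib distrib_right module_hom.add[OF counit_right_hom])

lemma counit_one: "counit_left f 1 = 1" "counit_right f 1 = 1"
  by (simp_all add: one_kGL2_def counit_left_tens[OF f_hom] counit_right_tens[OF f_hom] f_one)

end

section \<open>Homomorphisms are determined by the matrix generators\<close>

definition gD1 :: "('k::field, 'm::finite, 'n::finite) kGL" where "gD1 = abs_kGL fD1"

definition gD2 :: "('k::field, 'm::finite, 'n::finite) kGL" where "gD2 = abs_kGL fD2"

lemma gD1_expand: "gD1 = (\<Sum>\<sigma> | \<sigma> permutes {1..CARD('m)}. qscale ((- qinv) ^ perm_length CARD('m) \<sigma>)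
    (\<Prod>j\<leftarrow>[1..<CARD('m) + 1]. gmat (ix j) (ix (\<sigma> j)) :: ('k::field, 'm::finite, 'n::finite) kGL))"
  unfolding gD1_def fD1_def abs_kGL_sum gmat_def by (simp only: abs_kGL_prod_list qscale_abs[symmetric])

lemma gD2_expand: "gD2 = (\<Sum>\<sigma> | \<sigma> permutes {1..CARD('n)}. qscale ((- qv) ^ perm_length CARD('n) \<sigma>)
    (\<Prod>j\<leftarrow>[1..<CARD('n) + 1]. gmat (ix (CARD('m) + j)) (ix (CARD('m) + \<sigma> j)) :: ('k::field, 'm::finite, 'n::finite) kGL))"
  unfolding gD2_def fD2_def abs_kGL_sum gmat_def by (simp only: abs_kGL_prod_list qscale_abs[symmetric])

lemma gD_inverse: "gD1 * gD1_inv = 1" "gD1_inv * gD1 = 1" "gD2 * gD2_inv = 1" "gD2_inv * gD2 = 1"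
  unfolding gD1_def gD2_def gD1_inv_def gD2_inv_def times_kGL.abs_eq one_kGL.abs_eq
  by (intro abs_kGL_diff_eq_0 gl_rel_abs gl_rel.intros)+

lemma word_prod: "Poly_Mapping.single w 1 = (\<Prod>g\<leftarrow>letters w. Poly_Mapping.single (Word [g]) (1 :: 'r::comm_ring_1))"
proof -
  have "Poly_Mapping.single (Word gs) 1 = (\<Prod>g\<leftarrow>gs. Poly_Mapping.single (Word [g]) (1 :: 'r))" for gs :: "'a list"
  proof (induction gs)
    case Nil
    show ?case by (simp flip: zero_word_def)
  next
    case (Cons g gs)
    have "Word (g # gs) = Word [g] + Word gs" by (simp add: plus_word_def)
    then show ?case by (simp add: Cons[symmetric] mult_single)
  qed
  from this[of "letters w"] show ?thesis by simp
qed

context gl_algebra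
begin

lemma gl_hom_eqI:
  fixes f g :: "('k, 'm::finite, 'n::finite) kGL \<Rightarrow> 'a"
  assumes f: "module_hom qscale scale f" "f 1 = 1" "\<And>x y. f (x * y) = f x * f y"
    and g: "module_hom qscale scale g" "g 1 = 1" "\<And>x y. g (x * y) = g x * g y"
    and mat: "\<And>i j. f (gmat i j) = g (gmat i j)"
  shows "f x = g x"
proof -
  interpret f: module_hom qscale scale f by (rule f(1))
  interpret g: module_hom qscale scale g by (rule g(1))
  have prod: "f (\<Prod>a\<leftarrow>as. h a) = g (\<Prod>a\<leftarrow>as. h a)" if "\<And>a. a \<in> set as \<Longrightarrow> f (h a) = g (h a)" for as and h :: "'e \<Rightarrow> ('k, 'm, 'n) kGL"
    using that by (induction as) (simp_all add: f g)
  have inv: "f y = g y" if "d * y = 1" "y * d = 1" "f d = g d" for d y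
  proof -
    have "f y * g d = 1" using that f(2,3) by (metis)
    moreover have "g d * g y = 1" using that g(2,3) by metis
    ultimately show ?thesis by (metis mult.assoc mult_1_left mult_1_right)
  qed
  have "f gD1 = g gD1" "f gD2 = g gD2"
    unfolding gD1_expand gD2_expand f.sum g.sum f.scale g.scale by (simp_all only: prod mat)
  then have "f gD1_inv = g gD1_inv" "f gD2_inv = g gD2_inv"
    using inv gD_inverse by blast+
  then have gen: "f (abs_kGL (fgen h)) = g (abs_kGL (fgen h))" for h
    using mat by (cases h) (simp_all add: gmat_def gD1_inv_def gD2_inv_def)
  obtain x' where x: "x = abs_kGL x'" by (rule kGL_cases)
  show ?thesis
    unfolding x
  proof (induction x' rule: poly_mapping_single_induct)
    case zero
    show ?case by (simp flip: zero_kGL.abs_eq)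
  next
    case (single w c)
    have "abs_kGL (Poly_Mapping.single w c) = qscale c (\<Prod>g\<leftarrow>letters w. abs_kGL (fgen g))"
      unfolding fscale_single_1[of w c] word_prod[of w] fgen_def[symmetric] qscale_abs[symmetric] abs_kGL_prod_list ..
    then show ?case by (simp add: f.scale g.scale prod gen)
  next
    case (add x y)
    then show ?case by (simp add: f.add g.add flip: plus_kGL.abs_eq)
  qed
qed

lemma gl_map_grade:
  fixes \<phi> :: "('m::finite, 'n::finite) gen \<Rightarrow> 'a"
  assumes "respects_gl \<phi>"
    and gr: "\<And>d. 0 \<in> gr d" "\<And>d x y. x \<in> gr d \<Longrightarrow> y \<in> gr d \<Longrightarrow> x + y \<in> gr d"
      "\<And>d c x. x \<in> gr d \<Longrightarrow> scale c x \<in> gr d" "1 \<in> gr 0"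
      "\<And>d e x y. x \<in> gr d \<Longrightarrow> y \<in> gr e \<Longrightarrow> x * y \<in> gr ((d + e) mod 2)"
    and \<phi>: "\<And>g. \<phi> g \<in> gr (gpar g)"
    and "x \<in> qgrade d"
  shows "gl_map \<phi> x \<in> gr d"
proof -
  have word: "(\<Prod>g\<leftarrow>gs. \<phi> g) \<in> gr ((\<Sum>g\<leftarrow>gs. gpar g) mod 2)" for gs
  proof (induction gs)
    case (Cons g gs)
    from gr(5)[OF \<phi>[of g] this] show ?case by (simp add: mod_simps)
  qed (simp add: gr)
  obtain x' where x': "x = abs_kGL x'" by (rule kGL_cases)
  \<comment> \<open>A homogeneous element has a representative made of words of the right parity
    only, and each such word is mapped into the right component.\<close>
  have "x = abs_kGL (fpart d x')"
    using assms(8) by (simp add: qgrade_def x' qpart_abs)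
  then have "gl_map \<phi> x = (\<Sum>w\<in>Poly_Mapping.keys (fpart d x'). scale (Poly_Mapping.lookup (fpart d x') w) (\<Prod>g\<leftarrow>letters w. \<phi> g))"
    by (simp add: gl_map_abs[OF assms(1)] free_eval_def lin_ext_def)
  also have "\<dots> \<in> gr d"
  proof -
    have letters_grade: "(\<Prod>g\<leftarrow>letters w. \<phi> g) \<in> gr d" if "w \<in> Poly_Mapping.keys (fpart d x')" for w
      using word[of "letters w"] that by (auto simp: in_keys_iff lookup_fpart wpar_def split: if_splits)
    have "sum (\<lambda>w. scale (Poly_Mapping.lookup (fpart d x') w) (\<Prod>g\<leftarrow>letters w. \<phi> g)) A \<in> gr d"
      if "A \<subseteq> Poly_Mapping.keys (fpart d x')" "finite A" for A
      using that(2,1) by (induction A rule: finite_induct) (auto intro!: gr letters_grade)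
    then show ?thesis by simp
  qed
  finally show ?thesis .
qed

end


section \<open>The coalgebra\<close>

lemma num_ix: "i \<in> {1..CARD('m) + CARD('n)} \<Longrightarrow> num (ix i :: ('m::finite, 'n::finite) idx) = i"
  by (rule ix_inverse)

lemma even_block:
  "gl_block (ix :: nat \<Rightarrow> ('m::finite, 'n::finite) idx) CARD('m) 0 gD1 (gD1_inv :: ('k::field, 'm, 'n) kGL)"
  and mem_even_block: "l \<in> (ix :: nat \<Rightarrow> ('m, 'n) idx) ` {1..CARD('m)} \<longleftrightarrow> num l \<le> CARD('m)"
proof -
  have mem: "l \<in> (ix :: nat \<Rightarrow> ('m, 'n) idx) ` {1..CARD('m)} \<longleftrightarrow> num l \<le> CARD('m)" for l
  proof
    assume "num l \<le> CARD('m)"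
    then have "num l \<in> {1..CARD('m)}" using num[of l] by auto
    then show "l \<in> ix ` {1..CARD('m)}" by (metis image_eqI num_inverse)
  qed (auto simp: num_ix)
  show "l \<in> (ix :: nat \<Rightarrow> ('m, 'n) idx) ` {1..CARD('m)} \<longleftrightarrow> num l \<le> CARD('m)" by (rule mem)
  show "gl_block (ix :: nat \<Rightarrow> ('m, 'n) idx) CARD('m) 0 gD1 (gD1_inv :: ('k, 'm, 'n) kGL)"
  proof
    show "gD1 = (\<Sum>\<sigma> | \<sigma> permutes {1..CARD('m)}. qscale ((- qpow ((- 1) ^ (0 + 1))) ^ perm_length CARD('m) \<sigma>)
        (\<Prod>j\<leftarrow>[1..<CARD('m) + 1]. gmat (ix j) (ix (\<sigma> j)) :: ('k, 'm, 'n) kGL))"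
      using gD1_expand by (simp only: add_0 power_one_right)
    fix l :: "('m, 'n) idx" assume l: "l \<notin> ix ` {1..CARD('m)}"
    then show "ipar l = 1 - 0" unfolding mem by (simp add: ipar_def)
    fix i assume "i \<in> {1..CARD('m)}"
    with l show "if (0 :: nat) = 0 then num (ix i :: ('m, 'n) idx) < num l else num l < num (ix i :: ('m, 'n) idx)"
      unfolding mem by (simp add: num_ix)
  qed (simp_all add: num_ix ipar_ix gD_inverse)
qed

lemma odd_block:
  "gl_block (\<lambda>j. ix (CARD('m) + j) :: ('m::finite, 'n::finite) idx) CARD('n) 1 gD2 (gD2_inv :: ('k::field, 'm, 'n) kGL)"
  and mem_odd_block: "l \<in> (\<lambda>j. ix (CARD('m) + j) :: ('m, 'n) idx) ` {1..CARD('n)} \<longleftrightarrow> \<not> num l \<le> CARD('m)"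
proof -
  have mem: "l \<in> (\<lambda>j. ix (CARD('m) + j) :: ('m, 'n) idx) ` {1..CARD('n)} \<longleftrightarrow> \<not> num l \<le> CARD('m)" for l
  proof
    assume "\<not> num l \<le> CARD('m)"
    then have "num l - CARD('m) \<in> {1..CARD('n)}" "l = ix (CARD('m) + (num l - CARD('m)))"
      using num[of l] by (auto simp: num_inverse)
    then show "l \<in> (\<lambda>j. ix (CARD('m) + j)) ` {1..CARD('n)}" by blast
  qed (auto simp: num_ix)
  show "l \<in> (\<lambda>j. ix (CARD('m) + j) :: ('m, 'n) idx) ` {1..CARD('n)} \<longleftrightarrow> \<not> num l \<le> CARD('m)" by (rule mem)
  show "gl_block (\<lambda>j. ix (CARD('m) + j) :: ('m, 'n) idx) CARD('n) 1 gD2 (gD2_inv :: ('k, 'm, 'n) kGL)"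
  proof
    show "gD2 = (\<Sum>\<sigma> | \<sigma> permutes {1..CARD('n)}. qscale ((- qpow ((- 1) ^ (1 + 1))) ^ perm_length CARD('n) \<sigma>)
        (\<Prod>j\<leftarrow>[1..<CARD('n) + 1]. gmat (ix (CARD('m) + j)) (ix (CARD('m) + \<sigma> j)) :: ('k, 'm, 'n) kGL))"
      using gD2_expand by simp
    fix l :: "('m, 'n) idx" assume l: "l \<notin> (\<lambda>j. ix (CARD('m) + j)) ` {1..CARD('n)}"
    then show "ipar l = 1 - 1" unfolding mem by (simp add: ipar_def)
    fix i assume "i \<in> {1..CARD('n)}"
    with l show "if (1 :: nat) = 0 then num (ix (CARD('m) + i) :: ('m, 'n) idx) < num l
        else num l < num (ix (CARD('m) + i) :: ('m, 'n) idx)"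
      unfolding mem by (simp add: num_ix)
  qed (simp_all add: num_ix ipar_ix gD_inverse)
qed

lemma card_idx: "CARD(('m::finite, 'n::finite) idx) = CARD('m) + CARD('n)"
  using bij_betw_same_card[OF bij_betw_ix[where ?'m = 'm and ?'n = 'n]] by simp

lemma permutes_delta_prod:
  fixes h :: "nat \<Rightarrow> 'c"
  assumes "\<sigma> permutes {1..N}" "inj_on h {1..N}"
  shows "(\<Prod>j\<leftarrow>[1..<N + 1]. if h j = h (\<sigma> j) then 1 else 0) = (if \<sigma> = id then 1 else 0 :: 'a::comm_semiring_1)"
proof (cases "\<sigma> = id")
  case True
  have "(\<Prod>j\<leftarrow>js. 1 :: 'a) = 1" for js :: "nat list" by (induction js) simp_all
  then show ?thesis using True by simp
next
  case False
  then obtain j where j: "\<sigma> j \<noteq> j" by (auto simp: fun_eq_iff)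
  then have jN: "j \<in> {1..N}" using assms(1) by (auto simp: permutes_def)
  then have "\<sigma> j \<in> {1..N}" using permutes_in_image[OF assms(1)] by blast
  then have "h j \<noteq> h (\<sigma> j)" using assms(2) jN j by (auto dest: inj_onD)
  then have "0 \<in> set (map (\<lambda>j. if h j = h (\<sigma> j) then 1 else (0 :: 'a)) [1..<N + 1])"
    unfolding set_map using jN by (intro image_eqI[of _ _ j]) auto
  moreover have "prod_list xs = 0" if "0 \<in> set xs" for xs :: "'a list" using that by (induction xs) auto
  ultimately show ?thesis using False by (simp del: upt_Suc)
qed

text \<open>The determinant of the identity matrix, whatever the weight c: only the identity
  permutation contributes, and it has no inversions. This makes the counit of either determinant
  equal to 1.\<close>

lemma sum_permutes_delta:
  fixes h :: "nat \<Rightarrow> 'c" and c :: "'a::comm_ring_1"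
  assumes "inj_on h {1..N}"
  shows "(\<Sum>\<sigma> | \<sigma> permutes {1..N}. c ^ perm_length N \<sigma> * (\<Prod>j\<leftarrow>[1..<N + 1]. if h j = h (\<sigma> j) then 1 else 0)) = 1"
proof -
  have "perm_length N id = 0"
    by (auto simp: perm_length_def card_eq_0_iff)
  moreover have "(\<Sum>\<sigma> | \<sigma> permutes {1..N}. c ^ perm_length N \<sigma> * (\<Prod>j\<leftarrow>[1..<N + 1]. if h j = h (\<sigma> j) then 1 else 0))
      = (\<Sum>\<sigma> | \<sigma> permutes {1..N}. if \<sigma> = id then c ^ perm_length N id else 0)"
    by (rule sum.cong[OF refl], simp only: mem_Collect_eq permutes_delta_prod[OF _ assms]) auto
  ultimately show ?thesis by (simp add: finite_permutations permutes_id)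
qed

theorem proposition4p12:
  "\<exists>(\<Delta> :: ('k::alg_closed_field, 'm::finite, 'n::finite) kGL \<Rightarrow> ('k, 'm, 'n) kGL2)
     (\<epsilon> :: ('k, 'm, 'n) kGL \<Rightarrow> 'k laurent).
     superalg_hom qscale qgrade t2scale t2grade \<Delta> \<and>
     superalg_hom qscale qgrade (*) laurent_grade \<epsilon> \<and>
     (\<forall>i j. \<Delta> (gmat i j) = (\<Sum>k\<in>UNIV. gmat i k \<otimes> gmat k j)) \<and>
     \<Delta> gD1_inv =
       (\<Sum>i = 1..2 * CARD('m) * CARD('n) + 2. t2scale ((- 1) ^ (i - 1))
         (unit_inv (gl_R 0) *
          (unit_inv (gl_R 0) * (\<Sum>j = 1..CARD('m). t2scale (qpow (- 2 * int j)) (gl_R j))) ^ (i - 1))) \<and>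
     \<Delta> gD2_inv =
       (\<Sum>i = 1..2 * CARD('m) * CARD('n) + 2. t2scale ((- 1) ^ (i - 1))
         (unit_inv (gl_S 0) *
          (unit_inv (gl_S 0) * (\<Sum>j = 1..CARD('n). t2scale (qpow (- 2 * int j)) (gl_S j))) ^ (i - 1))) \<and>
     (\<forall>i j. \<epsilon> (gmat i j) = (if i = j then 1 else 0)) \<and>
     \<epsilon> gD1_inv = 1 \<and> \<epsilon> gD2_inv = 1 \<and>
     coalgebra \<Delta> \<epsilon>"
proof -
  interpret B1: gl_block "ix :: nat \<Rightarrow> ('m, 'n) idx" "CARD('m)" 0 gD1 "gD1_inv :: ('k, 'm, 'n) kGL"
    by (rule even_block)
  interpret B2: gl_block "\<lambda>j. ix (CARD('m) + j) :: ('m, 'n) idx" "CARD('n)" 1 gD2 "gD2_inv :: ('k, 'm, 'n) kGL"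
    by (rule odd_block)
  \<comment> \<open>The number of terms in the statement. For both blocks the bound on words in odd
    letters is m n, and K exceeds it; powers of exponent m n + 1 and above are 0.\<close>
  define K where "K = 2 * CARD('m) * CARD('n) + 2"
  have R: "gl_R i = B1.coD i" for i
  proof -
    have "{j \<in> {1..CARD('m)}. num (k j) > CARD('m)} = {j \<in> {1..CARD('m)}. k j \<notin> ix ` {1..CARD('m)}}"
      for k :: "nat \<Rightarrow> ('m, 'n) idx"
      by (auto simp only: mem_even_block not_le)
    then show ?thesis
      unfolding gl_R_def B1.coD_def B1.coterm_def by simp
  qed
  have S: "gl_S i = B2.coD i" for i
  proof -
    have "{j \<in> {1..CARD('n)}. num (k j) \<le> CARD('m)} = {j \<in> {1..CARD('n)}. k j \<notin> (\<lambda>j. ix (CARD('m) + j)) ` {1..CARD('n)}}"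
      for k :: "nat \<Rightarrow> ('m, 'n) idx"
      by (auto simp only: mem_odd_block not_not)
    then show ?thesis
      unfolding gl_S_def B2.coD_def B2.coterm_def by simp
  qed
  have card1: "card (- (ix ` {1..CARD('m)} :: ('m, 'n) idx set)) = CARD('n)"
    by (simp add: Compl_eq_Diff_UNIV card_Diff_subset card_image[OF B1.b_inj] card_idx del: One_nat_def)
  have card2: "card (- ((\<lambda>j. ix (CARD('m) + j)) ` {1..CARD('n)} :: ('m, 'n) idx set)) = CARD('m)"
    by (simp add: Compl_eq_Diff_UNIV card_Diff_subset card_image[OF B2.b_inj] card_idx del: One_nat_def)
  define \<phi> :: "('m, 'n) gen \<Rightarrow> ('k, 'm, 'n) kGL2" where
    "\<phi> g = (case g of Mat i j \<Rightarrow> comat i j | D1_inv \<Rightarrow> B1.coD_inv K | D2_inv \<Rightarrow> B2.coD_inv K)" for g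
  have \<phi>: "\<phi> (Mat i j) = comat i j" "\<phi> D1_inv = B1.coD_inv K" "\<phi> D2_inv = B2.coD_inv K" for i j
    by (simp_all add: \<phi>_def)
  have K1: "CARD('m) * card (- (ix ` {1..CARD('m)} :: ('m, 'n) idx set)) < K"
    unfolding card1 K_def by simp
  have K2: "CARD('n) * card (- ((\<lambda>j. ix (CARD('m) + j)) ` {1..CARD('n)} :: ('m, 'n) idx set)) < K"
    unfolding card2 K_def by (simp add: mult.commute)
  have eval1: "GL2.free_eval \<phi> fD1 = (\<Sum>i\<le>CARD('m). B1.coD i)"
    unfolding fD1_def B1.sum_coD
    by (simp add: GL2.free_eval_simps GL2.free_eval_prod_list GL2.free_eval_fgen \<phi> del: upt_Suc)
  have eval2: "GL2.free_eval \<phi> fD2 = (\<Sum>i\<le>CARD('n). B2.coD i)"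
    unfolding fD2_def B2.sum_coD
    by (simp add: GL2.free_eval_simps GL2.free_eval_prod_list GL2.free_eval_fgen \<phi> del: upt_Suc)
  \<comment> \<open>The images of the two determinants are the sums of the \<open>coD i\<close>, so
    the relations for the adjoined inverses are exactly the identities of
    \<open>coD_inverse\<close>.\<close>
  have resp: "GL2.respects_gl \<phi>"
    by (rule GL2.respects_glI)
      (simp_all only: \<phi> gl_matrix_comat eval1 eval2 B1.coD_inverse[OF K1] B2.coD_inverse[OF K2])
  define \<psi> :: "('m, 'n) gen \<Rightarrow> 'k laurent" where
    "\<psi> g = (case g of Mat i j \<Rightarrow> if i = j then 1 else 0 | _ \<Rightarrow> 1)" for g
  have \<psi>: "\<psi> (Mat i j) = (if i = j then 1 else 0)" "\<psi> D1_inv = 1" "\<psi> D2_inv = 1" for i j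
    by (simp_all add: \<psi>_def)
  have "ground.free_eval \<psi> fD1 = 1"
    unfolding fD1_def using sum_permutes_delta[OF B1.b_inj]
    by (simp only: ground.free_eval_simps ground.free_eval_prod_list ground.free_eval_fgen \<psi>)
  moreover have "ground.free_eval \<psi> fD2 = 1"
    unfolding fD2_def using sum_permutes_delta[OF B2.b_inj]
    by (simp only: ground.free_eval_simps ground.free_eval_prod_list ground.free_eval_fgen \<psi>)
  ultimately have resp': "ground.respects_gl \<psi>"
    using gl_matrix_counit by (intro ground.respects_glI) (simp_all add: \<psi>)
  define \<Delta> where "\<Delta> = GL2.gl_map \<phi>"
  define \<epsilon> where "\<epsilon> = ground.gl_map \<psi>"
  have \<phi>_grade: "\<phi> g \<in> t2grade (gpar g)" for g
    by (cases g) (simp_all only: \<phi> gpar.simps t2grade_comat B1.coD_inv_even B2.coD_inv_even)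
  have \<psi>_grade: "\<psi> g \<in> laurent_grade (gpar g)" for g
    by (cases g) (auto simp: \<psi> laurent_grade_def apar_def)
  have \<Delta>_grade: "\<Delta> x \<in> t2grade d" if "x \<in> qgrade d" for x d
    unfolding \<Delta>_def
    by (rule GL2.gl_map_grade[OF resp t2grade_zero t2grade_add t2grade_scale t2grade_one t2grade_mult[OF _ _ refl] \<phi>_grade that])
  have \<epsilon>_grade: "\<epsilon> x \<in> laurent_grade d" if "x \<in> qgrade d" for x d
    unfolding \<epsilon>_def
    by (rule ground.gl_map_grade[OF resp' _ _ _ _ _ \<psi>_grade that]) (auto simp: laurent_grade_def split: if_splits)
  have \<Delta>_hom: "superalg_hom qscale qgrade t2scale t2grade \<Delta>"
    unfolding superalg_hom_def using \<Delta>_grade GL2.gl_map_hom[OF resp] GL2.gl_map_one[OF resp] GL2.gl_map_mult[OF resp]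
    by (simp add: \<Delta>_def)
  have \<epsilon>_hom: "superalg_hom qscale qgrade (*) laurent_grade \<epsilon>"
    unfolding superalg_hom_def using \<epsilon>_grade ground.gl_map_hom[OF resp'] ground.gl_map_one[OF resp'] ground.gl_map_mult[OF resp']
    by (simp add: \<epsilon>_def)
  interpret \<Delta>: comult_hom \<Delta> by (rule comult_hom.intro[OF \<Delta>_hom])
  interpret \<epsilon>: counit_hom \<epsilon> by (rule counit_hom.intro[OF \<epsilon>_hom])
  have \<Delta>_gmat: "\<Delta> (gmat i j) = (\<Sum>k\<in>UNIV. gmat i k \<otimes> gmat k j)" for i j
    by (simp add: \<Delta>_def gmat_def[of i j] GL2.gl_map_gen[OF resp] \<phi> comat_def)
  have \<Delta>_D: "\<Delta> gD1_inv = B1.coD_inv K" "\<Delta> gD2_inv = B2.coD_inv K"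
    by (simp_all add: \<Delta>_def gD1_inv_def gD2_inv_def GL2.gl_map_gen[OF resp] \<phi>)
  have \<epsilon>_gmat: "\<epsilon> (gmat i j) = (if i = j then 1 else 0)" for i j
    by (simp add: \<epsilon>_def gmat_def ground.gl_map_gen[OF resp'] \<psi>)
  have \<epsilon>_D: "\<epsilon> gD1_inv = 1" "\<epsilon> gD2_inv = 1"
    by (simp_all add: \<epsilon>_def gD1_inv_def gD2_inv_def ground.gl_map_gen[OF resp'] \<psi>)
  have "comult_left \<Delta> (\<Delta> x) = comult_right \<Delta> (\<Delta> x)" for x
  proof (rule GL3.gl_hom_eqI[where f = "\<lambda>x. comult_left \<Delta> (\<Delta> x)" and g = "\<lambda>x. comult_right \<Delta> (\<Delta> x)"])
    show "module_hom qscale t3scale (\<lambda>x. comult_left \<Delta> (\<Delta> x))"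
      using module_hom_compose[OF \<Delta>.f_hom \<Delta>.comult_left_hom] by (simp add: comp_def)
    show "module_hom qscale t3scale (\<lambda>x. comult_right \<Delta> (\<Delta> x))"
      using module_hom_compose[OF \<Delta>.f_hom \<Delta>.comult_right_hom] by (simp add: comp_def)
    \<comment> \<open>Both sides are the double sum of the elements
      \<open>tens3 (gmat i k) (gmat k l) (gmat l j)\<close>, with the two summations in opposite
      orders.\<close>
    show "comult_left \<Delta> (\<Delta> (gmat i j)) = comult_right \<Delta> (\<Delta> (gmat i j))" for i j
      unfolding \<Delta>_gmat module_hom.sum[OF \<Delta>.comult_left_hom] module_hom.sum[OF \<Delta>.comult_right_hom]
        comult_left_tens[OF \<Delta>.f_hom] comult_right_tens[OF \<Delta>.f_hom] module_hom.sum[OF ext2_hom[OF append_right_bilin]]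
        module_hom.sum[OF ext2_hom[OF append_left_bilin]] ext2_tens[OF append_right_bilin] ext2_tens[OF append_left_bilin]
      by (rule sum.swap)
  qed (simp_all add: \<Delta>.f_one \<Delta>.f_mult \<Delta>.comult_left_one \<Delta>.comult_right_one \<Delta>.comult_left_mult \<Delta>.comult_right_mult)
  moreover have "counit_left \<epsilon> (\<Delta> x) = x" for x
  proof (rule GL.gl_hom_eqI[where f = "\<lambda>x. counit_left \<epsilon> (\<Delta> x)" and g = "\<lambda>x. x"])
    show "module_hom qscale qscale (\<lambda>x. counit_left \<epsilon> (\<Delta> x))"
      using module_hom_compose[OF \<Delta>.f_hom \<epsilon>.counit_left_hom] by (simp add: comp_def)
    show "counit_left \<epsilon> (\<Delta> (gmat i j)) = gmat i j" for i j
    proof -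
      have "counit_left \<epsilon> (\<Delta> (gmat i j)) = (\<Sum>k\<in>UNIV. if k = i then gmat k j else 0)"
        unfolding \<Delta>_gmat module_hom.sum[OF \<epsilon>.counit_left_hom] counit_left_tens[OF \<epsilon>.f_hom] \<epsilon>_gmat
        by (rule sum.cong) auto
      then show ?thesis by simp
    qed
  qed (simp_all add: \<Delta>.f_one \<Delta>.f_mult \<epsilon>.counit_one \<epsilon>.counit_left_mult kGL.module_hom_ident)
  moreover have "counit_right \<epsilon> (\<Delta> x) = x" for x
  proof (rule GL.gl_hom_eqI[where f = "\<lambda>x. counit_right \<epsilon> (\<Delta> x)" and g = "\<lambda>x. x"])
    show "module_hom qscale qscale (\<lambda>x. counit_right \<epsilon> (\<Delta> x))"
      using module_hom_compose[OF \<Delta>.f_hom \<epsilon>.counit_right_hom] by (simp add: comp_def)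
    show "counit_right \<epsilon> (\<Delta> (gmat i j)) = gmat i j" for i j
    proof -
      have "counit_right \<epsilon> (\<Delta> (gmat i j)) = (\<Sum>k\<in>UNIV. if k = j then gmat i k else 0)"
        unfolding \<Delta>_gmat module_hom.sum[OF \<epsilon>.counit_right_hom] counit_right_tens[OF \<epsilon>.f_hom] \<epsilon>_gmat
        by (rule sum.cong) auto
      then show ?thesis by simp
    qed
  qed (simp_all add: \<Delta>.f_one \<Delta>.f_mult \<epsilon>.counit_one \<epsilon>.counit_right_mult kGL.module_hom_ident)
  ultimately have coalg: "coalgebra \<Delta> \<epsilon>"
    unfolding coalgebra_def using \<Delta>.f_hom \<epsilon>.f_hom by blast
  note \<Delta>_D' = \<Delta>_D[unfolded B1.coD_inv_def B2.coD_inv_def K_def, folded R S]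
  show ?thesis
    using \<Delta>_hom \<epsilon>_hom \<Delta>_gmat \<Delta>_D' \<epsilon>_gmat \<epsilon>_D coalg by blast
qed

end
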